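(* For every $\varepsilon>0$ there exist $k_0$ and $C$ such that for all integers $k>k_0$ and all positive integers $n$ with $n/\sqrt{k}>C$ we have \[ (1-\varepsilon)\cdot\frac{2n}{\sqrt{k}}\ \le\ \mathbf{E}\left[L(\Sigma(K_{n,n};k))\right]\ \le\ (1+\varepsilon)\cdot\frac{2n}{\sqrt{k}}. \] Moreover, there is an exponentially small tail bound: for every $\varepsilon>0$ there exists $c>0$ such that for all $k$ and $n$ as in the previous sentence (i.e. $k>k_0$ and $n/\sqrt{k}>C$, with $k_0,C$ depending on $\varepsilon$), \[ \mathbf{P}\left[\left|L(\Sigma(K_{n,n};k))-\frac{2n}{\sqrt{k}}\right|\ge\varepsilon\,\frac{2n}{\sqrt{k}}\right]\le e^{-cn/\sqrt{k}}. \]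
   Context: Random words model: let $K_{n,n}$ be the complete bipartite graph with disjoint color classes $A$ and $B$, each totally ordered, with the elements of each class numbered $1,\dots,n$ in order. $\Sigma(K_{n,n};k)$ denotes the random subgraph of $K_{n,n}$ (and its distribution) obtained by assigning to each of the $2n$ nodes, uniformly and independently, one of $k$ characters, and keeping exactly those edges whose two endpoints are assigned equal characters. Two distinct edges $ab$ and $a'b'$ (with $a,a'\in A$, $b,b'\in B$) are noncrossing if $a<a'$ and $b<b'$, or $a'<a$ and $b'<b$. A matching is planar if every two distinct edges of it are noncrossing. For a bipartite graph $G$ with ordered color classes, $L(G)$ is the number of edges of a maximum size planar matching in $G$; $L(\Sigma(K_{n,n};k))$ is the random variable $L(G)$ with $G$ distributed as $\Sigma(K_{n,n};k)$. (Equivalently, it is the length of the longest common subsequence of two independent uniformly random words of length $n$ over a $k$-letter alphabet.) *)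

theory Defs
  imports "HOL-Probability.Probability"
begin

text \<open>
  A bipartite graph with ordered colour classes is represented by its set of edges: the pair
  \<open>(a, b)\<close> is the edge between the node \<open>a\<close> of the class \<open>A\<close> and the node \<open>b\<close> of the class \<open>B\<close>.
  The classes are kept apart by the position in the pair, so they are disjoint even if
  both are numbered by \<open>{1..n}\<close>.
\<close>

definition noncrossing :: "'a::linorder \<times> 'b::linorder \<Rightarrow> 'a \<times> 'b \<Rightarrow> bool" where
  "noncrossing e f \<longleftrightarrow>
     fst e < fst f \<and> snd e < snd f \<or> fst f < fst e \<and> snd f < snd e"

definition matching :: "('a \<times> 'b) set \<Rightarrow> bool" where
  "matching M \<longleftrightarrow> (\<forall>e\<in>M. \<forall>f\<in>M. e \<noteq> f \<longrightarrow> fst e \<noteq> fst f \<and> snd e \<noteq> snd f)"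

definition planar_matching :: "('a::linorder \<times> 'b::linorder) set \<Rightarrow> bool" where
  "planar_matching M \<longleftrightarrow> matching M \<and> (\<forall>e\<in>M. \<forall>f\<in>M. e \<noteq> f \<longrightarrow> noncrossing e f)"

text \<open>Only meaningful for finite \<open>G\<close>; the empty matching makes the set below nonempty.\<close>

definition max_planar_matching :: "('a::linorder \<times> 'b::linorder) set \<Rightarrow> nat" where
  "max_planar_matching G = Max (card ` {M. M \<subseteq> G \<and> planar_matching M})"

definition complete_bipartite :: "nat \<Rightarrow> (nat \<times> nat) set" where
  "complete_bipartite n = {1..n} \<times> {1..n}"

text \<open>
  The nodes of \<open>A\<close> are \<open>Inl 1, \<dots>, Inl n\<close>, those of \<open>B\<close> are \<open>Inr 1, \<dots>, Inr n\<close>, and the characters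
  are \<open>0, \<dots>, k - 1\<close>. The value \<open>0\<close> assigned outside the node set is never used.
  For \<open>k = 0\<close> the distribution is unspecified.
\<close>

definition random_characters :: "nat \<Rightarrow> nat \<Rightarrow> (nat + nat \<Rightarrow> nat) pmf" where
  "random_characters n k = Pi_pmf ({1..n} <+> {1..n}) 0 (\<lambda>_. pmf_of_set {..<k})"

definition random_words_graph :: "nat \<Rightarrow> nat \<Rightarrow> (nat \<times> nat) set pmf" where
  "random_words_graph n k =
     map_pmf (\<lambda>w. {(a, b) \<in> complete_bipartite n. w (Inl a) = w (Inr b)})
       (random_characters n k)"

end

theory Submission
  imports Defs
begin

text \<open>
  Independent edges. If each edge is present independently with probability \<open>p\<close>, independent
  Bernoulli sources and sinks can be put on the axes such that the increments of the last passage
  time along the far sides are again independent Bernoulli variables (Burke's property of the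
  discrete Hammersley process). The passage time with boundary is then a sum of two binomial
  variables. It dominates the length of a maximum planar matching of an \<open>n \<times> m\<close> grid, which gives
  \<open>(l n + m / l) \<surd>p\<close> as an upper bound for every \<open>l > 0\<close>, with exponential tails. The lower bound
  \<open>2 n \<surd>p\<close> for \<open>n = m\<close> follows because the stationary path with \<open>l = 1\<close> must leave the axes close to
  the origin: leaving at distance \<open>z\<close> leaves an \<open>(n - z) \<times> n\<close> grid, for which the upper bound with a
  slightly larger \<open>l\<close> is too small.

  Words. On blocks of side \<open>O(\<surd>k)\<close> the match graph of two random words is close to independent edges
  with \<open>p = 1 / k\<close> in total variation as \<open>k\<close> grows. The lower bound follows by concatenating
  independent blocks. For the upper bound a long common subsequence is cut at every
  \<open>(q + 1)\<close>-st edge, and the exponential bound for a block beats the sum over all positions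
  of the cuts.
\<close>

subsection \<open>Planar matchings as increasing lists of edges\<close>

text \<open>The constant 2 is the minimum of l + 1 / l, attained at l = 1. After an exit at relative
  distance rho the optimal l gives rho + 2 sqrt (1 - rho), which is below 2 for rho > 0; this strict
  gap is what excludes distant exits. The comparison with independent edges is the bottleneck: on
  blocks of side R sqrt k its error is of order R^3 / sqrt k, which is not exponentially small and
  grows with R. It is therefore applied only at bounded scaled size, with k large depending on that
  size, and the decay in n / sqrt k comes from multiplying over many independent pieces of the
  words. In the upper bound a cut ranges over about sqrt k positions in each word, so about k
  choices, while its edge has probability 1 / k. The entropy of a cut is thus bounded uniformly in
  k, and a fixed large number q of edges per block pays for it. In the lower bound a single block
  fails with a small constant probability; Chernoff's method over many blocks makes this
  exponentially small.\<close>

definition asc :: "(nat \<times> nat) list \<Rightarrow> bool" where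
  "asc = sorted_wrt (\<lambda>p q. fst p < fst q \<and> snd p < snd q)"

lemma asc_append:
  "asc (ps @ qs) \<longleftrightarrow> asc ps \<and> asc qs \<and> (\<forall>p\<in>set ps. \<forall>q\<in>set qs. fst p < fst q \<and> snd p < snd q)"
  by (simp add: asc_def sorted_wrt_append)

lemma asc_Cons:
  "asc (p # qs) \<longleftrightarrow> asc qs \<and> (\<forall>q\<in>set qs. fst p < fst q \<and> snd p < snd q)"
  by (auto simp add: asc_def)

lemma asc_Nil [simp]: "asc []"
  by (simp add: asc_def)

lemma asc_map:
  assumes "asc ps" "\<And>p q. p \<in> set ps \<Longrightarrow> q \<in> set ps \<Longrightarrow> fst p < fst q \<Longrightarrow> snd p < snd q \<Longrightarrow>
    fst (f p) < fst (f q) \<and> snd (f p) < snd (f q)"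
  shows "asc (map f ps)"
  using assms unfolding asc_def sorted_wrt_map
  by (auto intro: sorted_wrt_mono_rel[rotated])

lemma asc_distinct: "asc ps \<Longrightarrow> distinct ps"
  by (induction ps) (auto simp: asc_Cons)

lemma asc_planar_matching: "asc ps \<Longrightarrow> planar_matching (set ps)"
proof (induction ps)
  case Nil
  then show ?case by (simp add: planar_matching_def matching_def)
next
  case (Cons p ps)
  then have "planar_matching (set ps)" "\<forall>q\<in>set ps. fst p < fst q \<and> snd p < snd q"
    by (auto simp: asc_Cons)
  then show ?case
    unfolding planar_matching_def matching_def noncrossing_def by fastforce
qed

text \<open>Distinct edges of a matching have distinct first coordinates, so \<open>M\<close> is the
  graph of a function \<open>g\<close>. Sorting the first coordinates lists the edges, and
  \<open>noncrossing\<close> makes the second coordinates increase as well.\<close>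

lemma planar_matching_asc:
  fixes M :: "(nat \<times> nat) set"
  assumes "finite M" "planar_matching M"
  shows "\<exists>ps. asc ps \<and> set ps = M \<and> length ps = card M"
proof -
  have inj: "inj_on fst M"
    using assms by (auto simp: inj_on_def planar_matching_def matching_def)
  define g where "g = the_inv_into M fst"
  have g: "g (fst p) = p" if "p \<in> M" for p
    using the_inv_into_f_f[OF inj that] by (simp add: g_def)
  define xs where "xs = sorted_list_of_set (fst ` M)"
  have sxs: "set xs = fst ` M" "sorted_wrt (<) xs" "length xs = card M"
    using assms by (auto simp: xs_def card_image inj)
  have "asc (map g xs)"
    unfolding asc_def sorted_wrt_map
  proof (rule sorted_wrt_mono_rel[OF _ sxs(2)])
    fix a b assume "a \<in> set xs" "b \<in> set xs" "a < b"
    then obtain p q where "p \<in> M" "q \<in> M" "a = fst p" "b = fst q"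
      using sxs(1) by auto
    then show "fst (g a) < fst (g b) \<and> snd (g a) < snd (g b)"
      using g \<open>a < b\<close> assms(2) unfolding planar_matching_def noncrossing_def
      by (metis less_asym less_irrefl)
  qed
  moreover have "set (map g xs) = M"
    using sxs(1) g by (force simp: image_iff)
  ultimately show ?thesis
    using sxs(3) by (metis length_map)
qed

text \<open>Prefixes of increasing lists are increasing, so length exactly \<open>l\<close> can be
  demanded. The criterion replaces the maximum by explicit lists, which can be shifted, appended and
  cut.\<close>

lemma max_planar_matching_ge_iff:
  fixes G :: "(nat \<times> nat) set"
  assumes "finite G"
  shows "l \<le> max_planar_matching G \<longleftrightarrow> (\<exists>ps. asc ps \<and> length ps = l \<and> set ps \<subseteq> G)"
proof
  let ?S = "card ` {M. M \<subseteq> G \<and> planar_matching M}"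
  have fin: "finite ?S"
    using assms by simp
  have "{} \<in> {M. M \<subseteq> G \<and> planar_matching M}"
    by (simp add: planar_matching_def matching_def)
  then have ne: "?S \<noteq> {}"
    by blast
  {
    assume l: "l \<le> max_planar_matching G"
    have "Max ?S \<in> ?S"
      by (rule Max_in[OF fin ne])
    then obtain M where M: "M \<subseteq> G" "planar_matching M" "l \<le> card M"
      using l unfolding max_planar_matching_def by auto
    then obtain ps where ps: "asc ps" "set ps = M" "length ps = card M"
      using planar_matching_asc finite_subset[OF _ assms] by metis
    have "asc (take l ps)"
      using ps(1) append_take_drop_id[of l ps] asc_append by metis
    then show "\<exists>ps. asc ps \<and> length ps = l \<and> set ps \<subseteq> G"
      using ps M set_take_subset[of l ps]
      by (intro exI[of _ "take l ps"]) auto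
  next
    assume "\<exists>ps. asc ps \<and> length ps = l \<and> set ps \<subseteq> G"
    then obtain ps where ps: "asc ps" "length ps = l" "set ps \<subseteq> G"
      by blast
    then have "l = card (set ps)"
      by (simp add: asc_distinct distinct_card)
    then have "l \<in> ?S"
      using ps asc_planar_matching by blast
    then show "l \<le> max_planar_matching G"
      unfolding max_planar_matching_def using fin by simp
  }
qed

lemma max_planar_matching_mono:
  fixes G :: "(nat \<times> nat) set"
  assumes "finite H" "G \<subseteq> H"
  shows "max_planar_matching G \<le> max_planar_matching H"
proof -
  have "finite G"
    using assms finite_subset by blast
  then show ?thesis
    using max_planar_matching_ge_iff[of G] max_planar_matching_ge_iff[of H] assms by blast
qed

lemma max_planar_matching_le_rows:
  assumes "G \<subseteq> {1..n} \<times> {1..m::nat}"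
  shows "max_planar_matching G \<le> n"
proof -
  have fin: "finite G"
    using assms finite_subset by blast
  obtain ps where ps: "asc ps" "length ps = max_planar_matching G" "set ps \<subseteq> G"
    using max_planar_matching_ge_iff[OF fin] by blast
  have "distinct (map fst ps)"
    using ps(1) by (induction ps) (auto simp: asc_Cons)
  then have "length ps = card (set (map fst ps))"
    by (metis distinct_card length_map)
  also have "\<dots> \<le> card {1..n}"
    using ps assms by (intro card_mono) fastforce+
  finally show ?thesis
    using ps by simp
qed

subsection \<open>Match graphs of words\<close>

text \<open>Positions count from 1, as the nodes of \<open>complete_bipartite\<close> do, hence the
  shift in the list indices.\<close>

definition match_graph :: "'c list \<Rightarrow> 'c list \<Rightarrow> (nat \<times> nat) set" where
  "match_graph xs ys =
     {(a, b). a \<in> {1..length xs} \<and> b \<in> {1..length ys} \<and> xs ! (a - 1) = ys ! (b - 1)}"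

lemma match_graph_subset: "match_graph xs ys \<subseteq> {1..length xs} \<times> {1..length ys}"
  by (auto simp: match_graph_def)

lemma finite_match_graph [simp]: "finite (match_graph xs ys)"
  by (rule finite_subset[OF match_graph_subset]) simp

abbreviation lcs :: "'c list \<Rightarrow> 'c list \<Rightarrow> nat" where
  "lcs xs ys \<equiv> max_planar_matching (match_graph xs ys)"

text \<open>Edges of the second pair, shifted by the lengths of the first words, lie strictly beyond
  all edges of the first pair. This superadditivity feeds the lower bound.\<close>

lemma lcs_append:
  "lcs xs ys + lcs xs' ys' \<le> lcs (xs @ xs') (ys @ ys')"
proof -
  obtain ps where ps: "asc ps" "length ps = lcs xs ys" "set ps \<subseteq> match_graph xs ys"
    using max_planar_matching_ge_iff[OF finite_match_graph] by blast
  obtain qs where qs: "asc qs" "length qs = lcs xs' ys'" "set qs \<subseteq> match_graph xs' ys'"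
    using max_planar_matching_ge_iff[OF finite_match_graph] by blast
  define f where "f = (\<lambda>p::nat \<times> nat. (length xs + fst p, length ys + snd p))"
  have "asc (map f qs)"
    by (rule asc_map[OF qs(1)]) (auto simp: f_def)
  moreover have "fst p \<le> length xs \<and> snd p \<le> length ys" if "p \<in> set ps" for p
    using ps(3) that by (auto simp: match_graph_def)
  moreover have "fst q > length xs \<and> snd q > length ys" if "q \<in> set (map f qs)" for q
    using qs(3) that by (auto simp: match_graph_def f_def)
  ultimately have "asc (ps @ map f qs)"
    unfolding asc_append using ps(1) by (meson order_le_less_trans)
  moreover have "set (ps @ map f qs) \<subseteq> match_graph (xs @ xs') (ys @ ys')"
  proof -
    have "f q \<in> match_graph (xs @ xs') (ys @ ys')" if "q \<in> match_graph xs' ys'" for q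
      using that by (auto simp: match_graph_def f_def nth_append)
    moreover have "match_graph xs ys \<subseteq> match_graph (xs @ xs') (ys @ ys')"
      by (auto simp: match_graph_def nth_append)
    ultimately show ?thesis
      using ps(3) qs(3) by auto
  qed
  ultimately show ?thesis
    using max_planar_matching_ge_iff[OF finite_match_graph] ps(2) qs(2)
    by (metis length_append length_map)
qed

text \<open>The edge with index \<open>l\<close> of an increasing list serves as the cut. It is
  counted on neither side, hence the \<open>+ 1\<close>.\<close>

lemma lcs_cut:
  assumes "l + 1 + l' \<le> lcs xs ys"
  shows "\<exists>i<length xs. \<exists>j<length ys. xs ! i = ys ! j \<and> l \<le> lcs (take i xs) (take j ys) \<and>
    l' \<le> lcs (drop (Suc i) xs) (drop (Suc j) ys)"
proof -
  obtain rs where rs: "asc rs" "length rs = l + 1 + l'" "set rs \<subseteq> match_graph xs ys"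
    using max_planar_matching_ge_iff[OF finite_match_graph] assms by blast
  define ps c qs where "ps = take l rs" and "c = rs ! l" and "qs = drop (Suc l) rs"
  have eq: "rs = ps @ c # qs" and len: "length ps = l" "length qs = l'"
    using rs(2) by (auto simp: ps_def c_def qs_def id_take_nth_drop)
  have "c \<in> match_graph xs ys"
    using rs(3) eq by auto
  then obtain i j where c: "c = (Suc i, Suc j)" and ij: "i < length xs" "j < length ys" "xs ! i = ys ! j"
    unfolding match_graph_def by (cases c) (auto simp: gr0_conv_Suc Suc_le_eq)
  define f where "f = (\<lambda>p::nat \<times> nat. (fst p - Suc i, snd p - Suc j))"
  have asc: "asc ps" "asc qs" "\<And>p. p \<in> set ps \<Longrightarrow> fst p < Suc i \<and> snd p < Suc j"
      "\<And>q. q \<in> set qs \<Longrightarrow> Suc i < fst q \<and> Suc j < snd q"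
    using rs(1) unfolding eq asc_append asc_Cons c by auto
  have ps: "set ps \<subseteq> match_graph (take i xs) (take j ys)"
  proof
    fix p assume "p \<in> set ps"
    then have "p \<in> match_graph xs ys" "fst p < Suc i" "snd p < Suc j"
      using asc(3) rs(3) eq by auto
    then show "p \<in> match_graph (take i xs) (take j ys)"
      using ij by (auto simp: match_graph_def)
  qed
  have "set (map f qs) \<subseteq> match_graph (drop (Suc i) xs) (drop (Suc j) ys)"
  proof -
    have "f q \<in> match_graph (drop (Suc i) xs) (drop (Suc j) ys)" if "q \<in> set qs" for q
    proof -
      obtain a b where "fst q = Suc (Suc i + a)" "snd q = Suc (Suc j + b)"
        using asc(4)[OF \<open>q \<in> set qs\<close>] by (meson less_imp_Suc_add)
      then have q: "q = (Suc i + Suc a, Suc j + Suc b)"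
        by (simp add: prod_eq_iff)
      have "q \<in> match_graph xs ys"
        using that rs(3) eq by auto
      then show ?thesis
        using ij by (auto simp: match_graph_def f_def q)
    qed
    then show ?thesis
      by auto
  qed
  moreover have "asc (map f qs)"
    using asc(2)
  proof (rule asc_map)
    fix p q assume "p \<in> set qs" "q \<in> set qs" "fst p < fst q" "snd p < snd q"
    then show "fst (f p) < fst (f q) \<and> snd (f p) < snd (f q)"
      using asc(4)[of p] asc(4)[of q] by (auto simp: f_def)
  qed
  ultimately have "l' \<le> lcs (drop (Suc i) xs) (drop (Suc j) ys)"
    using max_planar_matching_ge_iff[OF finite_match_graph] len by (metis length_map)
  moreover have "l \<le> lcs (take i xs) (take j ys)"
    using max_planar_matching_ge_iff[OF finite_match_graph] ps asc(1) len by blast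
  ultimately show ?thesis
    using ij by blast
qed

subsection \<open>Last passage with sources and sinks\<close>

text \<open>Points on the axes carry the sources (horizontal) and sinks (vertical). A path first follows
  one axis and collects the points there, then leaves it and is strictly increasing.\<close>

fun passage :: "(nat \<times> nat \<Rightarrow> bool) \<Rightarrow> nat \<Rightarrow> nat \<Rightarrow> nat" where
  "passage w 0 0 = 0"
| "passage w (Suc x) 0 = passage w x 0 + of_bool (w (Suc x, 0))"
| "passage w 0 (Suc y) = passage w 0 y + of_bool (w (0, Suc y))"
| "passage w (Suc x) (Suc y) =
     max (max (passage w x (Suc y)) (passage w (Suc x) y)) (passage w x y + of_bool (w (Suc x, Suc y)))"

text \<open>Half open, so that \<open>x0 = y0 = 0\<close> leaves out the sources and sinks on the
  axes, and \<open>x0 = z\<close> keeps exactly the points beyond an exit at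
  \<open>z\<close>.\<close>

definition edges_in :: "(nat \<times> nat \<Rightarrow> bool) \<Rightarrow> nat \<Rightarrow> nat \<Rightarrow> nat \<Rightarrow> nat \<Rightarrow> (nat \<times> nat) set" where
  "edges_in w x0 y0 x y = {z \<in> {x0<..x} \<times> {y0<..y}. w z}"

lemma finite_edges_in [simp]: "finite (edges_in w x0 y0 x y)"
  by (auto simp: edges_in_def)

lemma passage_horizontal: "passage w x 0 = (\<Sum>i=1..x. of_bool (w (i, 0)))"
  by (induction x) auto

lemma passage_vertical: "passage w 0 y = (\<Sum>i=1..y. of_bool (w (0, i)))"
  by (induction y) auto

lemma passage_Suc_left: "passage w x y \<le> passage w (Suc x) y"
  by (cases y) auto

lemma passage_Suc_right: "passage w x y \<le> passage w x (Suc y)"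
  by (cases x) auto

text \<open>Steps of size 0 or 1 allow increments to be recorded as truth values, the form in which
  Burke's property is stated.\<close>

lemma passage_Suc_le: "passage w (Suc x) y \<le> Suc (passage w x y) \<and> passage w x (Suc y) \<le> Suc (passage w x y)"
proof (induction "x + y" arbitrary: x y rule: less_induct)
  case less
  show ?case
  proof (cases x; cases y)
    fix y' assume "x = 0" "y = Suc y'"
    then show ?thesis
      using less[of 0 y'] passage_Suc_right[of w 0 y'] by simp
  next
    fix x' assume "y = 0" "x = Suc x'"
    then show ?thesis
      using less[of x' 0] passage_Suc_left[of w x' 0] by simp
  next
    fix x' y' assume xy: "x = Suc x'" "y = Suc y'"
    have "passage w (Suc x) y' \<le> Suc (passage w x y')" "passage w x y' \<le> passage w x y"
      "passage w x' (Suc y) \<le> Suc (passage w x' y)" "passage w x' y \<le> passage w x y"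
      using less[of x y'] less[of x' y] passage_Suc_right[of w x y'] passage_Suc_left[of w x' y]
      unfolding xy by simp_all
    moreover have "passage w (Suc x) y = max (max (passage w x y) (passage w (Suc x) y')) (passage w x y' + of_bool (w (Suc x, y)))"
      "passage w x (Suc y) = max (max (passage w x' (Suc y)) (passage w x y)) (passage w x' y + of_bool (w (x, Suc y)))"
      unfolding xy by (rule passage.simps(4))+
    ultimately show ?thesis
      by (cases "w (Suc x, y)"; cases "w (x, Suc y)"; simp)
  qed auto
qed

lemma passage_mono: "x \<le> x' \<Longrightarrow> y \<le> y' \<Longrightarrow> passage w x y \<le> passage w x' y'"
  by (meson passage_Suc_left passage_Suc_right lift_Suc_mono_le order_trans)

lemma asc_le_passage:
  assumes "asc ps" "set ps \<subseteq> edges_in w 0 0 x y"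
  shows "length ps \<le> passage w x y"
  using assms
proof (induction ps arbitrary: x y rule: rev_induct)
  case (snoc p ps)
  obtain a b where p: "p = (Suc a, Suc b)" "Suc a \<le> x" "Suc b \<le> y" "w p"
    using snoc.prems(2) by (cases p) (auto simp: edges_in_def gr0_conv_Suc)
  have *: "asc ps" "\<forall>q\<in>set ps. fst q < Suc a \<and> snd q < Suc b"
    using snoc.prems(1) unfolding asc_append p by auto
  then have "set ps \<subseteq> edges_in w 0 0 a b"
    using snoc.prems(2) by (fastforce simp: edges_in_def)
  then have "length ps \<le> passage w a b"
    using snoc.IH * by blast
  then have "length (ps @ [p]) \<le> passage w (Suc a) (Suc b)"
    using p by (simp add: le_max_iff_disj)
  also have "\<dots> \<le> passage w x y"
    using p by (intro passage_mono)
  finally show ?case .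
qed simp

lemma max_planar_matching_edges_in_le_passage: "max_planar_matching (edges_in w 0 0 x y) \<le> passage w x y"
  using asc_le_passage max_planar_matching_ge_iff[OF finite_edges_in] by (metis order_refl)

lemma max_planar_matching_edges_in_Suc:
  assumes "w (Suc x, Suc y)" "x0 \<le> x" "y0 \<le> y"
  shows "Suc (max_planar_matching (edges_in w x0 y0 x y)) \<le> max_planar_matching (edges_in w x0 y0 (Suc x) (Suc y))"
proof -
  obtain ps where ps: "asc ps" "length ps = max_planar_matching (edges_in w x0 y0 x y)"
      "set ps \<subseteq> edges_in w x0 y0 x y"
    using max_planar_matching_ge_iff[OF finite_edges_in] by blast
  have "asc (ps @ [(Suc x, Suc y)])"
    unfolding asc_append using ps by (auto simp: asc_Cons edges_in_def)
  moreover have "set (ps @ [(Suc x, Suc y)]) \<subseteq> edges_in w x0 y0 (Suc x) (Suc y)"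
    using ps assms by (auto simp: edges_in_def)
  ultimately show ?thesis
    using max_planar_matching_ge_iff[OF finite_edges_in] ps(2) by (metis length_append_singleton)
qed

lemma max_planar_matching_edges_in_mono:
  assumes "x0' \<le> x0" "y0' \<le> y0" "x \<le> x'" "y \<le> y'"
  shows "max_planar_matching (edges_in w x0 y0 x y) \<le> max_planar_matching (edges_in w x0' y0' x' y')"
  using assms by (intro max_planar_matching_mono finite_edges_in) (auto simp: edges_in_def)

text \<open>Trace the maximum in the recursion back until an axis is met, at \<open>z\<close>. A
  diagonal step through a point appends one edge to the matching beyond \<open>z\<close>; every
  other step only enlarges its rectangle.\<close>

lemma passage_exit:
  "(\<exists>z\<le>x. passage w x y \<le> passage w z 0 + max_planar_matching (edges_in w z 0 x y)) \<or>
   (\<exists>z\<le>y. passage w x y \<le> passage w 0 z + max_planar_matching (edges_in w 0 z x y))"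
  (is "?H x y \<or> ?V x y")
proof (induction "x + y" arbitrary: x y rule: less_induct)
  case less
  consider "x = 0" | "y = 0" | x' y' where "x = Suc x'" "y = Suc y'"
    by (metis not0_implies_Suc)
  then show ?case
  proof cases
    case 1
    then show ?thesis
      by (intro disjI2 exI[of _ y]) simp
  next
    case 2
    then show ?thesis
      by (intro disjI1 exI[of _ x]) simp
  next
    case 3
    have step: "?H x y \<or> ?V x y"
      if "?H a b \<or> ?V a b" "a \<le> x" "b \<le> y" "passage w x y \<le> passage w a b" for a b
      using that
    proof (elim disjE exE conjE)
      fix z assume z: "z \<le> a" "passage w a b \<le> passage w z 0 + max_planar_matching (edges_in w z 0 a b)"
      have "passage w x y \<le> passage w z 0 + max_planar_matching (edges_in w z 0 x y)"
        using z max_planar_matching_edges_in_mono[of z z 0 0 a x b y w] that by linarith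
      then show ?thesis
        using z that by (meson order_trans)
    next
      fix z assume z: "z \<le> b" "passage w a b \<le> passage w 0 z + max_planar_matching (edges_in w 0 z a b)"
      have "passage w x y \<le> passage w 0 z + max_planar_matching (edges_in w 0 z x y)"
        using z max_planar_matching_edges_in_mono[of 0 0 z z a x b y w] that by linarith
      then show ?thesis
        using z that by (meson order_trans)
    qed
    have eq: "passage w x y = max (max (passage w x' y) (passage w x y')) (passage w x' y' + of_bool (w (x, y)))"
      unfolding 3 by (rule passage.simps(4))
    consider "passage w x y \<le> passage w x' y" | "passage w x y \<le> passage w x y'" | "passage w x y \<le> passage w x' y'"
      | "w (x, y)" "passage w x y = Suc (passage w x' y')"
      using eq by (cases "w (x, y)") (auto simp: max_def split: if_splits)
    then show ?thesis
    proof cases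
      case 4
      have "?H x' y' \<or> ?V x' y'"
        using less 3 by simp
      then show ?thesis
      proof (elim disjE exE conjE)
        fix z assume z: "z \<le> x'" "passage w x' y' \<le> passage w z 0 + max_planar_matching (edges_in w z 0 x' y')"
        have "passage w x y \<le> passage w z 0 + max_planar_matching (edges_in w z 0 x y)"
          using z 4 max_planar_matching_edges_in_Suc[of w x' y' z 0] 3 by simp
        then show ?thesis
          using z 3 by (metis le_SucI)
      next
        fix z assume z: "z \<le> y'" "passage w x' y' \<le> passage w 0 z + max_planar_matching (edges_in w 0 z x' y')"
        have "passage w x y \<le> passage w 0 z + max_planar_matching (edges_in w 0 z x y)"
          using z 4 max_planar_matching_edges_in_Suc[of w x' y' 0 z] 3 by simp
        then show ?thesis
          using z 3 by (metis le_SucI)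
      qed
    next
      case 1
      show ?thesis
        by (rule step[OF less _ _ 1]) (simp_all add: 3)
    next
      case 2
      show ?thesis
        by (rule step[OF less _ _ 2]) (simp_all add: 3)
    next
      case c3: 3
      show ?thesis
        by (rule step[OF less _ _ c3]) (simp_all add: 3)
    qed
  qed
qed

subsection \<open>Burke's property\<close>

text \<open>\<open>h\<close> and \<open>v\<close> enter a cell whose point is \<open>c\<close>. If
  exactly one of them holds, the pair passes unchanged; both true become both false; both false
  become both \<open>c\<close>. The product law is kept because the mass \<open>a * b\<close>
  leaving (true, true) equals the mass \<open>p * (1 - a) * (1 - b)\<close> entering it.\<close>

lemma cell_burke:
  fixes a b p :: real
  assumes "a \<in> {0..1}" "b \<in> {0..1}" "p \<in> {0..1}" "a * b = p * (1 - a) * (1 - b)"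
  shows "do {h \<leftarrow> bernoulli_pmf a; v \<leftarrow> bernoulli_pmf b; c \<leftarrow> bernoulli_pmf p;
             return_pmf (\<not> v \<and> (h \<or> c), \<not> h \<and> (v \<or> c))}
         = pair_pmf (bernoulli_pmf a) (bernoulli_pmf b)"
proof (rule pmf_eqI)
  fix z :: "bool \<times> bool"
  obtain x y where z: "z = (x, y)"
    by (cases z)
  show "pmf (do {h \<leftarrow> bernoulli_pmf a; v \<leftarrow> bernoulli_pmf b; c \<leftarrow> bernoulli_pmf p;
             return_pmf (\<not> v \<and> (h \<or> c), \<not> h \<and> (v \<or> c))}) z
         = pmf (pair_pmf (bernoulli_pmf a) (bernoulli_pmf b)) z"
    using assms unfolding z
    by (cases x; cases y) (simp_all add: pmf_bind pmf_pair indicator_def, algebra+)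
qed

text \<open>One column of the recursion for \<open>passage\<close>, in terms of its increments, which are all
  at most 1: \<open>v\<close> holds the vertical increments to the left of the column and \<open>c\<close> its source
  (at 0) and points.\<close>

fun col_h :: "(nat \<Rightarrow> bool) \<Rightarrow> (nat \<Rightarrow> bool) \<Rightarrow> nat \<Rightarrow> bool" where
  "col_h v c 0 = c 0"
| "col_h v c (Suc y) = (\<not> v (Suc y) \<and> (col_h v c y \<or> c (Suc y)))"

text \<open>False outside \<open>{1..m}\<close>, the default of \<open>Pi_pmf\<close>, so that the
  output law can be an identity of distributions on functions.\<close>

definition col_v :: "nat \<Rightarrow> (nat \<Rightarrow> bool) \<Rightarrow> (nat \<Rightarrow> bool) \<Rightarrow> nat \<Rightarrow> bool" where
  "col_v m v c y \<longleftrightarrow> y \<in> {1..m} \<and> \<not> col_h v c (y - 1) \<and> (v y \<or> c y)"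

lemma col_h_cong:
  assumes "\<And>i. i \<in> {1..y} \<Longrightarrow> v i = v' i" "\<And>i. i \<le> y \<Longrightarrow> c i = c' i"
  shows "col_h v c y = col_h v' c' y"
  using assms by (induction y) auto

lemma col_v_Suc:
  "col_v (Suc m) (v(Suc m := s)) (c(Suc m := t)) =
     (col_v m v c)(Suc m := (\<not> col_h v c m \<and> (s \<or> t)))"
proof
  fix y
  have *: "col_h (v(Suc m := s)) (c(Suc m := t)) (y - 1) = col_h v c (y - 1)" if "y \<in> {1..Suc m}"
    using that by (intro col_h_cong) auto
  show "col_v (Suc m) (v(Suc m := s)) (c(Suc m := t)) y =
     ((col_v m v c)(Suc m := (\<not> col_h v c m \<and> (s \<or> t)))) y"
    using * by (cases "y = Suc m") (auto simp: col_v_def)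
qed

lemma col_h_Suc:
  "col_h (v(Suc m := s)) (c(Suc m := t)) (Suc m) = (\<not> s \<and> (col_h v c m \<or> t))"
proof -
  have "col_h (v(Suc m := s)) (c(Suc m := t)) m = col_h v c m"
    by (intro col_h_cong) auto
  then show ?thesis by simp
qed

text \<open>Induction upwards through the cells: the horizontal output \<open>h\<close> at height
  \<open>m\<close> is independent of the vertical outputs below it, and with fresh \<open>s\<close>
  and \<open>t\<close> it is a valid input of \<open>cell_burke\<close> for the next cell.\<close>

lemma column_burke:
  fixes a b p :: real
  assumes "a \<in> {0..1}" "b \<in> {0..1}" "p \<in> {0..1}" "a * b = p * (1 - a) * (1 - b)"
  shows "do {v \<leftarrow> Pi_pmf {1..m} False (\<lambda>_. bernoulli_pmf b);
             c \<leftarrow> Pi_pmf {0..m} False (\<lambda>y. bernoulli_pmf (if y = 0 then a else p));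
             return_pmf (col_v m v c, col_h v c m)}
         = pair_pmf (Pi_pmf {1..m} False (\<lambda>_. bernoulli_pmf b)) (bernoulli_pmf a)"
proof (induction m)
  case 0
  have "col_v 0 v c = (\<lambda>_. False)" for v c
    by (auto simp: col_v_def)
  then show ?case
    by (simp add: Pi_pmf_singleton bind_return_pmf pair_return_pmf1 map_pmf_comp flip: map_pmf_def)
next
  case (Suc m)
  let ?V = "\<lambda>m. Pi_pmf {1..m} False (\<lambda>_. bernoulli_pmf b)"
  let ?C = "\<lambda>m. Pi_pmf {0..m} False (\<lambda>y. bernoulli_pmf (if y = 0 then a else p))"
  have V: "?V (Suc m) = do {v \<leftarrow> ?V m; s \<leftarrow> bernoulli_pmf b; return_pmf (v(Suc m := s))}"
    by (simp add: atLeastAtMostSuc_conv Pi_pmf_insert pair_pmf_def map_bind_pmf bind_return_pmf)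
       (subst bind_commute_pmf, simp)
  have C: "?C (Suc m) = do {c \<leftarrow> ?C m; t \<leftarrow> bernoulli_pmf p; return_pmf (c(Suc m := t))}"
    by (simp add: atLeastAtMostSuc_conv Pi_pmf_insert pair_pmf_def map_bind_pmf bind_return_pmf)
       (subst bind_commute_pmf, simp)
  have "do {v \<leftarrow> ?V (Suc m); c \<leftarrow> ?C (Suc m);
            return_pmf (col_v (Suc m) v c, col_h v c (Suc m))}
      = do {v \<leftarrow> ?V m; s \<leftarrow> bernoulli_pmf b; c \<leftarrow> ?C m; t \<leftarrow> bernoulli_pmf p;
            return_pmf ((col_v m v c)(Suc m := (\<not> col_h v c m \<and> (s \<or> t))),
              \<not> s \<and> (col_h v c m \<or> t))}"
    unfolding V C bind_assoc_pmf bind_return_pmf col_v_Suc col_h_Suc ..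
  also have "\<dots> = do {v \<leftarrow> ?V m; c \<leftarrow> ?C m; s \<leftarrow> bernoulli_pmf b; t \<leftarrow> bernoulli_pmf p;
            return_pmf ((col_v m v c)(Suc m := (\<not> col_h v c m \<and> (s \<or> t))),
              \<not> s \<and> (col_h v c m \<or> t))}"
    by (subst bind_commute_pmf) (rule refl)
  also have "\<dots> = do {(v, h) \<leftarrow> do {v \<leftarrow> ?V m; c \<leftarrow> ?C m; return_pmf (col_v m v c, col_h v c m)};
            s \<leftarrow> bernoulli_pmf b; t \<leftarrow> bernoulli_pmf p;
            return_pmf (v(Suc m := (\<not> h \<and> (s \<or> t))), \<not> s \<and> (h \<or> t))}"
    by (simp add: bind_assoc_pmf bind_return_pmf)
  also have "\<dots> = do {(v, h) \<leftarrow> pair_pmf (?V m) (bernoulli_pmf a);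
            s \<leftarrow> bernoulli_pmf b; t \<leftarrow> bernoulli_pmf p;
            return_pmf (v(Suc m := (\<not> h \<and> (s \<or> t))), \<not> s \<and> (h \<or> t))}"
    unfolding Suc.IH ..
  also have "\<dots> = do {v \<leftarrow> ?V m; (h', v') \<leftarrow>
              do {h \<leftarrow> bernoulli_pmf a; s \<leftarrow> bernoulli_pmf b; t \<leftarrow> bernoulli_pmf p;
                  return_pmf (\<not> s \<and> (h \<or> t), \<not> h \<and> (s \<or> t))};
            return_pmf (v(Suc m := v'), h')}"
    by (simp add: pair_pmf_def bind_assoc_pmf bind_return_pmf)
  also have "\<dots> = do {v \<leftarrow> ?V m; h' \<leftarrow> bernoulli_pmf a; v' \<leftarrow> bernoulli_pmf b;
            return_pmf (v(Suc m := v'), h')}"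
    unfolding cell_burke[OF assms] by (simp add: pair_pmf_def bind_assoc_pmf bind_return_pmf)
  also have "\<dots> = do {v \<leftarrow> ?V m; v' \<leftarrow> bernoulli_pmf b; h' \<leftarrow> bernoulli_pmf a;
            return_pmf (v(Suc m := v'), h')}"
    by (subst bind_commute_pmf) (rule refl)
  also have "\<dots> = pair_pmf (?V (Suc m)) (bernoulli_pmf a)"
    unfolding V by (simp add: pair_pmf_def bind_assoc_pmf bind_return_pmf)
  finally show ?case .
qed

section \<open>From single columns to the passage time\<close>

lemma passage_cong:
  assumes "\<And>i j. i \<le> x \<Longrightarrow> j \<le> y \<Longrightarrow> w (i, j) = w' (i, j)"
  shows "passage w x y = passage w' x y"
  using assms
proof (induction w x y rule: passage.induct)
  case (4 w x y)
  have "passage w x (Suc y) = passage w' x (Suc y)" "passage w (Suc x) y = passage w' (Suc x) y" "passage w x y = passage w' x y"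
    by (rule "4.IH"; use "4.prems" in simp)+
  then show ?case
    using "4.prems" by simp
qed auto

lemma passage_Suc_right_eq: "passage w x (Suc y) = passage w x y + of_bool (passage w x (Suc y) \<noteq> passage w x y)"
  using passage_Suc_le[of w x y] passage_Suc_right[of w x y] by (auto simp: of_bool_def)

text \<open>Subtracting \<open>passage w x y\<close> from the recursion for
  \<open>passage w (Suc x) (Suc y)\<close> leaves a maximum of three quantities in {0, 1}; read as a
  boolean rule for the increments it is that of \<open>col_h\<close> and
  \<open>col_v\<close>.\<close>

lemma passage_Suc_col:
  defines "v \<equiv> \<lambda>w m x y. y \<in> {1..m::nat} \<and> passage w x y \<noteq> passage w x (y - 1)"
  shows "y \<le> m \<Longrightarrow> passage w (Suc x) y = passage w x y + of_bool (col_h (v w m x) (\<lambda>j. w (Suc x, j)) y)"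
    and "v w m (Suc x) = col_v m (v w m x) (\<lambda>j. w (Suc x, j))"
proof -
  have 1: "passage w (Suc x) y = passage w x y + of_bool (col_h (v w m x) (\<lambda>j. w (Suc x, j)) y)" if "y \<le> m" for y
    using that
  proof (induction y)
    case (Suc y)
    have "v w m x (Suc y) \<longleftrightarrow> passage w x (Suc y) \<noteq> passage w x y"
      using Suc.prems by (simp add: v_def)
    moreover have "passage w (Suc x) y = passage w x y + of_bool (col_h (v w m x) (\<lambda>j. w (Suc x, j)) y)"
      using Suc by simp
    ultimately show ?case
      using passage_Suc_right_eq[of w x y]
      by (cases "passage w x (Suc y) = passage w x y"; cases "w (Suc x, Suc y)";
          cases "col_h (v w m x) (\<lambda>j. w (Suc x, j)) y") auto
  qed simp
  show "y \<le> m \<Longrightarrow> passage w (Suc x) y = passage w x y + of_bool (col_h (v w m x) (\<lambda>j. w (Suc x, j)) y)"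
    by (rule 1)
  show "v w m (Suc x) = col_v m (v w m x) (\<lambda>j. w (Suc x, j))"
  proof
    fix y
    show "v w m (Suc x) y = col_v m (v w m x) (\<lambda>j. w (Suc x, j)) y"
    proof (cases "y \<in> {1..m}")
      case True
      then obtain y' where y: "y = Suc y'"
        by (cases y) auto
      have "v w m x y \<longleftrightarrow> passage w x y \<noteq> passage w x y'" "v w m (Suc x) y \<longleftrightarrow> passage w (Suc x) y \<noteq> passage w (Suc x) y'"
        using True by (simp_all add: v_def y)
      then show ?thesis
        using 1[of y] 1[of y'] True passage_Suc_right_eq[of w x y'] unfolding y col_v_def
        by (cases "passage w x (Suc y') = passage w x y'"; cases "w (Suc x, Suc y')";
          cases "col_h (v w m x) (\<lambda>j. w (Suc x, j)) y'") (auto simp del: passage.simps)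
    qed (auto simp: v_def col_v_def)
  qed
qed

definition boundary_field :: "real \<Rightarrow> real \<Rightarrow> real \<Rightarrow> nat \<Rightarrow> nat \<Rightarrow> (nat \<times> nat \<Rightarrow> bool) pmf" where
  "boundary_field a b p n m = Pi_pmf ({0..n} \<times> {0..m}) False
     (\<lambda>(x, y). bernoulli_pmf (if y = 0 then a else if x = 0 then b else p))"

text \<open>An independent field is a family of independent columns; \<open>burke\<close> adds these
  one at a time.\<close>

lemma Pi_pmf_Times:
  assumes "finite A" "finite B"
  shows "Pi_pmf (A \<times> B) d (\<lambda>(x, y). p x y) =
    map_pmf case_prod (Pi_pmf A (\<lambda>_. d) (\<lambda>x. Pi_pmf B d (p x)))"
proof (rule pmf_eqI)
  fix f :: "'a \<times> 'b \<Rightarrow> 'c"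
  have f: "f = case_prod (curry f)"
    by simp
  have "inj (case_prod :: ('a \<Rightarrow> 'b \<Rightarrow> 'c) \<Rightarrow> _)"
    by (metis curry_case_prod injI)
  then have "pmf (map_pmf case_prod (Pi_pmf A (\<lambda>_. d) (\<lambda>x. Pi_pmf B d (p x)))) f =
      pmf (Pi_pmf A (\<lambda>_. d) (\<lambda>x. Pi_pmf B d (p x))) (curry f)"
    by (subst f) (rule pmf_map_inj')
  also have "\<dots> = pmf (Pi_pmf (A \<times> B) d (\<lambda>(x, y). p x y)) f"
  proof (cases "\<forall>z. z \<notin> A \<times> B \<longrightarrow> f z = d")
    case True
    then have "pmf (Pi_pmf A (\<lambda>_. d) (\<lambda>x. Pi_pmf B d (p x))) (curry f) =
        (\<Prod>x\<in>A. pmf (Pi_pmf B d (p x)) (curry f x))"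
      using assms by (intro pmf_Pi') (auto simp: fun_eq_iff)
    also have "\<dots> = (\<Prod>x\<in>A. \<Prod>y\<in>B. pmf (p x y) (f (x, y)))"
      using assms True by (intro prod.cong refl) (auto simp: pmf_Pi')
    also have "\<dots> = (\<Prod>z\<in>A \<times> B. pmf (case z of (x, y) \<Rightarrow> p x y) (f z))"
      by (simp add: prod.cartesian_product case_prod_unfold)
    also have "\<dots> = pmf (Pi_pmf (A \<times> B) d (\<lambda>(x, y). p x y)) f"
      using assms True by (subst pmf_Pi') auto
    finally show ?thesis .
  next
    case False
    then obtain x y where xy: "(x, y) \<notin> A \<times> B" "f (x, y) \<noteq> d"
      by auto
    have "pmf (Pi_pmf A (\<lambda>_. d) (\<lambda>x. Pi_pmf B d (p x))) (curry f) = 0"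
    proof (cases "x \<in> A")
      case True
      then have "pmf (Pi_pmf B d (p x)) (curry f x) = 0"
        using xy assms by (intro pmf_Pi_outside) auto
      then have "(\<Prod>x\<in>A. pmf (Pi_pmf B d (p x)) (curry f x)) = 0"
        using True assms(1) by (intro prod_zero) blast+
      then show ?thesis
        by (simp add: pmf_Pi[OF assms(1)])
    next
      case False
      then show ?thesis
        using xy assms by (intro pmf_Pi_outside) (auto simp: fun_eq_iff)
    qed
    then show ?thesis
      using False assms by (subst pmf_Pi_outside) auto
  qed
  finally show "pmf (Pi_pmf (A \<times> B) d (\<lambda>(x, y). p x y)) f =
    pmf (map_pmf case_prod (Pi_pmf A (\<lambda>_. d) (\<lambda>x. Pi_pmf B d (p x)))) f" ..
qed

text \<open>Iterate \<open>column_burke\<close> from left to right: each new column is independent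
  of the increments on its left, and the first component of its output law is the input law
  again.\<close>

lemma burke:
  fixes a b p :: real
  assumes "a \<in> {0..1}" "b \<in> {0..1}" "p \<in> {0..1}" "a * b = p * (1 - a) * (1 - b)"
  shows "map_pmf (\<lambda>w y. y \<in> {1..m} \<and> passage w n y \<noteq> passage w n (y - 1)) (boundary_field a b p n m) =
     Pi_pmf {1..m} False (\<lambda>_. bernoulli_pmf b)"
proof -
  define c where "c = (\<lambda>x::nat. Pi_pmf {0..m} False
     (\<lambda>y. bernoulli_pmf (if y = 0 then a else if x = 0 then b else p)))"
  define v where "v = (\<lambda>w n y. y \<in> {1..m} \<and> passage w n y \<noteq> passage w n (y - 1))"
  have "map_pmf (\<lambda>f. v (case_prod f) n) (Pi_pmf {0..n} (\<lambda>_. False) c) =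
     Pi_pmf {1..m} False (\<lambda>_. bernoulli_pmf b)"
  proof (induction n)
    case 0
    \<comment> \<open>On the vertical axis the increments are the sinks themselves.\<close>
    have "v (case_prod ((\<lambda>_ _. False)(0 := f))) 0 = (\<lambda>y. if y \<in> {1..m} then f y else False)" for f
    proof
      fix y
      show "v (case_prod ((\<lambda>_ _. False)(0 := f))) 0 y = (if y \<in> {1..m} then f y else False)"
        by (cases y) (auto simp: v_def)
    qed
    then have "map_pmf (\<lambda>f. v (case_prod f) 0) (Pi_pmf {0..0} (\<lambda>_. False) c) =
        map_pmf (\<lambda>f y. if y \<in> {1..m} then f y else False) (c 0)"
      by (simp add: Pi_pmf_singleton map_pmf_comp fun_upd_def)
    also have "\<dots> = Pi_pmf {1..m} False (\<lambda>y. bernoulli_pmf (if y = 0 then a else b))"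
      unfolding c_def by (subst Pi_pmf_subset[symmetric]) auto
    also have "\<dots> = Pi_pmf {1..m} False (\<lambda>_. bernoulli_pmf b)"
      by (intro Pi_pmf_cong) auto
    finally show ?case .
  next
    case (Suc n)
    have v_Suc: "v (case_prod (f(Suc n := g))) (Suc n) = col_v m (v (case_prod f) n) g" for f g
    proof -
      have "passage (case_prod (f(Suc n := g))) n y = passage (case_prod f) n y" for y
        by (intro passage_cong) auto
      then have "v (case_prod (f(Suc n := g))) n = v (case_prod f) n"
        by (simp add: v_def)
      then show ?thesis
        using passage_Suc_col(2)[of m "case_prod (f(Suc n := g))" n] by (simp add: v_def)
    qed
    have "map_pmf (\<lambda>f. v (case_prod f) (Suc n)) (Pi_pmf {0..Suc n} (\<lambda>_. False) c) =
      do {g \<leftarrow> c (Suc n); f \<leftarrow> Pi_pmf {0..n} (\<lambda>_. False) c;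
          return_pmf (col_v m (v (case_prod f) n) g)}"
      by (simp add: atLeastAtMostSuc_conv Pi_pmf_insert pair_pmf_def map_bind_pmf v_Suc)
    also have "\<dots> = do {f \<leftarrow> Pi_pmf {0..n} (\<lambda>_. False) c; g \<leftarrow> c (Suc n);
          return_pmf (col_v m (v (case_prod f) n) g)}"
      by (rule bind_commute_pmf)
    also have "\<dots> = do {f' \<leftarrow> map_pmf (\<lambda>f. v (case_prod f) n) (Pi_pmf {0..n} (\<lambda>_. False) c);
          g \<leftarrow> c (Suc n); return_pmf (col_v m f' g)}"
      by (simp add: bind_map_pmf)
    also have "\<dots> = do {f' \<leftarrow> Pi_pmf {1..m} False (\<lambda>_. bernoulli_pmf b);
          g \<leftarrow> c (Suc n); return_pmf (col_v m f' g)}"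
      unfolding Suc.IH ..
    also have "\<dots> = map_pmf fst (do {f' \<leftarrow> Pi_pmf {1..m} False (\<lambda>_. bernoulli_pmf b);
          g \<leftarrow> c (Suc n); return_pmf (col_v m f' g, col_h f' g m)})"
      by (simp add: map_bind_pmf)
    also have "\<dots> = Pi_pmf {1..m} False (\<lambda>_. bernoulli_pmf b)"
      using column_burke[OF assms, of m] by (simp add: c_def map_fst_pair_pmf)
    finally show ?case .
  qed
  moreover have "boundary_field a b p n m = map_pmf case_prod (Pi_pmf {0..n} (\<lambda>_. False) c)"
    unfolding boundary_field_def c_def
    by (rule Pi_pmf_Times) auto
  ultimately show ?thesis
    by (simp add: map_pmf_comp v_def)
qed

subsection \<open>Exponential moments\<close>

lemma finite_set_Pi_pmf [intro]:
  assumes "finite A" "\<And>x. x \<in> A \<Longrightarrow> finite (set_pmf (p x))"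
  shows "finite (set_pmf (Pi_pmf A d p))"
  using assms by (auto simp: set_Pi_pmf)

lemma expectation_mono_finite:
  fixes f g :: "'a \<Rightarrow> real"
  assumes "finite (set_pmf M)" "\<And>x. x \<in> set_pmf M \<Longrightarrow> f x \<le> g x"
  shows "measure_pmf.expectation M f \<le> measure_pmf.expectation M g"
  using assms by (intro integral_mono_AE integrable_measure_pmf_finite AE_pmfI)

lemma exp_Markov:
  fixes f :: "'a \<Rightarrow> real"
  assumes "finite (set_pmf M)"
  shows "measure_pmf.prob M {x. c \<le> f x} \<le> exp (- c) * measure_pmf.expectation M (\<lambda>x. exp (f x))"
proof -
  have "measure_pmf.prob M {x. c \<le> f x} = measure_pmf.expectation M (indicator {x. c \<le> f x})"
    by simp
  also have "\<dots> \<le> measure_pmf.expectation M (\<lambda>x. exp (- c) * exp (f x))"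
    using assms by (intro expectation_mono_finite) (auto simp: indicator_def simp flip: exp_add)
  finally show ?thesis
    by simp
qed

text \<open>For negative \<open>t = - y\<close> the claim is inverted to
  \<open>(1 - y + y\<^sup>2) * exp y \<ge> 1\<close>, which follows from the Taylor bound for
  \<open>exp y\<close>.\<close>

lemma exp_le_quadratic:
  fixes t :: real
  assumes "\<bar>t\<bar> \<le> 1"
  shows "exp t \<le> 1 + t + t\<^sup>2"
proof (cases "t \<ge> 0")
  case True
  then show ?thesis
    using assms exp_bound[of t] by simp
next
  case False
  define y where "y = - t"
  have y: "0 \<le> y" "y \<le> 1"
    using False assms by (auto simp: y_def)
  have "1 \<le> 1 + (y\<^sup>2 + y ^ 3 + y ^ 4) / 2"
    using y by simp
  also have "\<dots> = (1 - y + y\<^sup>2) * (1 + y + y\<^sup>2 / 2)"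
    by (simp add: field_simps power2_eq_square power3_eq_cube power4_eq_xxxx)
  also have "\<dots> \<le> (1 - y + y\<^sup>2) * exp y"
    using y exp_lower_Taylor_quadratic[of y] by (intro mult_left_mono) auto
  finally show ?thesis
    using False by (simp add: y_def exp_minus field_simps)
qed

text \<open>Independence factors the moment into \<open>(1 + a * (exp t - 1)) ^ card B\<close>, and
  \<open>1 + x \<le> exp x\<close> replaces the binomial by a Poisson moment. Both signs of
  \<open>t\<close> are allowed, as lower tails use negative \<open>t\<close>.\<close>

lemma expectation_exp_count:
  fixes a t :: real
  assumes "finite A" "B \<subseteq> A" "\<And>z. z \<in> B \<Longrightarrow> q z = bernoulli_pmf a" "a \<in> {0..1}"
  shows "measure_pmf.expectation (Pi_pmf A False q) (\<lambda>w. exp (t * (\<Sum>z\<in>B. of_bool (w z))))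
    \<le> exp (a * card B * (exp t - 1))"
proof -
  have finB: "finite B"
    using assms finite_subset by blast
  \<comment> \<open>Coordinates outside \<open>B\<close> get the factor 1, so that the product runs
    over all of \<open>A\<close>.\<close>
  define f where "f = (\<lambda>z c. if z \<in> B then exp (t * of_bool c) else 1 :: real)"
  have "exp (t * (\<Sum>z\<in>B. of_bool (w z))) = (\<Prod>z\<in>A. f z (w z))" for w
  proof -
    have "(\<Prod>z\<in>A. f z (w z)) = (\<Prod>z\<in>B. exp (t * of_bool (w z)))"
      using assms(1,2) unfolding f_def
      by (intro prod.mono_neutral_cong_right) auto
    then show ?thesis
      by (simp only: exp_sum[OF finB] sum_distrib_left)
  qed
  then have "measure_pmf.expectation (Pi_pmf A False q) (\<lambda>w. exp (t * (\<Sum>z\<in>B. of_bool (w z)))) =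
      measure_pmf.expectation (Pi_pmf A False q) (\<lambda>w. \<Prod>z\<in>A. f z (w z))"
    by simp
  also have "\<dots> = (\<Prod>z\<in>A. measure_pmf.expectation (q z) (f z))"
    using assms(1) by (intro expectation_prod_Pi_pmf integrable_measure_pmf_finite)
      (auto simp: f_def intro: finite_subset[OF subset_UNIV])
  also have "\<dots> = (\<Prod>z\<in>B. measure_pmf.expectation (bernoulli_pmf a) (\<lambda>c. exp (t * of_bool c)))"
    using assms by (intro prod.mono_neutral_cong_right) (auto simp: f_def)
  also have "\<dots> = (1 + a * (exp t - 1)) ^ card B"
    using assms(4) by (simp add: algebra_simps)
  also have "\<dots> \<le> exp (a * (exp t - 1)) ^ card B"
  proof (intro power_mono)
    have "1 + a * (exp t - 1) = (1 - a) + a * exp t"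
      by (simp add: algebra_simps)
    also have "\<dots> \<ge> 0"
      using assms(4) by simp
    finally show "0 \<le> 1 + a * (exp t - 1)" .
  qed auto
  also have "\<dots> = exp (a * card B * (exp t - 1))"
    by (simp add: exp_of_nat_mult[symmetric] mult_ac)
  finally show ?thesis .
qed

text \<open>The hypothesis \<open>mgf\<close> says that the exponential moments of \<open>X\<close> are at most those of a
  Poisson variable with mean \<open>\<mu>\<close>.\<close>

lemma poisson_tail_upper:
  fixes X :: "'a \<Rightarrow> real"
  assumes "finite (set_pmf M)"
    and mgf: "\<And>t. measure_pmf.expectation M (\<lambda>w. exp (t * X w)) \<le> exp (\<mu> * (exp t - 1))"
    and "0 \<le> \<mu>" "\<mu> \<le> m" "0 < s" "s \<le> 2 * m"
  shows "measure_pmf.prob M {w. \<mu> + s \<le> X w} \<le> exp (- s\<^sup>2 / (4 * m))"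
proof -
  have m: "m > 0"
    using assms by linarith
  \<comment> \<open>The minimiser of \<open>- (t * s) + m * t\<^sup>2\<close>; the condition
    \<open>s \<le> 2 * m\<close> keeps it in the range of \<open>exp_le_quadratic\<close>.\<close>
  define t where "t = s / (2 * m)"
  have t: "0 < t" "t \<le> 1"
    using assms m by (auto simp: t_def)
  have "measure_pmf.prob M {w. \<mu> + s \<le> X w} = measure_pmf.prob M {w. t * (\<mu> + s) \<le> t * X w}"
    using t by simp
  also have "\<dots> \<le> exp (- (t * (\<mu> + s))) * measure_pmf.expectation M (\<lambda>w. exp (t * X w))"
    by (intro exp_Markov assms)
  also have "\<dots> \<le> exp (- (t * (\<mu> + s))) * exp (\<mu> * (exp t - 1))"
    by (intro mult_left_mono mgf) auto
  also have "\<dots> \<le> exp (- (t * (\<mu> + s))) * exp (\<mu> * t + m * t\<^sup>2)"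
  proof -
    have "\<mu> * (exp t - 1) \<le> \<mu> * (t + t\<^sup>2)"
      using exp_le_quadratic[of t] t assms by (intro mult_left_mono) auto
    also have "\<dots> \<le> \<mu> * t + m * t\<^sup>2"
      using assms by (simp add: distrib_left mult_right_mono)
    finally show ?thesis
      by simp
  qed
  also have "\<dots> = exp (- (t * s) + m * t\<^sup>2)"
    by (simp add: algebra_simps flip: exp_add)
  also have "- (t * s) + m * t\<^sup>2 = - s\<^sup>2 / (4 * m)"
    using m by (simp add: t_def field_simps power2_eq_square)
  finally show ?thesis .
qed

lemma poisson_tail_lower:
  fixes X :: "'a \<Rightarrow> real"
  assumes "finite (set_pmf M)"
    and mgf: "\<And>t. measure_pmf.expectation M (\<lambda>w. exp (t * X w)) \<le> exp (\<mu> * (exp t - 1))"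
    and "0 \<le> \<mu>" "\<mu> \<le> m" "0 < s" "s \<le> 2 * m"
  shows "measure_pmf.prob M {w. X w \<le> \<mu> - s} \<le> exp (- s\<^sup>2 / (4 * m))"
proof -
  have m: "m > 0"
    using assms by linarith
  define t where "t = s / (2 * m)"
  have t: "0 < t" "t \<le> 1"
    using assms m by (auto simp: t_def)
  have "measure_pmf.prob M {w. X w \<le> \<mu> - s} = measure_pmf.prob M {w. - t * (\<mu> - s) \<le> - t * X w}"
    using t by simp
  also have "\<dots> \<le> exp (- (- t * (\<mu> - s))) * measure_pmf.expectation M (\<lambda>w. exp (- t * X w))"
    by (intro exp_Markov assms)
  also have "\<dots> \<le> exp (- (- t * (\<mu> - s))) * exp (\<mu> * (exp (- t) - 1))"
    by (intro mult_left_mono mgf) auto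
  also have "\<dots> \<le> exp (- (- t * (\<mu> - s))) * exp (- \<mu> * t + m * t\<^sup>2)"
  proof -
    have "\<mu> * (exp (- t) - 1) \<le> \<mu> * (- t + t\<^sup>2)"
      using exp_le_quadratic[of "- t"] t assms by (intro mult_left_mono) auto
    also have "\<dots> \<le> - \<mu> * t + m * t\<^sup>2"
      using assms by (simp add: right_diff_distrib mult_right_mono)
    finally show ?thesis
      by simp
  qed
  also have "\<dots> = exp (- (t * s) + m * t\<^sup>2)"
    by (simp add: algebra_simps flip: exp_add)
  also have "- (t * s) + m * t\<^sup>2 = - s\<^sup>2 / (4 * m)"
    using m by (simp add: t_def field_simps power2_eq_square)
  finally show ?thesis .
qed

subsection \<open>Fields of independent Bernoulli variables\<close>

definition edge_field :: "real \<Rightarrow> nat \<Rightarrow> nat \<Rightarrow> (nat \<times> nat \<Rightarrow> bool) pmf" where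
  "edge_field p n m = Pi_pmf ({1..n} \<times> {1..m}) False (\<lambda>_. bernoulli_pmf p)"

lemma finite_set_field [simp]: "finite (set_pmf (edge_field p n m))"
  unfolding edge_field_def by (intro finite_set_Pi_pmf) (auto intro: finite_subset[OF subset_UNIV])

lemma finite_set_boundary_field [simp]: "finite (set_pmf (boundary_field a b p n m))"
  unfolding boundary_field_def
  by (intro finite_set_Pi_pmf) (auto intro: finite_subset[OF subset_UNIV])

lemma max_planar_matching_shift:
  fixes G :: "(nat \<times> nat) set"
  assumes "finite G"
  shows "max_planar_matching ((\<lambda>(a, b). (x0 + a, y0 + b)) ` G) = max_planar_matching G"
proof (rule antisym)
  define f where "f = (\<lambda>(a, b). (x0 + a, y0 + b) :: nat \<times> nat)"
  define g where "g = (\<lambda>(a, b). (a - x0, b - y0) :: nat \<times> nat)"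
  have fin: "finite (f ` G)"
    using assms by simp
  obtain ps where ps: "asc ps" "length ps = max_planar_matching (f ` G)" "set ps \<subseteq> f ` G"
    using max_planar_matching_ge_iff[OF fin] by blast
  have "asc (map g ps)"
    by (rule asc_map[OF ps(1)]) (use ps(3) in \<open>fastforce simp: f_def g_def\<close>)
  moreover have "g z \<in> G" if "z \<in> f ` G" for z
    using that by (auto simp: f_def g_def)
  then have "set (map g ps) \<subseteq> G"
    using ps(3) by (metis image_subset_iff list.set_map subsetD)
  ultimately show "max_planar_matching (f ` G) \<le> max_planar_matching G"
    using ps(2) by (intro max_planar_matching_ge_iff[OF assms, THEN iffD2] exI[of _ "map g ps"]) simp
  obtain ps where ps: "asc ps" "length ps = max_planar_matching G" "set ps \<subseteq> G"
    using max_planar_matching_ge_iff[OF assms] by blast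
  have "asc (map f ps)"
    by (rule asc_map[OF ps(1)]) (auto simp: f_def)
  moreover have "set (map f ps) \<subseteq> f ` G"
    using ps(3) by auto
  ultimately show "max_planar_matching G \<le> max_planar_matching (f ` G)"
    using ps(2) by (intro max_planar_matching_ge_iff[OF fin, THEN iffD2] exI[of _ "map f ps"]) simp
qed

text \<open>Translation invariance: what remains beyond an exit point can be treated as a field on a
  smaller rectangle at the origin.\<close>

lemma edge_field_edges_in:
  assumes "x0 \<le> n" "y0 \<le> m"
  shows "map_pmf (\<lambda>w. max_planar_matching (edges_in w x0 y0 n m)) (edge_field p n m) =
    map_pmf (\<lambda>w. max_planar_matching (edges_in w 0 0 (n - x0) (m - y0))) (edge_field p (n - x0) (m - y0))"
proof -
  let ?A = "{1..n - x0} \<times> {1..m - y0}" and ?B = "{x0<..n} \<times> {y0<..m}"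
  define h where "h = (\<lambda>(a, b). (x0 + a, y0 + b) :: nat \<times> nat)"
  have bij: "bij_betw h ?A ?B"
    using assms by (intro bij_betwI[of _ _ _ "\<lambda>(a, b). (a - x0, b - y0)"]) (auto simp: h_def)
  have "edge_field p (n - x0) (m - y0) = map_pmf (\<lambda>g. g \<circ> h) (Pi_pmf ?B False (\<lambda>_. bernoulli_pmf p))"
    unfolding edge_field_def using bij by (intro Pi_pmf_bij_betw) (auto simp: h_def)
  also have "Pi_pmf ?B False (\<lambda>_. bernoulli_pmf p) =
      map_pmf (\<lambda>w z. if z \<in> ?B then w z else False) (edge_field p n m)"
    unfolding edge_field_def by (intro Pi_pmf_subset) auto
  finally have *: "edge_field p (n - x0) (m - y0) =
      map_pmf (\<lambda>w. (\<lambda>z. if z \<in> ?B then w z else False) \<circ> h) (edge_field p n m)"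
    by (simp only: map_pmf_comp)
  have "max_planar_matching (edges_in ((\<lambda>z. if z \<in> ?B then w z else False) \<circ> h) 0 0 (n - x0) (m - y0)) =
      max_planar_matching (edges_in w x0 y0 n m)" for w
  proof -
    let ?G = "edges_in ((\<lambda>z. if z \<in> ?B then w z else False) \<circ> h) 0 0 (n - x0) (m - y0)"
    have "edges_in w x0 y0 n m \<subseteq> h ` ?G"
    proof
      fix z assume z: "z \<in> edges_in w x0 y0 n m"
      then have "z = h (fst z - x0, snd z - y0)"
        by (auto simp: h_def edges_in_def)
      then show "z \<in> h ` ?G"
        using z by (intro image_eqI[of _ _ "(fst z - x0, snd z - y0)"]) (auto simp: h_def edges_in_def)
    qed
    moreover have "h ` ?G \<subseteq> edges_in w x0 y0 n m"
      using assms by (auto simp: edges_in_def h_def split: if_splits)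
    ultimately have "edges_in w x0 y0 n m = h ` ?G"
      by blast
    then show ?thesis
      using max_planar_matching_shift[OF finite_edges_in, of x0 y0] by (simp only: h_def)
  qed
  then show ?thesis
    unfolding * by (simp add: map_pmf_comp)
qed

text \<open>Sources and sinks are invisible to \<open>edges_in\<close>. This carries tail bounds
  from the boundary field to the edge field and back.\<close>

lemma boundary_field_edges_in:
  "map_pmf (\<lambda>w. max_planar_matching (edges_in w x0 y0 n m)) (boundary_field a b p n m) =
   map_pmf (\<lambda>w. max_planar_matching (edges_in w x0 y0 n m)) (edge_field p n m)"
proof -
  have "edge_field p n m = Pi_pmf ({1..n} \<times> {1..m}) False
     (\<lambda>(x, y). bernoulli_pmf (if y = 0 then a else if x = 0 then b else p))"
    unfolding edge_field_def by (intro Pi_pmf_cong) auto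
  also have "\<dots> = map_pmf (\<lambda>w z. if z \<in> {1..n} \<times> {1..m} then w z else False) (boundary_field a b p n m)"
    unfolding boundary_field_def by (intro Pi_pmf_subset) auto
  finally have *: "edge_field p n m =
    map_pmf (\<lambda>w z. if z \<in> {1..n} \<times> {1..m} then w z else False) (boundary_field a b p n m)" .
  have "edges_in (\<lambda>z. if z \<in> {1..n} \<times> {1..m} then w z else False) x0 y0 n m = edges_in w x0 y0 n m" for w
    by (auto simp: edges_in_def split: if_splits)
  then show ?thesis
    unfolding * by (simp add: map_pmf_comp)
qed

lemma boundary_field_source_mgf:
  assumes "a \<in> {0..1}" "z \<le> n"
  shows "measure_pmf.expectation (boundary_field a b p n m) (\<lambda>w. exp (t * real (passage w z 0)))
    \<le> exp (a * z * (exp t - 1))"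
proof -
  have eq: "real (passage w z 0) = (\<Sum>x\<in>{1..z} \<times> {0}. of_bool (w x))" for w
  proof -
    have "(\<Sum>x\<in>{1..z} \<times> {0}. of_bool (w x)) = (\<Sum>x\<in>{1..z}. of_bool (w (x, 0)) :: real)"
      by (rule sum.reindex_bij_witness[of _ "\<lambda>x. (x, 0)" fst]) auto
    then show ?thesis
      by (simp only: passage_horizontal of_nat_sum of_nat_of_bool)
  qed
  show ?thesis
    unfolding eq boundary_field_def
    by (rule order_trans[OF expectation_exp_count[where a = a]]) (use assms in auto)
qed

lemma boundary_field_sink_mgf:
  assumes "b \<in> {0..1}" "z \<le> m"
  shows "measure_pmf.expectation (boundary_field a b p n m) (\<lambda>w. exp (t * real (passage w 0 z)))
    \<le> exp (b * z * (exp t - 1))"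
proof -
  have eq: "real (passage w 0 z) = (\<Sum>x\<in>{0} \<times> {1..z}. of_bool (w x))" for w
  proof -
    have "(\<Sum>x\<in>{0} \<times> {1..z}. of_bool (w x)) = (\<Sum>y\<in>{1..z}. of_bool (w (0, y)) :: real)"
      by (rule sum.reindex_bij_witness[of _ "\<lambda>y. (0, y)" snd]) auto
    then show ?thesis
      by (simp only: passage_vertical of_nat_sum of_nat_of_bool)
  qed
  show ?thesis
    unfolding eq boundary_field_def
    by (rule order_trans[OF expectation_exp_count[where a = b]]) (use assms in auto)
qed

text \<open>The difference telescopes into the increments along the right side, which are
  independent with density \<open>b\<close> by \<open>burke\<close>.\<close>

lemma boundary_field_right_mgf:
  assumes "a \<in> {0..1}" "b \<in> {0..1}" "p \<in> {0..1}" "a * b = p * (1 - a) * (1 - b)"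
  shows "measure_pmf.expectation (boundary_field a b p n m) (\<lambda>w. exp (t * (real (passage w n m) - real (passage w n 0))))
    \<le> exp (b * m * (exp t - 1))"
proof -
  define v where "v = (\<lambda>w y. y \<in> {1..m} \<and> passage w n y \<noteq> passage w n (y - 1))"
  have "real (passage w n m) - real (passage w n 0) = (\<Sum>y\<in>{1..m}. of_bool (v w y))" for w
  proof -
    have "real (passage w n m) - real (passage w n 0) = (\<Sum>y\<in>{Suc 0..m}. real (passage w n y) - real (passage w n (y - 1)))"
      using sum_telescope''[of 0 m "\<lambda>y. real (passage w n y)"] by simp
    also have "\<dots> = (\<Sum>y\<in>{1..m}. of_bool (v w y))"
    proof (rule sum.cong)
      fix y assume "y \<in> {1..m}"
      then show "real (passage w n y) - real (passage w n (y - 1)) = of_bool (v w y)"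
        using passage_Suc_right_eq[of w n "y - 1"] by (auto simp: v_def)
    qed simp
    finally show ?thesis .
  qed
  then have "measure_pmf.expectation (boundary_field a b p n m) (\<lambda>w. exp (t * (real (passage w n m) - real (passage w n 0)))) =
    measure_pmf.expectation (map_pmf v (boundary_field a b p n m)) (\<lambda>f. exp (t * (\<Sum>y\<in>{1..m}. of_bool (f y))))"
    by simp
  also have "map_pmf v (boundary_field a b p n m) = Pi_pmf {1..m} False (\<lambda>_. bernoulli_pmf b)"
    unfolding v_def by (rule burke[OF assms])
  also have "measure_pmf.expectation \<dots> (\<lambda>f. exp (t * (\<Sum>y\<in>{1..m}. of_bool (f y)))) \<le> exp (b * m * (exp t - 1))"
    by (rule order_trans[OF expectation_exp_count[where a = b]]) (use assms in auto)
  finally show ?thesis .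
qed

subsection \<open>Tail bounds for independent edges\<close>

text \<open>In terms of the odds \<open>u = a / (1 - a)\<close> and \<open>v = b / (1 - b)\<close>
  Burke's condition reads \<open>u * v = p\<close>. Its solutions \<open>u = sqrt p * l\<close>,
  \<open>v = sqrt p / l\<close> are the origin of the parameter \<open>l\<close>.\<close>

lemma stationary_densities:
  fixes u v p :: real
  assumes "u \<ge> 0" "v \<ge> 0" "u * v = p"
  shows "u / (1 + u) * (v / (1 + v)) = p * (1 - u / (1 + u)) * (1 - v / (1 + v))"
proof -
  have "1 - u / (1 + u) = 1 / (1 + u)" "1 - v / (1 + v) = 1 / (1 + v)"
    using assms by (simp_all add: field_simps)
  then show ?thesis
    using assms(3) by simp
qed

text \<open>Density and odds differ only in second order, which is harmless for the small
  \<open>p = 1 / k\<close> of interest.\<close>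

lemma density_bounds:
  fixes u :: real
  assumes "u \<ge> 0"
  shows "u / (1 + u) \<in> {0..1}" "u / (1 + u) \<le> u" "u - u\<^sup>2 \<le> u / (1 + u)"
proof -
  have "u \<le> u * (1 + u)" "(u - u\<^sup>2) * (1 + u) \<le> u"
    using assms by (simp_all add: algebra_simps power2_eq_square)
  then show "u / (1 + u) \<in> {0..1}" "u / (1 + u) \<le> u" "u - u\<^sup>2 \<le> u / (1 + u)"
    using assms by (simp_all add: divide_simps)
qed

lemma edge_field_prob_le_boundary_field:
  "measure_pmf.prob (edge_field p n m) {w. c \<le> real (max_planar_matching (edges_in w 0 0 n m))}
   \<le> measure_pmf.prob (boundary_field a b p n m) {w. c \<le> real (passage w n m)}"
proof -
  have "measure_pmf.prob (edge_field p n m) {w. c \<le> real (max_planar_matching (edges_in w 0 0 n m))}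
    = measure_pmf.prob (map_pmf (\<lambda>w. max_planar_matching (edges_in w 0 0 n m)) (edge_field p n m)) {l. c \<le> real l}"
    by (simp add: vimage_def)
  also have "\<dots> = measure_pmf.prob (boundary_field a b p n m) {w. c \<le> real (max_planar_matching (edges_in w 0 0 n m))}"
    unfolding boundary_field_edges_in[of 0 0 n m a b p, symmetric] by (simp add: vimage_def)
  also have "\<dots> \<le> measure_pmf.prob (boundary_field a b p n m) {w. c \<le> real (passage w n m)}"
    using max_planar_matching_edges_in_le_passage[of _ n m]
    by (intro measure_pmf.finite_measure_mono) (auto intro: order_trans)
  finally show ?thesis .
qed

text \<open>The sources \<open>S\<close> and the right increments \<open>R\<close> have known laws
  but are dependent. The bound \<open>x * y \<le> (x\<^sup>2 + y\<^sup>2) / 2\<close> separates them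
  at the price of \<open>2 * t\<close>; for small \<open>t\<close> little is lost, since
  \<open>(exp (2 * t) - 1) / 2\<close> is \<open>t\<close> to first order.\<close>

lemma edge_field_exp_tail:
  fixes p t :: real
  assumes "0 \<le> p" "p \<le> 1" "t \<ge> 0"
  shows "measure_pmf.prob (edge_field p n m) {w. q \<le> real (max_planar_matching (edges_in w 0 0 n m))}
    \<le> exp (- t * q + sqrt p * (n + m) * (exp (2 * t) - 1) / 2)"
proof -
  define a where "a = sqrt p / (1 + sqrt p)"
  define G where "G = sqrt p * (exp (2 * t) - 1)"
  \<comment> \<open>Tilts the two squares so that their expectations get the same bound, which
    depends on \<open>n + m\<close> only.\<close>
  define c where "c = (real m - real n) * G / 2"
  define M where "M = boundary_field a a p n m"
  define S R where "S = (\<lambda>w. real (passage w n 0))" and "R = (\<lambda>w. real (passage w n m) - real (passage w n 0))"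
  have a: "a \<in> {0..1}" "a \<le> sqrt p"
    using density_bounds[of "sqrt p"] assms by (auto simp: a_def)
  have st: "a * a = p * (1 - a) * (1 - a)"
    unfolding a_def by (rule stationary_densities) (use assms in auto)
  have aG: "a * real k * (exp (2 * t) - 1) \<le> real k * G" for k
  proof -
    have "a * (exp (2 * t) - 1) \<le> G"
      unfolding G_def using a assms by (intro mult_right_mono) auto
    then have "real k * (a * (exp (2 * t) - 1)) \<le> real k * G"
      by (intro mult_left_mono) auto
    then show ?thesis
      by (simp add: mult_ac)
  qed
  have S: "measure_pmf.expectation M (\<lambda>w. exp (2 * t * S w)) \<le> exp (real n * G)"
    unfolding M_def S_def
    by (rule order_trans[OF boundary_field_source_mgf[OF a(1)]]) (use aG[of n] in auto)
  have R: "measure_pmf.expectation M (\<lambda>w. exp (2 * t * R w)) \<le> exp (real m * G)"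
    unfolding M_def R_def
    by (rule order_trans[OF boundary_field_right_mgf[OF a(1) a(1) _ st]]) (use aG[of m] assms in auto)
  have fin: "finite (set_pmf M)"
    by (simp add: M_def)
  note int = integrable_measure_pmf_finite[OF fin]
  have "measure_pmf.expectation M (\<lambda>w. exp (t * real (passage w n m)))
    \<le> measure_pmf.expectation M (\<lambda>w. (exp c * exp (2 * t * S w) + exp (- c) * exp (2 * t * R w)) / 2)"
  proof (rule expectation_mono_finite[OF fin])
    fix w
    define x y where "x = exp (c / 2 + t * S w)" and "y = exp (- c / 2 + t * R w)"
    have "exp (t * real (passage w n m)) = x * y"
      by (simp add: x_def y_def S_def R_def algebra_simps flip: exp_add)
    also have "\<dots> \<le> (x\<^sup>2 + y\<^sup>2) / 2"
      using sum_squares_bound[of x y] by simp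
    also have "x\<^sup>2 = exp c * exp (2 * t * S w)"
      by (simp add: x_def power2_eq_square flip: exp_add)
    also have "y\<^sup>2 = exp (- c) * exp (2 * t * R w)"
      by (simp add: y_def power2_eq_square flip: exp_add)
    finally show "exp (t * real (passage w n m)) \<le> (exp c * exp (2 * t * S w) + exp (- c) * exp (2 * t * R w)) / 2" .
  qed
  also have "\<dots> = (exp c * measure_pmf.expectation M (\<lambda>w. exp (2 * t * S w)) +
      exp (- c) * measure_pmf.expectation M (\<lambda>w. exp (2 * t * R w))) / 2"
    by (simp add: int)
  also have "\<dots> \<le> (exp c * exp (real n * G) + exp (- c) * exp (real m * G)) / 2"
    using S R by (intro divide_right_mono add_mono mult_left_mono) auto
  also have "\<dots> = exp (sqrt p * (n + m) * (exp (2 * t) - 1) / 2)"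
    by (simp add: c_def G_def field_simps flip: exp_add)
  finally have mgf: "measure_pmf.expectation M (\<lambda>w. exp (t * real (passage w n m)))
    \<le> exp (sqrt p * (n + m) * (exp (2 * t) - 1) / 2)" .
  have "measure_pmf.prob (edge_field p n m) {w. q \<le> real (max_planar_matching (edges_in w 0 0 n m))}
    \<le> measure_pmf.prob M {w. q \<le> real (passage w n m)}"
    unfolding M_def by (rule edge_field_prob_le_boundary_field)
  also have "\<dots> \<le> measure_pmf.prob M {w. t * q \<le> t * real (passage w n m)}"
    using assms by (intro measure_pmf.finite_measure_mono) (auto intro: mult_left_mono)
  also have "\<dots> \<le> exp (- (t * q)) * measure_pmf.expectation M (\<lambda>w. exp (t * real (passage w n m)))"
    by (rule exp_Markov[OF fin])
  also have "\<dots> \<le> exp (- (t * q)) * exp (sqrt p * (n + m) * (exp (2 * t) - 1) / 2)"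
    by (intro mult_left_mono mgf) simp
  finally show ?thesis
    by (simp flip: exp_add)
qed

lemma prob_Un_le:
  "measure_pmf.prob M (A \<union> B) \<le> measure_pmf.prob M A + measure_pmf.prob M B"
  by (intro measure_Un_le) auto

text \<open>A passage time exceeding the sum of both means by \<open>2 * s\<close> forces
  \<open>S\<close> or \<open>R\<close> to exceed its own mean by \<open>s\<close>. Varying
  \<open>l\<close> shifts weight between sources and sinks; \<open>r\<close> bounds both means, so
  that the two tails take the same form.\<close>

lemma edge_field_rect_tail:
  fixes p l s r :: real
  assumes "0 \<le> p" "p \<le> 1" "l > 0" "0 < s" "s \<le> 2 * r"
    and "n * (sqrt p * l) \<le> r" "m * (sqrt p / l) \<le> r"
  shows "measure_pmf.prob (edge_field p n m)
    {w. n * (sqrt p * l) + m * (sqrt p / l) + 2 * s \<le> real (max_planar_matching (edges_in w 0 0 n m))}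
    \<le> 2 * exp (- s\<^sup>2 / (4 * r))"
proof -
  define u v where "u = sqrt p * l" and "v = sqrt p / l"
  define a b where "a = u / (1 + u)" and "b = v / (1 + v)"
  define M where "M = boundary_field a b p n m"
  define S R where "S = (\<lambda>w. real (passage w n 0))" and "R = (\<lambda>w. real (passage w n m) - real (passage w n 0))"
  have uv: "u \<ge> 0" "v \<ge> 0" "u * v = p"
    using assms by (simp_all add: u_def v_def)
  have a: "a \<in> {0..1}" "a \<le> u" and b: "b \<in> {0..1}" "b \<le> v"
    using density_bounds[of u] density_bounds[of v] uv by (auto simp: a_def b_def)
  have st: "a * b = p * (1 - a) * (1 - b)"
    unfolding a_def b_def by (rule stationary_densities) (use uv in auto)
  have an: "a * n \<le> n * u" and bm: "b * m \<le> m * v"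
    using mult_right_mono[OF a(2), of "real n"] mult_right_mono[OF b(2), of "real m"]
    by (simp_all add: mult.commute)
  have fin: "finite (set_pmf M)"
    by (simp add: M_def)
  have S: "measure_pmf.prob M {w. a * n + s \<le> S w} \<le> exp (- s\<^sup>2 / (4 * r))"
  proof (rule poisson_tail_upper[OF fin])
    show "measure_pmf.expectation M (\<lambda>w. exp (t * S w)) \<le> exp (a * n * (exp t - 1))" for t
      unfolding M_def S_def by (rule boundary_field_source_mgf[OF a(1)]) simp
  qed (use a an assms in \<open>auto simp: u_def\<close>)
  have R: "measure_pmf.prob M {w. b * m + s \<le> R w} \<le> exp (- s\<^sup>2 / (4 * r))"
  proof (rule poisson_tail_upper[OF fin])
    show "measure_pmf.expectation M (\<lambda>w. exp (t * R w)) \<le> exp (b * m * (exp t - 1))" for t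
      unfolding M_def R_def by (rule boundary_field_right_mgf[OF a(1) b(1) _ st]) (use assms in auto)
  qed (use b bm assms in \<open>auto simp: v_def\<close>)
  have "measure_pmf.prob (edge_field p n m)
      {w. n * u + m * v + 2 * s \<le> real (max_planar_matching (edges_in w 0 0 n m))}
    \<le> measure_pmf.prob M {w. n * u + m * v + 2 * s \<le> real (passage w n m)}"
    unfolding M_def by (rule edge_field_prob_le_boundary_field)
  also have "\<dots> \<le> measure_pmf.prob M ({w. a * n + s \<le> S w} \<union> {w. b * m + s \<le> R w})"
    using an bm by (intro measure_pmf.finite_measure_mono) (auto simp: S_def R_def)
  also have "\<dots> \<le> 2 * exp (- s\<^sup>2 / (4 * r))"
    using prob_Un_le[of M "{w. a * n + s \<le> S w}" "{w. b * m + s \<le> R w}"] S R by linarith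
  finally show ?thesis
    by (simp add: u_def v_def)
qed

lemma boundary_field_edges_in_rect_tail:
  fixes p l s r :: real
  assumes "0 \<le> p" "p \<le> 1" "l > 0" "0 < s" "s \<le> 2 * r" "x0 \<le> n" "y0 \<le> m"
    and "real (n - x0) * (sqrt p * l) \<le> r" "real (m - y0) * (sqrt p / l) \<le> r"
  shows "measure_pmf.prob (boundary_field a b p n m)
    {w. real (n - x0) * (sqrt p * l) + real (m - y0) * (sqrt p / l) + 2 * s
        \<le> real (max_planar_matching (edges_in w x0 y0 n m))}
    \<le> 2 * exp (- s\<^sup>2 / (4 * r))"
proof -
  let ?c = "real (n - x0) * (sqrt p * l) + real (m - y0) * (sqrt p / l) + 2 * s"
  have "measure_pmf.prob (boundary_field a b p n m) {w. ?c \<le> real (max_planar_matching (edges_in w x0 y0 n m))}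
    = measure_pmf.prob (map_pmf (\<lambda>w. max_planar_matching (edges_in w x0 y0 n m)) (boundary_field a b p n m))
        {i. ?c \<le> real i}"
    by (simp add: vimage_def)
  also have "\<dots> = measure_pmf.prob (edge_field p (n - x0) (m - y0))
      {w. ?c \<le> real (max_planar_matching (edges_in w 0 0 (n - x0) (m - y0)))}"
    unfolding boundary_field_edges_in edge_field_edges_in[OF assms(6,7)] by (simp add: vimage_def)
  also have "\<dots> \<le> 2 * exp (- s\<^sup>2 / (4 * r))"
    by (rule edge_field_rect_tail) (use assms in auto)
  finally show ?thesis .
qed

subsection \<open>Lower bound for independent edges\<close>

text \<open>An optimal path leaving the axis at relative position \<open>\<rho> = i / K\<close> has length at most
  \<open>(\<rho> + l (1 - \<rho>) + 1 / l) N\<close> for every \<open>l > 0\<close>; with \<open>l = 1 + e / 2\<close> this falls short of \<open>2 N\<close>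
  as soon as \<open>\<rho> \<ge> e\<close>.\<close>

lemma exit_near_origin:
  fixes e N \<xi> l q B L L0 :: real and i K n :: nat
  assumes e: "0 < e" "e \<le> 1" and \<xi>: "\<xi> = e\<^sup>2 / 64" and l: "l = 1 + e / 2"
    and K: "i < K" "1 / real K \<le> \<xi>" and q: "0 \<le> q" "q * l \<le> \<xi> * N" and N: "N = n * q"
    and total: "2 * N - 3 * \<xi> * N \<le> B + L"
    and B: "B \<le> N * (real (i + 1) / K) + \<xi> * N"
    and L: "L \<le> real (n - i * n div K) * (q * l) + n * (q / l) + 2 * \<xi> * N"
    and L0: "L \<le> L0"
  shows "(1 - e) * 2 * N \<le> L0"
proof -
  define \<rho> where "\<rho> = i / K"
  have N0: "N \<ge> 0"
    using N q by simp
  have \<xi>0: "\<xi> > 0" "5 * \<xi> \<le> e"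
    using e by (simp_all add: \<xi> power2_eq_square)
  have "real (i + 1) / K \<le> \<rho> + \<xi>"
    using K by (simp add: \<rho>_def add_divide_distrib)
  then have "N * (real (i + 1) / K) \<le> N * (\<rho> + \<xi>)"
    using N0 by (intro mult_left_mono)
  then have B': "B \<le> N * (\<rho> + 2 * \<xi>)"
    using B by (simp add: algebra_simps)
  show ?thesis
  proof (cases "\<rho> < e")
    case True
    have "2 * N - 3 * \<xi> * N \<le> N * (\<rho> + 2 * \<xi>) + L0"
      using total B' L0 by linarith
    then have "N * (2 - \<rho> - 5 * \<xi>) \<le> L0"
      by (simp add: algebra_simps)
    moreover have "N * (2 - 2 * e) \<le> N * (2 - \<rho> - 5 * \<xi>)"
      using True \<xi>0 N0 by (intro mult_left_mono) auto
    ultimately show ?thesis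
      by (simp add: algebra_simps)
  next
    case False
    have l0: "l > 0" "1 / l \<le> 1 - e / 2 + (e / 2)\<^sup>2"
    proof -
      \<comment> \<open>The right-hand side is \<open>1 + (e / 2) ^ 3\<close>.\<close>
      have "1 \<le> (1 - e / 2 + (e / 2)\<^sup>2) * l"
        using e by (simp add: l field_simps power2_eq_square)
      then show "l > 0" "1 / l \<le> 1 - e / 2 + (e / 2)\<^sup>2"
        using e by (simp_all add: l pos_divide_le_eq)
    qed
    have "i * n \<le> n * K"
      using K by simp
    then have "i * n div K \<le> n"
      using K by (metis div_le_mono div_mult_self_is_m le_less_trans zero_le)
    then have "real (n - i * n div K) = n - real (i * n div K)"
      by (simp add: of_nat_diff)
    \<comment> \<open>Rounding the grid point costs at most one line of the grid, whose weight
      \<open>q * l\<close> is at most \<open>\<xi> * N\<close> by assumption.\<close>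
    moreover have "real (i * n div K) \<ge> \<rho> * n - 1"
      using floor_divide_of_nat_eq[where ?'a = real, of "i * n" K] by (simp add: \<rho>_def) linarith
    ultimately have n': "real (n - i * n div K) \<le> n - \<rho> * n + 1"
      by linarith
    show ?thesis
    proof (cases "N = 0")
      case True
      then show ?thesis
        using L0 total B' by simp
    next
      case Npos: False
      have q0: "q * l \<ge> 0"
        using q l0 by simp
      have "real (n - i * n div K) * (q * l) \<le> (n - \<rho> * n + 1) * (q * l)"
        using n' q0 by (rule mult_right_mono)
      also have "\<dots> = N * ((1 - \<rho>) * l) + q * l"
        by (simp add: N algebra_simps)
      also have "\<dots> \<le> N * ((1 - \<rho>) * l) + \<xi> * N"
        using q by simp
      finally have L': "real (n - i * n div K) * (q * l) \<le> N * ((1 - \<rho>) * l) + \<xi> * N" .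
      then have "L \<le> N * ((1 - \<rho>) * l) + \<xi> * N + N * (1 / l) + 2 * \<xi> * N"
      proof -
        have "n * (q / l) = N * (1 / l)"
          by (simp add: N)
        then show ?thesis
          using L L' by linarith
      qed
      then have "2 * N - 3 * \<xi> * N \<le> N * (\<rho> + 2 * \<xi>) + N * ((1 - \<rho>) * l) + \<xi> * N + N * (1 / l) + 2 * \<xi> * N"
        using total B' by linarith
      then have "N * 2 \<le> N * (\<rho> + (1 - \<rho>) * l + 1 / l + 8 * \<xi>)"
        by (simp add: algebra_simps)
      then have "2 \<le> \<rho> + (1 - \<rho>) * l + 1 / l + 8 * \<xi>"
        using Npos N0 by simp
      also have "\<dots> \<le> \<rho> + (1 - \<rho>) * l + (1 - e / 2 + (e / 2)\<^sup>2) + 8 * \<xi>"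
        using l0 by simp
      \<comment> \<open>For \<open>\<rho> \<ge> e\<close> the exit loses at least
        \<open>e\<^sup>2 / 2\<close>, against \<open>e\<^sup>2 / 4\<close> from \<open>1 / l\<close>
        and \<open>8 * \<xi> = e\<^sup>2 / 8\<close> from all errors. The 64 in \<open>\<xi>\<close>
        leaves this margin.\<close>
      also have "\<dots> = 2 - \<rho> * e / 2 + 3 / 8 * e\<^sup>2"
        by (simp add: l \<xi> field_simps power2_eq_square)
      finally have "\<rho> * e \<le> 3 / 4 * e\<^sup>2"
        by simp
      moreover have "e * e \<le> \<rho> * e"
        using False e by (intro mult_right_mono) auto
      ultimately have "e * e \<le> 0"
        by (simp add: power2_eq_square)
      then show ?thesis
        using e by (simp add: mult_le_0_iff)
    qed
  qed
qed

text \<open>Exit positions are grouped into \<open>K\<close> cells, so that the later union bound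
  has a number of events independent of \<open>n\<close>.\<close>

lemma grid_cover:
  fixes n K z :: nat
  assumes "0 < n" "0 < K" "z \<le> n"
  shows "\<exists>i<K. i * n div K \<le> z \<and> z \<le> (i + 1) * n div K"
\<comment> \<open>The index \<open>z * K div n\<close> would be \<open>K\<close> here, one too many;
  this \<open>z\<close> goes into the last cell.\<close>
proof (cases "z = n")
  case True
  have "(K - 1) * n div K \<le> K * n div K"
    by (intro div_le_mono) simp
  then show ?thesis
    using assms True by (intro exI[of _ "K - 1"]) auto
next
  case False
  define i where "i = z * K div n"
  have "i * n \<le> z * K"
    by (simp add: i_def)
  then have 1: "i * n div K \<le> z"
    using assms by (metis div_le_mono div_mult_self_is_m)
  have "z * K \<le> (i + 1) * n"
    using assms dividend_less_div_times[of n "z * K"] by (simp add: i_def algebra_simps)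
  then have 2: "z \<le> (i + 1) * n div K"
    using assms by (metis div_le_mono div_mult_self_is_m)
  have "i < K"
    using False assms by (simp add: i_def div_less_iff_less_mult mult.commute)
  then show ?thesis
    using 1 2 by blast
qed

text \<open>The deterministic half of the lower bound, with all randomness confined to quantities at
  grid points. Inside a cell the points collected on the axis grow with \<open>z\<close> and are
  read off at the right end, while the remaining matching shrinks and is read off at the left
  end.\<close>

lemma max_planar_matching_edges_in_lower:
  fixes e N \<xi> l q :: real and K n :: nat
  assumes e: "0 < e" "e \<le> 1" and \<xi>: "\<xi> = e\<^sup>2 / 64" and l: "l = 1 + e / 2"
    and K: "0 < K" "1 / real K \<le> \<xi>" and q: "0 \<le> q" "q * l \<le> \<xi> * N" and N: "N = n * q" "0 < n"
    and total: "2 * N - 3 * \<xi> * N \<le> passage w n n"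
    and horizontal: "\<And>i. i \<le> K \<Longrightarrow> passage w (i * n div K) 0 \<le> N * (i / K) + \<xi> * N"
      "\<And>i. i \<le> K \<Longrightarrow> max_planar_matching (edges_in w (i * n div K) 0 n n) \<le>
         real (n - i * n div K) * (q * l) + n * (q / l) + 2 * \<xi> * N"
    and vertical: "\<And>i. i \<le> K \<Longrightarrow> passage w 0 (i * n div K) \<le> N * (i / K) + \<xi> * N"
      "\<And>i. i \<le> K \<Longrightarrow> max_planar_matching (edges_in w 0 (i * n div K) n n) \<le>
         real (n - i * n div K) * (q * l) + n * (q / l) + 2 * \<xi> * N"
  shows "(1 - e) * 2 * N \<le> max_planar_matching (edges_in w 0 0 n n)"
  using passage_exit[of n w n]
proof (elim disjE exE conjE)
  fix z assume z: "z \<le> n" "passage w n n \<le> passage w z 0 + max_planar_matching (edges_in w z 0 n n)"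
  obtain i where i: "i < K" "i * n div K \<le> z" "z \<le> (i + 1) * n div K"
    using grid_cover[OF N(2) K(1) z(1)] by blast
  show ?thesis
  proof (rule exit_near_origin[OF e \<xi> l i(1) K(2) q N(1)])
    have "real (passage w z 0) \<le> passage w ((i + 1) * n div K) 0"
      using passage_mono[OF i(3), of 0 0 w] by simp
    then show "passage w z 0 \<le> N * (real (i + 1) / K) + \<xi> * N"
      using horizontal(1)[of "i + 1"] i by simp
    have "real (max_planar_matching (edges_in w z 0 n n)) \<le> max_planar_matching (edges_in w (i * n div K) 0 n n)"
      using max_planar_matching_edges_in_mono[OF i(2), of 0 0 n n n n w] by simp
    then show "max_planar_matching (edges_in w z 0 n n) \<le> real (n - i * n div K) * (q * l) + n * (q / l) + 2 * \<xi> * N"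
      using horizontal(2)[of i] i by simp
    show "real (max_planar_matching (edges_in w z 0 n n)) \<le> max_planar_matching (edges_in w 0 0 n n)"
      using max_planar_matching_edges_in_mono[of 0 z 0 0 n n n n w] by simp
  qed (use total z(2) in linarith)
next
  fix z assume z: "z \<le> n" "passage w n n \<le> passage w 0 z + max_planar_matching (edges_in w 0 z n n)"
  obtain i where i: "i < K" "i * n div K \<le> z" "z \<le> (i + 1) * n div K"
    using grid_cover[OF N(2) K(1) z(1)] by blast
  show ?thesis
  proof (rule exit_near_origin[OF e \<xi> l i(1) K(2) q N(1)])
    have "real (passage w 0 z) \<le> passage w 0 ((i + 1) * n div K)"
      using passage_mono[OF _ i(3), of 0 0 w] by simp
    then show "passage w 0 z \<le> N * (real (i + 1) / K) + \<xi> * N"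
      using vertical(1)[of "i + 1"] i by simp
    have "real (max_planar_matching (edges_in w 0 z n n)) \<le> max_planar_matching (edges_in w 0 (i * n div K) n n)"
      using max_planar_matching_edges_in_mono[OF _ i(2), of 0 0 n n n n w] by simp
    then show "max_planar_matching (edges_in w 0 z n n) \<le> real (n - i * n div K) * (q * l) + n * (q / l) + 2 * \<xi> * N"
      using vertical(2)[of i] i by simp
    show "real (max_planar_matching (edges_in w 0 z n n)) \<le> max_planar_matching (edges_in w 0 0 n n)"
      using max_planar_matching_edges_in_mono[of 0 0 0 z n n n n w] by simp
  qed (use total z(2) in linarith)
qed


lemma boundary_field_boundary_tails:
  fixes a p q s r :: real and n z :: nat
  assumes q: "q = sqrt p" "0 \<le> p" "p \<le> 1" and a: "a = q / (1 + q)"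
    and "n * q \<le> r" "0 < s" "s \<le> 2 * r"
  defines "M \<equiv> boundary_field a a p n n"
  shows "z \<le> n \<Longrightarrow> measure_pmf.prob M {w. z * q + s \<le> real (passage w z 0)} \<le> exp (- s\<^sup>2 / (4 * r))"
    and "z \<le> n \<Longrightarrow> measure_pmf.prob M {w. z * q + s \<le> real (passage w 0 z)} \<le> exp (- s\<^sup>2 / (4 * r))"
    and "measure_pmf.prob M {w. real (passage w n n) \<le> 2 * (a * n) - 2 * s} \<le> 2 * exp (- s\<^sup>2 / (4 * r))"
proof -
  have q0: "q \<ge> 0"
    using q by simp
  have a': "a \<in> {0..1}" "a \<le> q"
    using density_bounds[OF q0] by (auto simp: a)
  have st: "a * a = p * (1 - a) * (1 - a)"
    unfolding a by (rule stationary_densities) (use q0 q in auto)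
  have fin: "finite (set_pmf M)"
    by (simp add: M_def)
  have az: "a * z \<le> z * q" "z * q \<le> r" if "z \<le> n" for z :: nat
  proof -
    show "a * z \<le> z * q"
      using mult_right_mono[OF a'(2), of "real z"] by (simp add: mult.commute)
    have "z * q \<le> n * q"
      using that q0 by (intro mult_right_mono) auto
    then show "z * q \<le> r"
      using assms by linarith
  qed
  have ar: "a * z \<le> r" if "z \<le> n" for z :: nat
    using az[OF that] by linarith
  note source = boundary_field_source_mgf[OF a'(1), of _ n a p n, folded M_def]
    and sink = boundary_field_sink_mgf[OF a'(1), of _ n a p n, folded M_def]
    and right = boundary_field_right_mgf[OF a'(1) a'(1) _ st, of n n, folded M_def]
  {
    assume z: "z \<le> n"
    have "measure_pmf.prob M {w. z * q + s \<le> real (passage w z 0)} \<le>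
        measure_pmf.prob M {w. a * z + s \<le> real (passage w z 0)}"
      using az(1)[OF z] by (intro measure_pmf.finite_measure_mono) auto
    also have "\<dots> \<le> exp (- s\<^sup>2 / (4 * r))"
      by (rule poisson_tail_upper[OF fin source[OF z]]) (use ar[OF z] a' assms in auto)
    finally show "measure_pmf.prob M {w. z * q + s \<le> real (passage w z 0)} \<le> exp (- s\<^sup>2 / (4 * r))" .
    have "measure_pmf.prob M {w. z * q + s \<le> real (passage w 0 z)} \<le>
        measure_pmf.prob M {w. a * z + s \<le> real (passage w 0 z)}"
      using az(1)[OF z] by (intro measure_pmf.finite_measure_mono) auto
    also have "\<dots> \<le> exp (- s\<^sup>2 / (4 * r))"
      by (rule poisson_tail_upper[OF fin sink[OF z]]) (use ar[OF z] a' assms in auto)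
    finally show "measure_pmf.prob M {w. z * q + s \<le> real (passage w 0 z)} \<le> exp (- s\<^sup>2 / (4 * r))" .
  }
  have S: "measure_pmf.prob M {w. real (passage w n 0) \<le> a * n - s} \<le> exp (- s\<^sup>2 / (4 * r))"
    by (rule poisson_tail_lower[OF fin source]) (use ar[of n] a' assms in auto)
  have R: "measure_pmf.prob M {w. real (passage w n n) - real (passage w n 0) \<le> a * n - s} \<le> exp (- s\<^sup>2 / (4 * r))"
    by (rule poisson_tail_lower[OF fin right]) (use ar[of n] a' assms in auto)
  have "measure_pmf.prob M {w. real (passage w n n) \<le> 2 * (a * n) - 2 * s} \<le>
    measure_pmf.prob M ({w. real (passage w n 0) \<le> a * n - s} \<union> {w. real (passage w n n) - real (passage w n 0) \<le> a * n - s})"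
    by (intro measure_pmf.finite_measure_mono) auto
  then show "measure_pmf.prob M {w. real (passage w n n) \<le> 2 * (a * n) - 2 * s} \<le> 2 * exp (- s\<^sup>2 / (4 * r))"
    using S R prob_Un_le[of M "{w. real (passage w n 0) \<le> a * n - s}"
      "{w. real (passage w n n) - real (passage w n 0) \<le> a * n - s}"] by linarith
qed

lemma prob_UN_le:
  fixes c :: real
  assumes "finite I" "\<And>i. i \<in> I \<Longrightarrow> measure_pmf.prob M (A i) \<le> c"
  shows "measure_pmf.prob M (\<Union>i\<in>I. A i) \<le> card I * c"
proof -
  have "measure_pmf.prob M (\<Union>i\<in>I. A i) \<le> (\<Sum>i\<in>I. measure_pmf.prob M (A i))"
    using assms by (intro measure_UNION_le) auto
  also have "\<dots> \<le> card I * c"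
    using assms by (intro sum_bounded_above)
  finally show ?thesis .
qed

text \<open>Union bound over the hypotheses of \<open>max_planar_matching_edges_in_lower\<close>, in
  units of one exponential: 2 for the total passage time and 6 for each of the \<open>K + 1\<close>
  grid points, namely 1 for each axis and 2 for each remaining rectangle.\<close>

lemma edge_field_lower_tail:
  fixes e N \<xi> q p :: real and K n :: nat
  assumes e: "0 < e" "e \<le> 1" and \<xi>: "\<xi> = e\<^sup>2 / 64" and K: "0 < K" "1 / real K \<le> \<xi>"
    and p: "0 < p" "q = sqrt p" "q \<le> \<xi> / 2" and N: "N = n * q" "1 \<le> N"
  shows "measure_pmf.prob (edge_field p n n) {w. real (max_planar_matching (edges_in w 0 0 n n)) < (1 - e) * 2 * N}
    \<le> (6 * K + 8) * exp (- (\<xi>\<^sup>2 / 16) * N)"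
proof -
  define l where "l = 1 + e / 2"
  define a where "a = q / (1 + q)"
  define M where "M = boundary_field a a p n n"
  define s where "s = \<xi> * N"
  define \<delta> where "\<delta> = exp (- (\<xi>\<^sup>2 / 16) * N)"
  define z where "z = (\<lambda>i. i * n div K)"
  have \<xi>1: "0 < \<xi>" "\<xi> \<le> 1"
    using e mult_le_one[of e e] by (auto simp: \<xi> power2_eq_square)
  have q1: "0 < q" "q \<le> 1" "q\<^sup>2 = p"
  proof -
    show "q \<le> 1"
      using p \<xi>1 by linarith
  qed (use p in simp_all)
  have p1: "0 \<le> p" "p \<le> 1"
    using q1 power_le_one[of q 2] by auto
  have n: "0 < n"
    using N by (cases n) auto
  \<comment> \<open>All means that occur are at most \<open>4 * N\<close>, as
    \<open>l \<le> 2\<close>.\<close>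
  have \<delta>: "exp (- s\<^sup>2 / (4 * (4 * N))) = \<delta>"
    using N by (simp add: s_def \<delta>_def power2_eq_square)
  have s: "0 < s" "s \<le> 2 * (4 * N)"
    using \<xi>1 N mult_right_mono[OF \<xi>1(2), of N] by (auto simp: s_def)
  have l1: "1 \<le> l" "l \<le> 2"
    using e by (auto simp: l_def)
  have zn: "z i \<le> n" if "i \<le> K" for i
  proof -
    have "i * n \<le> n * K"
      using that by simp
    then show ?thesis
      unfolding z_def using K(1) by (metis div_le_mono div_mult_self_is_m)
  qed
  have zN: "z i * q \<le> N * (i / K)" for i
  proof -
    have "real (z i) \<le> i * n / K"
      unfolding z_def using of_nat_div_le_of_nat[of "i * n" K, where ?'a = real] by simp
    then have "z i * q \<le> (i * n / K) * q"
      using q1 by (intro mult_right_mono) auto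
    then show ?thesis
      by (simp add: N mult_ac)
  qed
  have mN: "real (n - z i) * (q * l) \<le> 4 * N" "real (n - z i) * (q / (1 / l)) \<le> 4 * N"
    "real (n - 0) * (q / l) \<le> 4 * N" "real (n - 0) * (q * (1 / l)) \<le> 4 * N" for i
  proof -
    have "real (n - z i) * (q * l) \<le> n * (q * 2)"
      using q1 l1 by (intro mult_mono) auto
    then show 1: "real (n - z i) * (q * l) \<le> 4 * N"
      using N by simp
    then show "real (n - z i) * (q / (1 / l)) \<le> 4 * N"
      by simp
    have "n * (q / l) \<le> n * q"
      using q1 l1 by (intro mult_left_mono) (auto simp: divide_le_eq mult_le_cancel_left1)
    then show "real (n - 0) * (q / l) \<le> 4 * N" "real (n - 0) * (q * (1 / l)) \<le> 4 * N"
      using N by simp_all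
  qed
  define B0 where "B0 = {w. real (passage w n n) \<le> 2 * (a * n) - 2 * s}"
  define B1 where "B1 = (\<lambda>i. {w. z i * q + s \<le> real (passage w (z i) 0)})"
  define B2 where "B2 = (\<lambda>i. {w. z i * q + s \<le> real (passage w 0 (z i))})"
  define B3 where "B3 = (\<lambda>i. {w. real (n - z i) * (q * l) + real (n - 0) * (q / l) + 2 * s
    \<le> real (max_planar_matching (edges_in w (z i) 0 n n))})"
  \<comment> \<open>The short side is now the vertical one, so \<open>1 / l\<close> takes the place
    of \<open>l\<close>; the centre is the same as in \<open>B3\<close>.\<close>
  define B4 where "B4 = (\<lambda>i. {w. real (n - 0) * (q * (1 / l)) + real (n - z i) * (q / (1 / l)) + 2 * s
    \<le> real (max_planar_matching (edges_in w 0 (z i) n n))})"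
  have nq: "n * q \<le> 4 * N"
    using N by linarith
  note tails = boundary_field_boundary_tails[OF p(2) p1 a_def nq s, folded M_def, unfolded \<delta>]
  note rect = boundary_field_edges_in_rect_tail[OF p1 _ s, folded p(2), unfolded \<delta>, of _ _ n _ n a a, folded M_def]
  have P0: "measure_pmf.prob M B0 \<le> 2 * \<delta>"
    unfolding B0_def by (rule tails(3))
  have P1: "measure_pmf.prob M (B1 i) \<le> \<delta>" if "i \<le> K" for i
    unfolding B1_def by (rule tails(1)[OF zn[OF that]])
  have P2: "measure_pmf.prob M (B2 i) \<le> \<delta>" if "i \<le> K" for i
    unfolding B2_def by (rule tails(2)[OF zn[OF that]])
  have P3: "measure_pmf.prob M (B3 i) \<le> 2 * \<delta>" if "i \<le> K" for i
    unfolding B3_def by (rule rect) (use l1 zn[OF that] mN in \<open>auto simp del: of_nat_diff\<close>)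
  have P4: "measure_pmf.prob M (B4 i) \<le> 2 * \<delta>" if "i \<le> K" for i
    unfolding B4_def by (rule rect) (use l1 zn[OF that] mN in \<open>auto simp del: of_nat_diff\<close>)
  define B where "B = (\<lambda>i. B1 i \<union> B2 i \<union> (B3 i \<union> B4 i))"
  have PB: "measure_pmf.prob M (B i) \<le> 6 * \<delta>" if "i \<le> K" for i
    using P1[OF that] P2[OF that] P3[OF that] P4[OF that] unfolding B_def
    using prob_Un_le[of M "B1 i \<union> B2 i" "B3 i \<union> B4 i"] prob_Un_le[of M "B1 i" "B2 i"]
      prob_Un_le[of M "B3 i" "B4 i"] by linarith
  have "measure_pmf.prob M (B0 \<union> (\<Union>i\<in>{..K}. B i)) \<le> 2 * \<delta> + card {..K} * (6 * \<delta>)"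
    using prob_Un_le[of M B0 "\<Union>i\<in>{..K}. B i"] P0 prob_UN_le[of "{..K}" M B "6 * \<delta>"] PB
    by fastforce
  also have "\<dots> = (6 * K + 8) * \<delta>"
    by (simp add: algebra_simps)
  finally have PU: "measure_pmf.prob M (B0 \<union> (\<Union>i\<in>{..K}. B i)) \<le> (6 * K + 8) * \<delta>" .
  have good: "(1 - e) * 2 * N \<le> max_planar_matching (edges_in w 0 0 n n)" if w: "w \<notin> B0 \<union> (\<Union>i\<in>{..K}. B i)" for w
  proof (rule max_planar_matching_edges_in_lower[OF e \<xi> l_def K _ _ N(1) n])
    show "0 \<le> q"
      using q1 by simp
    have "q * l \<le> \<xi> / 2 * 2"
      using p l1 q1 \<xi>1 by (intro mult_mono) auto
    also have "\<dots> \<le> \<xi> * N"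
      using N \<xi>1 by simp
    finally show "q * l \<le> \<xi> * N" .
    \<comment> \<open>The density \<open>a\<close> is below \<open>q\<close> by at most
      \<open>q\<^sup>2\<close>. With \<open>q \<le> \<xi> / 2\<close> this loses
      \<open>\<xi> * N\<close> on the two sides together; fluctuations lose \<open>2 * s\<close>
      more.\<close>
    have "a * n \<ge> (q - q\<^sup>2) * n"
      unfolding a_def using density_bounds(3)[of q] q1 by (intro mult_right_mono) auto
    also have "(q - q\<^sup>2) * n = N - q * N"
      by (simp add: N power2_eq_square algebra_simps)
    finally have "a * n \<ge> N - \<xi> / 2 * N"
      using mult_right_mono[OF p(3), of N] N by linarith
    moreover have "real (passage w n n) \<ge> 2 * (a * n) - 2 * s"
      using w by (auto simp: B0_def)
    ultimately show "2 * N - 3 * \<xi> * N \<le> passage w n n"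
      unfolding s_def by linarith
    fix i assume i: "i \<le> K"
    then have w': "w \<notin> B1 i" "w \<notin> B2 i" "w \<notin> B3 i" "w \<notin> B4 i"
      using w by (auto simp: B_def)
    show "passage w (i * n div K) 0 \<le> N * (i / K) + \<xi> * N"
      using w'(1) zN[of i] by (simp add: B1_def s_def z_def)
    show "passage w 0 (i * n div K) \<le> N * (i / K) + \<xi> * N"
      using w'(2) zN[of i] by (simp add: B2_def s_def z_def)
    show "max_planar_matching (edges_in w (i * n div K) 0 n n) \<le>
         real (n - i * n div K) * (q * l) + n * (q / l) + 2 * \<xi> * N"
      using w'(3) by (simp add: B3_def s_def z_def)
    show "max_planar_matching (edges_in w 0 (i * n div K) n n) \<le>
         real (n - i * n div K) * (q * l) + n * (q / l) + 2 * \<xi> * N"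
      using w'(4) by (simp add: B4_def s_def z_def)
  qed
  have "measure_pmf.prob (edge_field p n n) {w. real (max_planar_matching (edges_in w 0 0 n n)) < (1 - e) * 2 * N} =
    measure_pmf.prob (map_pmf (\<lambda>w. max_planar_matching (edges_in w 0 0 n n)) (edge_field p n n)) {i. real i < (1 - e) * 2 * N}"
    by (simp add: vimage_def)
  also have "\<dots> = measure_pmf.prob M {w. real (max_planar_matching (edges_in w 0 0 n n)) < (1 - e) * 2 * N}"
    unfolding M_def boundary_field_edges_in[of 0 0 n n a a p, symmetric] by (simp add: vimage_def)
  also have "\<dots> \<le> measure_pmf.prob M (B0 \<union> (\<Union>i\<in>{..K}. B i))"
    using good by (intro measure_pmf.finite_measure_mono) (auto simp: not_less[symmetric])
  finally show ?thesis
    using PU by (simp add: \<delta>_def)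
qed

subsection \<open>Pairs of random words\<close>

lemma expectation_pair_pmf_finite:
  fixes f :: "'a \<times> 'b \<Rightarrow> real"
  assumes "finite (set_pmf A)" "finite (set_pmf B)"
  shows "measure_pmf.expectation (pair_pmf A B) f =
    measure_pmf.expectation A (\<lambda>a. measure_pmf.expectation B (\<lambda>b. f (a, b)))"
proof -
  have "measure_pmf.expectation (pair_pmf A B) f = (\<Sum>x\<in>set_pmf A \<times> set_pmf B. f x * pmf (pair_pmf A B) x)"
    using assms by (intro integral_measure_pmf_real) auto
  also have "\<dots> = (\<Sum>a\<in>set_pmf A. \<Sum>b\<in>set_pmf B. f (a, b) * pmf (pair_pmf A B) (a, b))"
    by (simp add: sum.cartesian_product)
  also have "\<dots> = (\<Sum>a\<in>set_pmf A. (\<Sum>b\<in>set_pmf B. f (a, b) * pmf B b) * pmf A a)"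
    by (simp add: pmf_pair sum_distrib_left sum_distrib_right mult_ac)
  also have "\<dots> = (\<Sum>a\<in>set_pmf A. measure_pmf.expectation B (\<lambda>b. f (a, b)) * pmf A a)"
    using assms by (intro sum.cong refl arg_cong2[where f = "(*)"] integral_measure_pmf_real[symmetric]) auto
  also have "\<dots> = measure_pmf.expectation A (\<lambda>a. measure_pmf.expectation B (\<lambda>b. f (a, b)))"
    using assms by (intro integral_measure_pmf_real[symmetric]) auto
  finally show ?thesis .
qed

lemma expectation_pair_pmf_product:
  fixes f :: "'a \<Rightarrow> real" and g :: "'b \<Rightarrow> real"
  assumes "finite (set_pmf A)" "finite (set_pmf B)"
  shows "measure_pmf.expectation (pair_pmf A B) (\<lambda>(a, b). f a * g b) =
    measure_pmf.expectation A f * measure_pmf.expectation B g"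
  by (subst expectation_pair_pmf_finite[OF assms]) simp

lemma prob_eq_expectation:
  "measure_pmf.prob M {x. P x} = measure_pmf.expectation M (\<lambda>x. of_bool (P x))"
proof -
  have "(\<lambda>x. of_bool (P x)) = (indicator {x. P x} :: _ \<Rightarrow> real)"
    by (auto simp: indicator_def)
  then show ?thesis
    by simp
qed

lemma prob_pair_pmf_product:
  assumes "finite (set_pmf A)" "finite (set_pmf B)"
  shows "measure_pmf.prob (pair_pmf A B) {x. P (fst x) \<and> R (snd x)} =
    measure_pmf.prob A {a. P a} * measure_pmf.prob B {b. R b}"
  unfolding prob_eq_expectation expectation_pair_pmf_product[OF assms, symmetric]
  by (rule arg_cong[where f = "measure_pmf.expectation _"]) auto

lemma prob_pair_pmf_section:
  assumes "finite (set_pmf A)" "finite (set_pmf B)"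
  shows "measure_pmf.prob (pair_pmf A B) {x. P (fst x) (snd x)} =
    measure_pmf.expectation A (\<lambda>a. measure_pmf.prob B {b. P a b})"
  unfolding prob_eq_expectation by (subst expectation_pair_pmf_finite[OF assms]) simp

abbreviation letter :: "nat \<Rightarrow> nat pmf" where
  "letter k \<equiv> pmf_of_set {..<k}"

definition words :: "nat \<Rightarrow> nat \<Rightarrow> nat \<Rightarrow> (nat list \<times> nat list) pmf" where
  "words k n m = pair_pmf (replicate_pmf n (letter k)) (replicate_pmf m (letter k))"

lemma finite_set_letter [simp]: "0 < k \<Longrightarrow> finite (set_pmf (letter k))"
  by (simp add: lessThan_empty_iff)

lemma finite_set_replicate_letter [simp]: "0 < k \<Longrightarrow> finite (set_pmf (replicate_pmf n (letter k)))"
  using finite_lists_length_eq[of "set_pmf (letter k)" n]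
  by (simp add: set_replicate_pmf lists_eq_set conj_commute)

lemma finite_set_words [simp]: "0 < k \<Longrightarrow> finite (set_pmf (words k n m))"
  by (simp add: words_def)

lemma set_words: "x \<in> set_pmf (words k n m) \<Longrightarrow> length (fst x) = n \<and> length (snd x) = m"
  by (auto simp: words_def set_replicate_pmf)

lemma words_add:
  "words k (n + n') (m + m') =
    map_pmf (\<lambda>(x, y). (fst x @ fst y, snd x @ snd y)) (pair_pmf (words k n m) (words k n' m'))"
  by (simp add: words_def pair_pmf_def replicate_pmf_distrib map_bind_pmf bind_assoc_pmf bind_return_pmf)
     (subst bind_commute_pmf, rule refl)

lemma prob_letter_eq:
  assumes "0 < k"
  shows "pmf (letter k) c \<le> 1 / k"
  using assms by (simp add: pmf_of_set indicator_def lessThan_empty_iff)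

lemma words_1_1_eq:
  assumes "0 < k"
  shows "measure_pmf.prob (words k 1 1) {x. fst x ! 0 = snd x ! 0} \<le> 1 / k"
proof -
  have "measure_pmf.prob (words k 1 1) {x. fst x ! 0 = snd x ! 0} =
      measure_pmf.expectation (replicate_pmf 1 (letter k))
        (\<lambda>a. measure_pmf.prob (replicate_pmf 1 (letter k)) {b. a ! 0 = b ! 0})"
    unfolding words_def using assms by (intro prob_pair_pmf_section) auto
  also have "\<dots> = measure_pmf.expectation (replicate_pmf 1 (letter k)) (\<lambda>a. pmf (letter k) (a ! 0))"
    unfolding replicate_pmf_1 by (simp add: vimage_def measure_pmf_single)
  also have "\<dots> \<le> measure_pmf.expectation (replicate_pmf 1 (letter k)) (\<lambda>a. 1 / k)"
    using assms by (intro expectation_mono_finite prob_letter_eq) auto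
  finally show ?thesis
    by simp
qed

section \<open>Upper tails by cutting at a pair of equal letters\<close>

abbreviation lcs_tail :: "nat \<Rightarrow> nat \<Rightarrow> nat \<Rightarrow> nat \<Rightarrow> real" where
  "lcs_tail k n m l \<equiv> measure_pmf.prob (words k n m) {x. l \<le> lcs (fst x) (snd x)}"

text \<open>Cutting both words around the letters at \<open>i\<close> and \<open>j\<close> gives
  three independent pairs of words; only the middle one, a pair of single letters, is
  estimated.\<close>

lemma prob_cut_at:
  assumes k: "0 < k"
  shows "measure_pmf.prob (words k (i + (1 + i')) (j + (1 + j')))
      {x. fst x ! i = snd x ! j \<and> l \<le> lcs (take i (fst x)) (take j (snd x)) \<and>
          l' \<le> lcs (drop (Suc i) (fst x)) (drop (Suc j) (snd x))}
    \<le> lcs_tail k i j l * (1 / k) * lcs_tail k i' j' l'"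
    (is "measure_pmf.prob ?W ?E \<le> _")
proof -
  define g where "g = (\<lambda>(x, y, z). (fst x @ fst y @ fst z, snd x @ snd y @ (snd z :: nat list)) :: nat list \<times> nat list)"
  define M where "M = pair_pmf (words k i j) (pair_pmf (words k 1 1) (words k i' j'))"
  have "?W = map_pmf g M"
  proof -
    have "?W = map_pmf (\<lambda>(x, y). (fst x @ fst y, snd x @ snd y))
        (pair_pmf (words k i j) (map_pmf (\<lambda>(x, y). (fst x @ fst y, snd x @ snd y))
          (pair_pmf (words k 1 1) (words k i' j'))))"
      by (subst words_add, subst words_add) (rule refl)
    also have "\<dots> = map_pmf g M"
      unfolding M_def pair_map_pmf2 map_pmf_comp g_def
      by (intro arg_cong2[where f = map_pmf]) (auto simp: fun_eq_iff apsnd_def)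
    finally show ?thesis .
  qed
  then have "measure_pmf.prob ?W ?E = measure_pmf.prob M {x. g x \<in> ?E}"
    by (simp add: vimage_def)
  also have "\<dots> = measure_pmf.prob M {x. l \<le> lcs (fst (fst x)) (snd (fst x)) \<and>
      (fst (fst (snd x)) ! 0 = snd (fst (snd x)) ! 0 \<and> l' \<le> lcs (fst (snd (snd x))) (snd (snd (snd x))))}"
  proof (rule measure_pmf.finite_measure_eq_AE)
    show "AE x in M. (x \<in> {x. g x \<in> ?E}) = (x \<in> {x. l \<le> lcs (fst (fst x)) (snd (fst x)) \<and>
      (fst (fst (snd x)) ! 0 = snd (fst (snd x)) ! 0 \<and> l' \<le> lcs (fst (snd (snd x))) (snd (snd (snd x))))})"
    proof (rule AE_pmfI)
      fix x assume "x \<in> set_pmf M"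
      then obtain a b c d e f where x: "x = ((a, b), (c, d), (e, f))"
        and len: "length a = i" "length b = j" "length c = 1" "length d = 1"
        unfolding M_def using set_words by (cases x) fastforce
      obtain c' d' where cd: "c = [c']" "d = [d']"
        using len by (auto simp: length_Suc_conv)
      show "(x \<in> {x. g x \<in> ?E}) = (x \<in> {x. l \<le> lcs (fst (fst x)) (snd (fst x)) \<and>
      (fst (fst (snd x)) ! 0 = snd (fst (snd x)) ! 0 \<and> l' \<le> lcs (fst (snd (snd x))) (snd (snd (snd x))))})"
        using len(1,2) by (auto simp: x cd g_def nth_append)
    qed
  qed auto
  also have "\<dots> = lcs_tail k i j l * (measure_pmf.prob (words k 1 1) {x. fst x ! 0 = snd x ! 0} *
      lcs_tail k i' j' l')"
    unfolding M_def using k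
    by (subst prob_pair_pmf_product; simp add: prob_pair_pmf_product[symmetric])
  also have "\<dots> \<le> lcs_tail k i j l * (1 / k * lcs_tail k i' j' l')"
    by (intro mult_left_mono mult_right_mono words_1_1_eq k) auto
  finally show ?thesis
    by (simp add: mult_ac)
qed

text \<open>The cut edge is present with probability \<open>1 / k\<close> independently of the blocks before and
  after it. Summing over its exact position is therefore affordable, and no discretisation of the
  block boundaries is needed.\<close>

lemma lcs_tail_cut:
  assumes k: "0 < k"
  shows "lcs_tail k n m (l + 1 + l') \<le>
    (\<Sum>i<n. \<Sum>j<m. lcs_tail k i j l * (1 / k) * lcs_tail k (n - 1 - i) (m - 1 - j) l')"
proof -
  define E where "E = (\<lambda>i j. {x :: nat list \<times> nat list. fst x ! i = snd x ! j \<and>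
    l \<le> lcs (take i (fst x)) (take j (snd x)) \<and> l' \<le> lcs (drop (Suc i) (fst x)) (drop (Suc j) (snd x))})"
  have E: "measure_pmf.prob (words k n m) (E i j) \<le> lcs_tail k i j l * (1 / k) * lcs_tail k (n - 1 - i) (m - 1 - j) l'"
    if "i < n" "j < m" for i j
  proof -
    have "n = i + (1 + (n - 1 - i))" "m = j + (1 + (m - 1 - j))"
      using that by auto
    then show ?thesis
      using prob_cut_at[OF k, of i "n - 1 - i" j "m - 1 - j" l l'] unfolding E_def by simp
  qed
  have "lcs_tail k n m (l + 1 + l') \<le> measure_pmf.prob (words k n m) (\<Union>i\<in>{..<n}. \<Union>j\<in>{..<m}. E i j)"
  proof (rule measure_pmf.finite_measure_mono_AE)
    show "AE x in words k n m. x \<in> {x. l + 1 + l' \<le> lcs (fst x) (snd x)} \<longrightarrow> x \<in> (\<Union>i\<in>{..<n}. \<Union>j\<in>{..<m}. E i j)"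
    proof (intro AE_pmfI impI)
      fix x assume "x \<in> set_pmf (words k n m)" "x \<in> {x. l + 1 + l' \<le> lcs (fst x) (snd x)}"
      then show "x \<in> (\<Union>i\<in>{..<n}. \<Union>j\<in>{..<m}. E i j)"
        using lcs_cut[of l l' "fst x" "snd x"] set_words[of x k n m] by (auto simp: E_def)
    qed
  qed auto
  also have "\<dots> \<le> (\<Sum>i<n. measure_pmf.prob (words k n m) (\<Union>j\<in>{..<m}. E i j))"
    by (intro measure_UNION_le) auto
  also have "\<dots> \<le> (\<Sum>i<n. \<Sum>j<m. measure_pmf.prob (words k n m) (E i j))"
    by (intro sum_mono measure_UNION_le) auto
  also have "\<dots> \<le> (\<Sum>i<n. \<Sum>j<m. lcs_tail k i j l * (1 / k) * lcs_tail k (n - 1 - i) (m - 1 - j) l')"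
    by (intro sum_mono E) auto
  finally show ?thesis .
qed

text \<open>Since \<open>g < \<theta>\<close> the sum is geometric and dominated by large
  \<open>i\<close>. For rates of order \<open>1 / sqrt k\<close> the factor
  \<open>1 / (1 - exp (g - \<theta>))\<close> is of order \<open>sqrt k\<close>.\<close>

lemma exp_convolution_le:
  fixes g \<theta> :: real
  assumes "g < \<theta>" "0 \<le> \<theta>"
  shows "(\<Sum>i<n. exp (\<theta> * real i) * exp (g * real (n - 1 - i))) \<le> exp (\<theta> * n) / (1 - exp (g - \<theta>))"
proof -
  define x where "x = exp (g - \<theta>)"
  have x: "0 < x" "x < 1"
    using assms by (auto simp: x_def)
  have "(\<Sum>i<n. exp (\<theta> * real i) * exp (g * real (n - 1 - i))) \<le> (\<Sum>i<n. exp (\<theta> * n) * x ^ (n - 1 - i))"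
  proof (intro sum_mono)
    fix i assume i: "i \<in> {..<n}"
    then have "\<theta> * real i + g * real (n - 1 - i) = \<theta> * real (n - 1) + (g - \<theta>) * real (n - 1 - i)"
      by (simp add: of_nat_diff algebra_simps)
    also have "\<dots> \<le> \<theta> * n + (g - \<theta>) * real (n - 1 - i)"
      using assms by (intro add_right_mono mult_left_mono) auto
    finally have "exp (\<theta> * real i + g * real (n - 1 - i)) \<le> exp (\<theta> * n + (g - \<theta>) * real (n - 1 - i))"
      by simp
    then show "exp (\<theta> * real i) * exp (g * real (n - 1 - i)) \<le> exp (\<theta> * n) * x ^ (n - 1 - i)"
      by (simp add: exp_add x_def exp_of_nat_mult[symmetric] mult.commute)
  qed
  also have "\<dots> = exp (\<theta> * n) * (\<Sum>i<n. x ^ i)"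
    by (simp add: sum_distrib_left[symmetric] sum.nat_diff_reindex)
  also have "(\<Sum>i<n. x ^ i) \<le> 1 / (1 - x)"
    using x by (simp add: sum_gp_strict divide_right_mono)
  finally show ?thesis
    by (simp add: x_def)
qed

text \<open>Each step peels off the last block of \<open>q\<close> edges with its cut edge.
  Convolving the rate \<open>\<theta>\<close> of the rest with the smaller rate \<open>g\<close> of
  the block returns the rate \<open>\<theta>\<close>, so the rate does not deteriorate with
  \<open>T\<close> and only a factor per block accumulates.\<close>

lemma lcs_tail_upper:
  fixes F g \<theta> :: real
  assumes k: "0 < k" and F: "0 \<le> F" and \<theta>: "g < \<theta>" "0 \<le> \<theta>"
    and q: "\<And>r s. lcs_tail k r s q \<le> F * exp (g * (real r + real s))"
  shows "lcs_tail k n m (T * (q + 1)) \<le>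
    exp (\<theta> * (real n + real m)) * (F / k * (1 / (1 - exp (g - \<theta>)))\<^sup>2) ^ T"
proof (induction T arbitrary: n m)
  case 0
  have "lcs_tail k n m 0 \<le> 1"
    by simp
  also have "\<dots> \<le> exp (\<theta> * (real n + real m))"
    using \<theta> by simp
  finally show ?case
    by simp
next
  case (Suc T)
  define G where "G = 1 / (1 - exp (g - \<theta>))"
  define \<Phi> where "\<Phi> = F / k * G\<^sup>2"
  define h where "h = (\<lambda>n i. exp (\<theta> * real i) * exp (g * real (n - 1 - i)))"
  have G: "0 \<le> G"
    using \<theta> by (simp add: G_def)
  have h: "(\<Sum>i<n. h n i) \<le> exp (\<theta> * n) * G" "0 \<le> (\<Sum>i<n. h n i)" for n
    using exp_convolution_le[OF \<theta>, of n] by (auto simp: h_def G_def intro: sum_nonneg)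
  have "lcs_tail k n m (Suc T * (q + 1)) = lcs_tail k n m (T * (q + 1) + 1 + q)"
    by (simp add: algebra_simps)
  also have "\<dots> \<le> (\<Sum>i<n. \<Sum>j<m. lcs_tail k i j (T * (q + 1)) * (1 / k) * lcs_tail k (n - 1 - i) (m - 1 - j) q)"
    by (rule lcs_tail_cut[OF k])
  also have "\<dots> \<le> (\<Sum>i<n. \<Sum>j<m. (exp (\<theta> * (real i + real j)) * \<Phi> ^ T) * (1 / k) *
      (F * exp (g * (real (n - 1 - i) + real (m - 1 - j)))))"
    using Suc.IH F k unfolding G_def \<Phi>_def
    by (intro sum_mono mult_mono q) (auto intro!: mult_nonneg_nonneg zero_le_power)
  also have "\<dots> = \<Phi> ^ T * (F / k) * ((\<Sum>i<n. h n i) * (\<Sum>j<m. h m j))"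
    by (simp add: sum_product sum_distrib_left h_def distrib_left exp_add mult_ac del: of_nat_diff)
  also have "\<dots> \<le> \<Phi> ^ T * (F / k) * ((exp (\<theta> * n) * G) * (exp (\<theta> * m) * G))"
    using h F G by (intro mult_left_mono mult_mono) (auto simp: \<Phi>_def)
  also have "\<dots> = exp (\<theta> * (real n + real m)) * \<Phi> ^ Suc T"
    by (simp add: \<Phi>_def power2_eq_square distrib_left exp_add mult_ac)
  finally show ?case
    by (simp add: \<Phi>_def G_def)
qed

text \<open>Superadditivity and independence of disjoint blocks; the remainder of length
  \<open>r\<close> contributes a factor at most 1.\<close>

lemma lcs_mgf_lower:
  fixes t :: real
  assumes k: "0 < k" and t: "0 \<le> t"
  shows "measure_pmf.expectation (words k (T * n + r) (T * n + r)) (\<lambda>x. exp (- t * lcs (fst x) (snd x))) \<le>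
    measure_pmf.expectation (words k n n) (\<lambda>x. exp (- t * lcs (fst x) (snd x))) ^ T"
proof (induction T)
  case 0
  have "measure_pmf.expectation (words k r r) (\<lambda>x. exp (- t * lcs (fst x) (snd x))) \<le>
    measure_pmf.expectation (words k r r) (\<lambda>x. 1)"
    using k t by (intro expectation_mono_finite) auto
  then show ?case
    by simp
next
  case (Suc T)
  let ?f = "\<lambda>x :: nat list \<times> nat list. exp (- t * lcs (fst x) (snd x))"
  let ?A = "words k n n" and ?B = "words k (T * n + r) (T * n + r)"
  have "measure_pmf.expectation (words k (Suc T * n + r) (Suc T * n + r)) ?f =
    measure_pmf.expectation (words k (n + (T * n + r)) (n + (T * n + r))) ?f"
    by (simp add: add.assoc)
  also have "\<dots> = measure_pmf.expectation (pair_pmf ?A ?B) (\<lambda>(x, y). ?f (fst x @ fst y, snd x @ snd y))"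
    by (subst words_add) (simp add: case_prod_unfold)
  also have "\<dots> \<le> measure_pmf.expectation (pair_pmf ?A ?B) (\<lambda>(x, y). ?f x * ?f y)"
  proof (rule expectation_mono_finite)
    fix z :: "(nat list \<times> nat list) \<times> (nat list \<times> nat list)"
    obtain x y where z: "z = (x, y)"
      by (cases z)
    have "t * (real (lcs (fst x) (snd x)) + real (lcs (fst y) (snd y))) \<le>
        t * real (lcs (fst x @ fst y) (snd x @ snd y))"
      using lcs_append[of "fst x" "snd x" "fst y" "snd y"] t by (intro mult_left_mono) auto
    then show "(case z of (x, y) \<Rightarrow> ?f (fst x @ fst y, snd x @ snd y)) \<le> (case z of (x, y) \<Rightarrow> ?f x * ?f y)"
      by (simp add: z distrib_left flip: exp_add)
  qed (use k in simp)
  also have "\<dots> = measure_pmf.expectation ?A ?f * measure_pmf.expectation ?B ?f"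
    using k by (intro expectation_pair_pmf_product) auto
  also have "\<dots> \<le> measure_pmf.expectation ?A ?f * measure_pmf.expectation ?A ?f ^ T"
    by (intro mult_left_mono Suc.IH integral_nonneg) auto
  finally show ?case
    by simp
qed

subsection \<open>Comparison of the match graph with independent edges\<close>

lemma prob_replicate_pmf_nth:
  assumes "finite (set_pmf p)"
  shows "measure_pmf.prob (replicate_pmf n p) {xs. \<forall>i<n. xs ! i \<in> A i} = (\<Prod>i<n. measure_pmf.prob p (A i))"
proof (induction n arbitrary: A)
  case (Suc n)
  have fin: "finite (set_pmf (replicate_pmf n p))"
    using finite_lists_length_eq[OF assms, of n] by (simp add: set_replicate_pmf lists_eq_set conj_commute)
  have "replicate_pmf (Suc n) p = map_pmf (\<lambda>x. fst x # snd x) (pair_pmf p (replicate_pmf n p))"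
    by (simp add: pair_pmf_def map_bind_pmf)
  then have "measure_pmf.prob (replicate_pmf (Suc n) p) {xs. \<forall>i<Suc n. xs ! i \<in> A i} =
    measure_pmf.prob (pair_pmf p (replicate_pmf n p)) {x. fst x \<in> A 0 \<and> (\<forall>i<n. snd x ! i \<in> A (Suc i))}"
    by (simp add: vimage_def All_less_Suc2)
  also have "\<dots> = measure_pmf.prob p {x. x \<in> A 0} * measure_pmf.prob (replicate_pmf n p) {xs. \<forall>i<n. xs ! i \<in> A (Suc i)}"
    by (rule prob_pair_pmf_product[OF assms fin])
  also have "\<dots> = (\<Prod>i<Suc n. measure_pmf.prob p (A i))"
    unfolding Suc.IH prod.lessThan_Suc_shift by simp
  finally show ?case .
qed simp

lemma prob_two_letters_eq:
  assumes k: "0 < k" and ij: "i < n" "j < n" "i \<noteq> j"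
  shows "measure_pmf.prob (replicate_pmf n (letter k)) {xs. xs ! i = xs ! j} \<le> 1 / k"
proof -
  define A where "A = (\<lambda>c m. if m = i \<or> m = j then {c} else UNIV :: nat set)"
  have "measure_pmf.prob (replicate_pmf n (letter k)) {xs. xs ! i = xs ! j} \<le>
    measure_pmf.prob (replicate_pmf n (letter k)) (\<Union>c\<in>{..<k}. {xs. \<forall>m<n. xs ! m \<in> A c m})"
  proof (intro measure_pmf.finite_measure_mono_AE AE_pmfI impI)
    fix xs assume xs: "xs \<in> set_pmf (replicate_pmf n (letter k))" "xs \<in> {xs. xs ! i = xs ! j}"
    then have "set xs \<subseteq> {..<k}" "length xs = n"
      using k by (auto simp: set_replicate_pmf lists_eq_set lessThan_empty_iff)
    then have "xs ! i \<in> {..<k}"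
      using ij nth_mem by blast
    moreover have "xs \<in> {xs. \<forall>m<n. xs ! m \<in> A (xs ! i) m}"
      using xs(2) by (auto simp: A_def)
    ultimately show "xs \<in> (\<Union>c\<in>{..<k}. {xs. \<forall>m<n. xs ! m \<in> A c m})"
      by blast
  qed auto
  also have "\<dots> \<le> card {..<k} * (1 / k)\<^sup>2"
  proof (rule prob_UN_le)
    fix c assume "c \<in> {..<k}"
    have "measure_pmf.prob (replicate_pmf n (letter k)) {xs. \<forall>m<n. xs ! m \<in> A c m} =
        (\<Prod>m<n. measure_pmf.prob (letter k) (A c m))"
      using k by (intro prob_replicate_pmf_nth) auto
    also have "\<dots> = (\<Prod>m\<in>{i, j}. measure_pmf.prob (letter k) (A c m))"
      using ij by (intro prod.mono_neutral_right) (auto simp: A_def)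
    also have "\<dots> = (pmf (letter k) c)\<^sup>2"
      using ij by (simp add: A_def measure_pmf_single power2_eq_square)
    also have "\<dots> \<le> (1 / k)\<^sup>2"
      using prob_letter_eq[OF k] by (intro power_mono) auto
    finally show "measure_pmf.prob (replicate_pmf n (letter k)) {xs. \<forall>m<n. xs ! m \<in> A c m} \<le> (1 / k)\<^sup>2" .
  qed simp
  also have "\<dots> = 1 / k"
    using k by (simp add: power2_eq_square)
  finally show ?thesis .
qed

text \<open>Uniqueness is asked only at the positions in \<open>I\<close>, the matched rows. In
  words of length of order \<open>sqrt k\<close> some repetition has a probability of order 1, but a
  repetition of one of the few matched letters is rare.\<close>

definition letters_unique :: "nat set \<Rightarrow> nat list \<Rightarrow> bool" where
  "letters_unique I xs \<longleftrightarrow> (\<forall>i\<in>I. \<forall>j<length xs. i \<noteq> j \<longrightarrow> xs ! i \<noteq> xs ! j)"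

lemma prob_letters_unique:
  assumes k: "0 < k" and I: "I \<subseteq> {..<n}"
  shows "1 - card I * real n / k \<le> measure_pmf.prob (replicate_pmf n (letter k)) {xs. letters_unique I xs}"
proof -
  let ?M = "replicate_pmf n (letter k)"
  have fin: "finite I"
    using I finite_subset by blast
  have "measure_pmf.prob ?M {xs. \<not> letters_unique I xs} \<le>
    measure_pmf.prob ?M (\<Union>z\<in>I \<times> {..<n}. if fst z = snd z then {} else {xs. xs ! fst z = xs ! snd z})"
  proof (intro measure_pmf.finite_measure_mono_AE AE_pmfI impI)
    fix xs assume "xs \<in> set_pmf ?M" "xs \<in> {xs. \<not> letters_unique I xs}"
    then obtain i j where "i \<in> I" "j < n" "i \<noteq> j" "xs ! i = xs ! j"
      by (auto simp: letters_unique_def set_replicate_pmf)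
    then show "xs \<in> (\<Union>z\<in>I \<times> {..<n}. if fst z = snd z then {} else {xs. xs ! fst z = xs ! snd z})"
      by (intro UN_I[of "(i, j)"]) auto
  qed auto
  also have "\<dots> \<le> card (I \<times> {..<n}) * (1 / k)"
    using fin I prob_two_letters_eq[OF k] by (intro prob_UN_le) auto
  finally have "measure_pmf.prob ?M {xs. \<not> letters_unique I xs} \<le> card I * real n / k"
    by (simp add: card_cartesian_product)
  moreover have "measure_pmf.prob ?M {xs. \<not> letters_unique I xs} = 1 - measure_pmf.prob ?M {xs. letters_unique I xs}"
    using measure_pmf.prob_compl[of "{xs. letters_unique I xs}" ?M] by (simp add: Compl_eq Compl_eq_Diff_UNIV[symmetric])
  ultimately show ?thesis
    by linarith
qed

lemma prob_match_graph_section: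
  assumes k: "0 < k" "r \<le> k" and xs: "length xs = r" "set xs \<subseteq> {..<k}"
    and g: "g \<subseteq> {1..r} \<times> {1..s}" "matching g"
    and unique: "letters_unique ((\<lambda>z. fst z - 1) ` g) xs"
  shows "(1 / k) ^ card g * (1 - r / k) ^ (s - card g) \<le>
    measure_pmf.prob (replicate_pmf s (letter k)) {ys. match_graph xs ys = g}"
proof -
  have fin: "finite g"
    using g(1) finite_subset by blast
  define J where "J = (\<lambda>z. snd z - 1) ` g"
  have g_inj: "fst z = fst z' \<longleftrightarrow> z = z'" "snd z = snd z' \<longleftrightarrow> z = z'" if "z \<in> g" "z' \<in> g" for z z'
    using g(2) that by (auto simp: matching_def)
  have inj: "inj_on (\<lambda>z. snd z - 1) g"
  proof (rule inj_onI)
    fix z z' assume z: "z \<in> g" "z' \<in> g" "snd z - 1 = snd z' - 1"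
    moreover have "snd z \<ge> 1" "snd z' \<ge> 1"
      using z g(1) by auto
    ultimately have "snd z = snd z'"
      by linarith
    then show "z = z'"
      using g_inj(2)[of z z'] z by simp
  qed
  have J: "J \<subseteq> {..<s}" "card J = card g"
    using g(1) card_image[OF inj] by (fastforce simp: J_def)+
  define f where "f = (\<lambda>j. SOME i. (Suc i, Suc j) \<in> g)"
  have f: "(Suc (f j), Suc j) \<in> g" if "j \<in> J" for j
  proof -
    obtain a b where ab: "(a, b) \<in> g" "j = b - 1"
      using \<open>j \<in> J\<close> by (auto simp: J_def)
    then have "(Suc (a - 1), Suc j) \<in> g"
      using g(1) by auto
    then show ?thesis
      unfolding f_def by (rule someI)
  qed
  have not_J: "(Suc i, Suc j) \<notin> g" if "j \<notin> J" for i j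
    using that by (force simp: J_def)
  define A where "A = (\<lambda>j. if j \<in> J then {xs ! f j} else {..<k} - set xs)"
  have graph: "match_graph xs ys = g" if ys: "length ys = s" "\<forall>j<s. ys ! j \<in> A j" for ys
  proof -
    have "(Suc i, Suc j) \<in> match_graph xs ys \<longleftrightarrow> (Suc i, Suc j) \<in> g" if ij: "i < r" "j < s" for i j
    proof (cases "j \<in> J")
      case True
      have "f j \<in> (\<lambda>z. fst z - 1) ` g"
        using f[OF True] by force
      then have "xs ! i = xs ! f j \<longleftrightarrow> i = f j"
        using unique[unfolded letters_unique_def, THEN bspec, THEN spec, of "f j" i] ij(1) xs(1)
        by (cases "i = f j") auto
      moreover have "ys ! j = xs ! f j"
        using ys(2) ij True by (auto simp: A_def)
      moreover have "(Suc i, Suc j) \<in> g \<longleftrightarrow> i = f j"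
        using f[OF True] g_inj(2)[of "(Suc i, Suc j)" "(Suc (f j), Suc j)"] by auto
      ultimately show ?thesis
        using ij ys(1) xs(1) by (simp add: match_graph_def)
    next
      case False
      then have "ys ! j \<notin> set xs"
        using ys(2) ij by (auto simp: A_def)
      then show ?thesis
        using not_J[OF False] ij ys(1) xs(1) by (auto simp: match_graph_def) (metis nth_mem)
    qed
    then have "(a, b) \<in> match_graph xs ys \<longleftrightarrow> (a, b) \<in> g" if "a \<in> {1..r}" "b \<in> {1..s}" for a b
      using that by (cases a; cases b) auto
    moreover have "match_graph xs ys \<subseteq> {1..r} \<times> {1..s}"
      using match_graph_subset[of xs ys] xs(1) ys(1) by simp
    ultimately show ?thesis
      using g(1) by (intro set_eqI) blast
  qed
  have "(1 / k) ^ card g * (1 - r / k) ^ (s - card g) = (\<Prod>j<s. if j \<in> J then 1 / k else 1 - r / k)"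
  proof -
    have "(\<Prod>j<s. if j \<in> J then 1 / k else 1 - r / k) =
        (\<Prod>j\<in>{..<s} \<inter> J. 1 / k) * (\<Prod>j\<in>{..<s} - J. 1 - r / k)"
      by (subst prod.If_cases) (auto simp: Diff_eq)
    also have "{..<s} \<inter> J = J"
      using J by auto
    finally show ?thesis
      using J finite_subset[OF J(1)] by (simp add: card_Diff_subset)
  qed
  also have "\<dots> \<le> (\<Prod>j<s. measure_pmf.prob (letter k) (A j))"
  proof (rule prod_mono, safe)
    fix j assume "j < s"
    show "0 \<le> (if j \<in> J then 1 / k else 1 - r / k)"
      using k by simp
    show "(if j \<in> J then 1 / k else 1 - r / k) \<le> measure_pmf.prob (letter k) (A j)"
    proof (cases "j \<in> J")
      case True
      have "f j < r"
        using f[OF True] g(1) by auto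
      then have "xs ! f j < k"
        using xs nth_mem by blast
      then show ?thesis
        using True k by (simp add: A_def measure_pmf_single pmf_of_set lessThan_empty_iff)
    next
      case False
      \<comment> \<open>Letters may repeat in unmatched rows; this only leaves more letters to
        choose from.\<close>
      have "card (set xs) \<le> r"
        using card_length[of xs] xs by simp
      moreover have "card ({..<k} - set xs) = k - card (set xs)"
        using xs by (simp add: card_Diff_subset)
      ultimately have "real k - real r \<le> card ({..<k} - set xs)"
        using k by linarith
      moreover have "measure_pmf.prob (letter k) ({..<k} - set xs) = card ({..<k} - set xs) / k"
        using k by (subst measure_pmf_of_set) (auto simp: lessThan_empty_iff Int_absorb1)
      ultimately show ?thesis
        using False k by (simp add: A_def field_simps)
    qed
  qed
  also have "\<dots> = measure_pmf.prob (replicate_pmf s (letter k)) {ys. \<forall>j<s. ys ! j \<in> A j}"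
    using k by (intro prob_replicate_pmf_nth[symmetric]) simp
  also have "\<dots> \<le> measure_pmf.prob (replicate_pmf s (letter k)) {ys. match_graph xs ys = g}"
    using graph by (intro measure_pmf.finite_measure_mono_AE AE_pmfI impI) (auto simp: set_replicate_pmf)
  finally show ?thesis .
qed

text \<open>Rows whose letters occur only once force the match graph to be the given matching as soon
  as each matched column copies its partner and the other columns avoid the letters of the rows.\<close>

lemma pmf_match_graph_ge:
  assumes k: "0 < k" "r \<le> k" and g: "g \<subseteq> {1..r} \<times> {1..s}" "matching g"
  shows "(1 - card g * real r / k) * ((1 / k) ^ card g * (1 - r / k) ^ (s - card g)) \<le>
    measure_pmf.prob (words k r s) {x. match_graph (fst x) (snd x) = g}"
proof -
  define c where "c = (1 / k) ^ card g * (1 - r / k) ^ (s - card g)"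
  define I where "I = (\<lambda>z. fst z - 1) ` g"
  let ?M = "\<lambda>n. replicate_pmf n (letter k)"
  have c: "0 \<le> c"
    using k by (simp add: c_def)
  have fin: "finite g"
    using g(1) finite_subset by blast
  have I: "I \<subseteq> {..<r}" "card I \<le> card g"
    using g(1) card_image_le[OF fin] by (fastforce simp: I_def)+
  have "1 - card g * real r / k \<le> 1 - card I * real r / k"
    using I k by (simp add: divide_right_mono mult_right_mono)
  also have "\<dots> \<le> measure_pmf.prob (?M r) {xs. letters_unique I xs}"
    by (rule prob_letters_unique[OF k(1) I(1)])
  finally have "(1 - card g * real r / k) * c \<le> measure_pmf.prob (?M r) {xs. letters_unique I xs} * c"
    using c by (rule mult_right_mono)
  also have "\<dots> = measure_pmf.expectation (?M r) (\<lambda>xs. of_bool (letters_unique I xs) * c)"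
    by (simp add: prob_eq_expectation)
  also have "\<dots> \<le> measure_pmf.expectation (?M r) (\<lambda>xs. measure_pmf.prob (?M s) {ys. match_graph xs ys = g})"
  proof (rule expectation_mono_finite)
    fix xs assume "xs \<in> set_pmf (?M r)"
    then have "length xs = r" "set xs \<subseteq> {..<k}"
      using k by (auto simp: set_replicate_pmf lessThan_empty_iff lists_eq_set)
    then show "of_bool (letters_unique I xs) * c \<le> measure_pmf.prob (?M s) {ys. match_graph xs ys = g}"
      using prob_match_graph_section[OF k _ _ g] by (auto simp: c_def I_def of_bool_def)
  qed (use k in simp)
  also have "\<dots> = measure_pmf.prob (words k r s) {x. match_graph (fst x) (snd x) = g}"
    unfolding words_def using k by (intro prob_pair_pmf_section[symmetric]) auto
  finally show ?thesis
    by (simp add: c_def)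
qed

section \<open>The two laws on a fixed matching\<close>

lemma pmf_field_edges_in:
  assumes p: "p \<in> {0..1}" and g: "g \<subseteq> {1..r} \<times> {1..s}"
  shows "pmf (map_pmf (\<lambda>w. edges_in w 0 0 r s) (edge_field p r s)) g = p ^ card g * (1 - p) ^ (r * s - card g)"
proof -
  let ?A = "{1..r} \<times> {1..s}"
  have fin: "finite g"
    using g finite_subset by blast
  have "pmf (map_pmf (\<lambda>w. edges_in w 0 0 r s) (edge_field p r s)) g = measure_pmf.prob (edge_field p r s) {w. edges_in w 0 0 r s = g}"
    by (simp add: pmf_map vimage_def)
  also have "\<dots> = measure_pmf.prob (edge_field p r s) {\<lambda>z. z \<in> g}"
  proof (intro measure_pmf.finite_measure_eq_AE AE_pmfI)
    fix w assume "w \<in> set_pmf (edge_field p r s)"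
    then have "w \<in> {f. \<forall>z. z \<notin> ?A \<longrightarrow> f z = False}"
      unfolding edge_field_def using set_Pi_pmf_subset[of ?A False "\<lambda>_. bernoulli_pmf p"] by (meson finite_SigmaI finite_atLeastAtMost subsetD)
    then have "w z = False" if "z \<notin> ?A" for z
      using that by blast
    moreover have "edges_in w 0 0 r s = {z \<in> ?A. w z}"
      by (auto simp: edges_in_def)
    ultimately show "(w \<in> {w. edges_in w 0 0 r s = g}) = (w \<in> {\<lambda>z. z \<in> g})"
      using g by (auto simp: fun_eq_iff)
  qed auto
  also have "\<dots> = (\<Prod>z\<in>?A. pmf (bernoulli_pmf p) (z \<in> g))"
    unfolding measure_pmf_single edge_field_def using g by (intro pmf_Pi') auto
  also have "\<dots> = (\<Prod>z\<in>?A. if z \<in> g then p else 1 - p)"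
    using p by (intro prod.cong) auto
  also have "\<dots> = (\<Prod>z\<in>?A \<inter> g. p) * (\<Prod>z\<in>?A - g. 1 - p)"
    by (subst prod.If_cases) (auto simp: Diff_eq)
  also have "?A \<inter> g = g"
    using g by auto
  finally show ?thesis
    using g fin by (simp add: card_Diff_subset)
qed

text \<open>Compares the \<open>s - e\<close> unmatched columns avoiding all row letters with the
  absence of \<open>r * s - e\<close> independent edges. For one column and
  \<open>x = r / k\<close>, \<open>(1 - 1 / k) ^ r \<le> exp (- x) \<le> 1 / (1 + x)\<close>, so a
  factor \<open>1 - x\<^sup>2\<close> is enough; Bernoulli's inequality collects these
  factors.\<close>

lemma pmf_ratio_bound:
  fixes k r s e :: nat
  assumes k: "0 < k" "r \<le> k" and e: "e \<le> s" "e \<le> e * r"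
  shows "(1 - real s * real r ^ 2 / real k ^ 2) * (1 - 1 / k) ^ (r * s - e) \<le> (1 - r / k) ^ (s - e)"
proof -
  define x where "x = real r / k"
  have x: "0 \<le> x" "x \<le> 1"
    using k by (auto simp: x_def)
  have k1: "0 \<le> 1 - 1 / real k" "1 - 1 / real k \<le> 1"
    using k by auto
  have "(1 - 1 / k) ^ r \<le> exp (- 1 / k) ^ r"
    using k1 exp_ge_add_one_self[of "- 1 / k"] by (intro power_mono) auto
  also have "\<dots> = exp (- x)"
    by (simp add: x_def exp_of_nat_mult[symmetric])
  also have "\<dots> \<le> 1 / (1 + x)"
    using exp_ge_add_one_self[of x] x by (simp add: exp_minus divide_simps)
  finally have *: "(1 - 1 / k) ^ r \<le> 1 / (1 + x)" .
  have "(1 - x\<^sup>2) * (1 - 1 / k) ^ r \<le> (1 - x\<^sup>2) * (1 / (1 + x))"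
    using * x by (intro mult_left_mono) (auto simp: power_le_one)
  also have "\<dots> = 1 - x"
    using x by (simp add: field_simps power2_eq_square)
  finally have **: "(1 - x\<^sup>2) * (1 - 1 / k) ^ r \<le> 1 - x" .
  have "1 - real s * x\<^sup>2 \<le> 1 - real (s - e) * x\<^sup>2"
    by (simp add: mult_right_mono)
  also have "\<dots> \<le> (1 - x\<^sup>2) ^ (s - e)"
    using Bernoulli_inequality[of "- (x\<^sup>2)" "s - e"] x by (simp add: power_le_one)
  finally have b: "1 - real s * x\<^sup>2 \<le> (1 - x\<^sup>2) ^ (s - e)" .
  \<comment> \<open>Absent edges in the matched columns contribute factors at most 1;
    \<open>e \<le> e * r\<close> allows them to be dropped.\<close>
  have "r * (s - e) = r * s - e * r"
    by (simp add: diff_mult_distrib2 mult.commute)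
  also have "\<dots> \<le> r * s - e"
    using e(2) by (intro diff_le_mono2)
  finally have "r * (s - e) \<le> r * s - e" .
  then have "(1 - 1 / k) ^ (r * s - e) \<le> (1 - 1 / k) ^ (r * (s - e))"
    using k1 by (intro power_decreasing) auto
  then have c: "(1 - 1 / k) ^ (r * s - e) \<le> ((1 - 1 / k) ^ r) ^ (s - e)"
    by (simp add: power_mult)
  have "(1 - real s * x\<^sup>2) * (1 - 1 / k) ^ (r * s - e) \<le> (1 - x\<^sup>2) ^ (s - e) * ((1 - 1 / k) ^ r) ^ (s - e)"
    using b c k1 x by (intro mult_mono) (auto simp: power_le_one)
  also have "\<dots> = ((1 - x\<^sup>2) * (1 - 1 / k) ^ r) ^ (s - e)"
    by (simp add: power_mult_distrib)
  also have "\<dots> \<le> (1 - x) ^ (s - e)"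
    using ** k1 x by (intro power_mono mult_nonneg_nonneg) (auto simp: power_le_one)
  finally show ?thesis
    by (simp add: x_def power_divide)
qed

lemma card_matching_le:
  assumes "g \<subseteq> {1..r} \<times> {1..s::nat}" "matching g"
  shows "card g \<le> s" "card g \<le> card g * r"
proof -
  have "inj_on snd g"
    using assms(2) by (auto simp: inj_on_def matching_def)
  then have "card g = card (snd ` g)"
    by (simp add: card_image)
  also have "\<dots> \<le> card {1..s}"
    using assms(1) by (intro card_mono) auto
  finally show "card g \<le> s"
    by simp
  show "card g \<le> card g * r"
    using assms(1) by (cases r) auto
qed

text \<open>The error is relative to the mass of \<open>g\<close>, so that a sum over matchings
  costs no count of them.\<close>

lemma match_graph_ge_field:
  assumes k: "0 < k" "r \<le> k" and g: "g \<subseteq> {1..r} \<times> {1..s}" "matching g"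
  shows "(1 - card g * real r / k - real s * real r ^ 2 / real k ^ 2) *
      pmf (map_pmf (\<lambda>w. edges_in w 0 0 r s) (edge_field (1 / k) r s)) g \<le>
    measure_pmf.prob (words k r s) {x. match_graph (fst x) (snd x) = g}"
proof -
  define X Y where "X = card g * real r / k" and "Y = real s * real r ^ 2 / real k ^ 2"
  let ?b = "pmf (map_pmf (\<lambda>w. edges_in w 0 0 r s) (edge_field (1 / k) r s)) g"
  let ?a = "measure_pmf.prob (words k r s) {x. match_graph (fst x) (snd x) = g}"
  have XY: "0 \<le> X" "0 \<le> Y"
    by (auto simp: X_def Y_def)
  show "(1 - X - Y) * ?b \<le> ?a"
  proof (cases "1 - X - Y \<le> 0")
    case True
    then have "(1 - X - Y) * ?b \<le> 0"
      by (intro mult_nonpos_nonneg) auto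
    also have "0 \<le> ?a"
      by simp
    finally show ?thesis .
  next
    case False
    then have X: "0 \<le> 1 - X"
      using XY by linarith
    have "(1 - X - Y) * ?b \<le> ((1 - X) * (1 - Y)) * ?b"
      using XY by (intro mult_right_mono) (auto simp: algebra_simps)
    also have "\<dots> = (1 - X) * ((1 / k) ^ card g * ((1 - Y) * (1 - 1 / k) ^ (r * s - card g)))"
      using k by (subst pmf_field_edges_in[OF _ g(1)]) auto
    also have "\<dots> \<le> (1 - X) * ((1 / k) ^ card g * (1 - r / k) ^ (s - card g))"
      unfolding Y_def using X card_matching_le[OF g]
      by (intro mult_left_mono pmf_ratio_bound[OF k]) auto
    also have "\<dots> \<le> ?a"
      unfolding X_def by (rule pmf_match_graph_ge[OF k g])
    finally show ?thesis .
  qed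
qed

section \<open>From matchings to arbitrary events\<close>

lemma edge_field_two_edges:
  assumes p: "p \<in> {0..1}" and z: "z \<in> {1..r} \<times> {1..s}" "z' \<in> {1..r} \<times> {1..s}" "z \<noteq> z'"
  shows "measure_pmf.prob (edge_field p r s) {w. w z \<and> w z'} = p\<^sup>2"
proof -
  let ?A = "{1..r} \<times> {1..s}"
  define B where "B = (\<lambda>x. if x \<in> {z, z'} then {True} else UNIV)"
  have "{w. w z \<and> w z'} = Pi ?A B"
    using z by (auto simp: B_def Pi_def)
  then have "measure_pmf.prob (edge_field p r s) {w. w z \<and> w z'} = (\<Prod>x\<in>?A. measure_pmf.prob (bernoulli_pmf p) (B x))"
    unfolding edge_field_def by (simp add: measure_Pi_pmf_Pi)
  also have "\<dots> = (\<Prod>x\<in>{z, z'}. measure_pmf.prob (bernoulli_pmf p) (B x))"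
    using z by (intro prod.mono_neutral_right) (auto simp: B_def)
  also have "\<dots> = p\<^sup>2"
    using z p by (simp add: B_def measure_pmf_single power2_eq_square)
  finally show ?thesis .
qed

lemma edge_field_not_matching:
  assumes p: "p \<in> {0..1}"
  shows "measure_pmf.prob (edge_field p r s) {w. \<not> matching (edges_in w 0 0 r s)} \<le>
    (real r * real s ^ 2 + real r ^ 2 * real s) * p\<^sup>2"
proof -
  define R where "R = {1..r} \<times> {1..s} \<times> {1..s}"
  define C where "C = {1..r} \<times> {1..r} \<times> {1..s}"
  define E1 :: "nat \<times> nat \<times> nat \<Rightarrow> (nat \<times> nat \<Rightarrow> bool) set" where
    "E1 = (\<lambda>(a, b, b'). if b = b' then {} else {w. w (a, b) \<and> w (a, b')})"
  define E2 :: "nat \<times> nat \<times> nat \<Rightarrow> (nat \<times> nat \<Rightarrow> bool) set" where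
    "E2 = (\<lambda>(a, a', b). if a = a' then {} else {w. w (a, b) \<and> w (a', b)})"
  have "{w. \<not> matching (edges_in w 0 0 r s)} \<subseteq> (\<Union>z\<in>R. E1 z) \<union> (\<Union>z\<in>C. E2 z)"
  proof
    fix w assume "w \<in> {w. \<not> matching (edges_in w 0 0 r s)}"
    then obtain e f where "e \<in> edges_in w 0 0 r s" "f \<in> edges_in w 0 0 r s" "e \<noteq> f" "fst e = fst f \<or> snd e = snd f"
      unfolding matching_def by blast
    then obtain a b a' b' where z: "(a, b) \<in> edges_in w 0 0 r s" "(a', b') \<in> edges_in w 0 0 r s" "(a, b) \<noteq> (a', b')"
      "a = a' \<or> b = b'"
      by (cases e; cases f) auto
    then consider "a = a'" "b \<noteq> b'" | "b = b'" "a \<noteq> a'"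
      by auto
    then show "w \<in> (\<Union>z\<in>R. E1 z) \<union> (\<Union>z\<in>C. E2 z)"
    proof cases
      case 1
      then have "(a, b, b') \<in> R" "w \<in> E1 (a, b, b')"
        using z by (auto simp: R_def E1_def edges_in_def)
      then show ?thesis
        by blast
    next
      case 2
      then have "(a, a', b) \<in> C" "w \<in> E2 (a, a', b)"
        using z by (auto simp: C_def E2_def edges_in_def)
      then show ?thesis
        by blast
    qed
  qed
  then have "measure_pmf.prob (edge_field p r s) {w. \<not> matching (edges_in w 0 0 r s)} \<le>
      measure_pmf.prob (edge_field p r s) ((\<Union>z\<in>R. E1 z) \<union> (\<Union>z\<in>C. E2 z))"
    by (intro measure_pmf.finite_measure_mono) auto
  also have "\<dots> \<le> card R * p\<^sup>2 + card C * p\<^sup>2"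
  proof (rule order_trans[OF prob_Un_le add_mono])
    show "measure_pmf.prob (edge_field p r s) (\<Union>z\<in>R. E1 z) \<le> card R * p\<^sup>2"
    proof (rule prob_UN_le)
      fix z assume "z \<in> R"
      then show "measure_pmf.prob (edge_field p r s) (E1 z) \<le> p\<^sup>2"
        using p by (auto simp: R_def E1_def edge_field_two_edges)
    qed (simp add: R_def)
    show "measure_pmf.prob (edge_field p r s) (\<Union>z\<in>C. E2 z) \<le> card C * p\<^sup>2"
    proof (rule prob_UN_le)
      fix z assume "z \<in> C"
      then show "measure_pmf.prob (edge_field p r s) (E2 z) \<le> p\<^sup>2"
        using p by (auto simp: C_def E2_def edge_field_two_edges)
    qed (simp add: C_def)
  qed
  also have "\<dots> = (real r * real s ^ 2 + real r ^ 2 * real s) * p\<^sup>2"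
    by (simp add: R_def C_def card_cartesian_product power2_eq_square algebra_simps)
  finally show ?thesis .
qed

lemma edge_field_expectation_card:
  assumes p: "p \<in> {0..1}"
  shows "measure_pmf.expectation (edge_field p r s) (\<lambda>w. real (card (edges_in w 0 0 r s))) = real r * real s * p"
proof -
  have "real (card (edges_in w 0 0 r s)) = (\<Sum>z\<in>{1..r} \<times> {1..s}. of_bool (w z))" for w
  proof -
    have "edges_in w 0 0 r s = {1..r} \<times> {1..s} \<inter> {z. w z}"
      by (auto simp: edges_in_def)
    then show ?thesis
      by simp
  qed
  then have "measure_pmf.expectation (edge_field p r s) (\<lambda>w. real (card (edges_in w 0 0 r s))) =
    measure_pmf.expectation (edge_field p r s) (\<lambda>w. \<Sum>z\<in>{1..r} \<times> {1..s}. of_bool (w z))"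
    by presburger
  also have "\<dots> = (\<Sum>z\<in>{1..r} \<times> {1..s}. measure_pmf.expectation (edge_field p r s) (\<lambda>w. of_bool (w z)))"
    by (intro Bochner_Integration.integral_sum integrable_measure_pmf_finite) simp
  also have "\<dots> = (\<Sum>z\<in>{1..r} \<times> {1..s}. p)"
  proof (rule sum.cong)
    fix z assume z: "z \<in> {1..r} \<times> {1..s}"
    have "measure_pmf.expectation (edge_field p r s) (\<lambda>w. of_bool (w z) :: real) =
        measure_pmf.expectation (map_pmf (\<lambda>w. w z) (edge_field p r s)) of_bool"
      by simp
    also have "map_pmf (\<lambda>w. w z) (edge_field p r s) = bernoulli_pmf p"
      unfolding edge_field_def using z by (subst Pi_pmf_component) auto
    finally show "measure_pmf.expectation (edge_field p r s) (\<lambda>w. of_bool (w z)) = p"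
      using p by simp
  qed simp
  also have "\<dots> = real r * real s * p"
    by simp
  finally show ?thesis .
qed

text \<open>Restrict \<open>Ev\<close> to matchings and sum the pointwise bounds. The error consists
  of the expectation of \<open>X\<close>, computed from the mean number \<open>r * s / k\<close> of
  edges, of the equal term \<open>Y\<close>, and of the probability that some row or column has two
  edges.\<close>

lemma words_ge_field:
  assumes k: "0 < k" "r \<le> k"
  shows "measure_pmf.prob (edge_field (1 / k) r s) {w. Ev (edges_in w 0 0 r s)} -
      (real r * real s ^ 2 + 3 * (real r ^ 2 * real s)) / real k ^ 2 \<le>
    measure_pmf.prob (words k r s) {x. Ev (match_graph (fst x) (snd x))}"
proof -
  let ?A = "{1..r} \<times> {1..s}"
  let ?F = "edge_field (1 / k) r s"
  define B where "B = map_pmf (\<lambda>w. edges_in w 0 0 r s) ?F"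
  define W where "W = map_pmf (\<lambda>x. match_graph (fst x) (snd x)) (words k r s)"
  define Y where "Y = real s * real r ^ 2 / real k ^ 2"
  define X where "X = (\<lambda>g :: (nat \<times> nat) set. card g * real r / k)"
  define S where "S = {g \<in> Pow ?A. matching g \<and> Ev g}"
  have p: "1 / real k \<in> {0..1}"
    using k by simp
  have fin: "finite S" "S \<subseteq> Pow ?A"
    by (auto simp: S_def)
  have B: "set_pmf B \<subseteq> Pow ?A"
    by (auto simp: B_def edges_in_def)
  have finB: "finite (set_pmf B)"
    by (simp add: B_def)
  have XY: "0 \<le> X g + Y" for g
    by (simp add: X_def Y_def)
  have "measure_pmf.prob B {g. Ev g} \<le> measure_pmf.prob B (S \<union> {g. \<not> matching g})"
    using B by (intro measure_pmf.finite_measure_mono_AE AE_pmfI impI) (auto simp: S_def)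
  also have "\<dots> \<le> measure_pmf.prob B S + measure_pmf.prob B {g. \<not> matching g}"
    by (rule prob_Un_le)
  also have "measure_pmf.prob B S = (\<Sum>g\<in>S. (1 - X g - Y) * pmf B g) + (\<Sum>g\<in>S. (X g + Y) * pmf B g)"
    using fin by (simp add: measure_measure_pmf_finite algebra_simps flip: sum.distrib)
  also have "(\<Sum>g\<in>S. (1 - X g - Y) * pmf B g) \<le> (\<Sum>g\<in>S. pmf W g)"
  proof (rule sum_mono)
    fix g assume "g \<in> S"
    then show "(1 - X g - Y) * pmf B g \<le> pmf W g"
      using match_graph_ge_field[OF k, of g s]
      by (simp add: S_def B_def W_def X_def Y_def pmf_map vimage_def)
  qed
  also have "(\<Sum>g\<in>S. pmf W g) \<le> measure_pmf.prob (words k r s) {x. Ev (match_graph (fst x) (snd x))}"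
  proof -
    have "(\<Sum>g\<in>S. pmf W g) = measure_pmf.prob W S"
      using fin by (simp add: measure_measure_pmf_finite)
    also have "\<dots> \<le> measure_pmf.prob W {g. Ev g}"
      by (intro measure_pmf.finite_measure_mono) (auto simp: S_def)
    finally show ?thesis
      by (simp add: W_def vimage_def)
  qed
  also have "(\<Sum>g\<in>S. (X g + Y) * pmf B g) \<le> (\<Sum>g\<in>Pow ?A. (X g + Y) * pmf B g)"
    using fin XY by (intro sum_mono2 mult_nonneg_nonneg) auto
  also have "\<dots> = measure_pmf.expectation B (\<lambda>g. X g + Y)"
    using B by (intro integral_measure_pmf_real[symmetric]) auto
  also have "\<dots> = measure_pmf.expectation B X + Y"
    using finB by (subst Bochner_Integration.integral_add) (auto intro: integrable_measure_pmf_finite)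
  also have "measure_pmf.expectation B X = real r ^ 2 * real s / real k ^ 2"
    using edge_field_expectation_card[OF p, of r s]
    by (simp add: B_def X_def power2_eq_square)
  also have "measure_pmf.prob B {g. \<not> matching g} \<le> (real r * real s ^ 2 + real r ^ 2 * real s) * (1 / k)\<^sup>2"
    using edge_field_not_matching[OF p, of r s] by (simp add: B_def vimage_def)
  finally have "measure_pmf.prob B {g. Ev g} \<le>
      measure_pmf.prob (words k r s) {x. Ev (match_graph (fst x) (snd x))} +
      (real r ^ 2 * real s / real k ^ 2 + Y) + (real r * real s ^ 2 + real r ^ 2 * real s) * (1 / k)\<^sup>2"
    by simp
  moreover have "(real r ^ 2 * real s / real k ^ 2 + Y) + (real r * real s ^ 2 + real r ^ 2 * real s) * (1 / k)\<^sup>2 =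
      (real r * real s ^ 2 + 3 * (real r ^ 2 * real s)) / real k ^ 2"
    using k by (simp add: Y_def field_simps)
  ultimately show ?thesis
    by (simp add: B_def vimage_def)
qed

text \<open>A lower bound valid for every event becomes an upper bound on passing to
  complements.\<close>

lemma words_le_field:
  assumes k: "0 < k" "r \<le> k"
  shows "measure_pmf.prob (words k r s) {x. Ev (match_graph (fst x) (snd x))} \<le>
    measure_pmf.prob (edge_field (1 / k) r s) {w. Ev (edges_in w 0 0 r s)} +
      (real r * real s ^ 2 + 3 * (real r ^ 2 * real s)) / real k ^ 2"
proof -
  have compl: "measure_pmf.prob M {x. \<not> P x} = 1 - measure_pmf.prob M {x. P x}" for M :: "'b pmf" and P
    using measure_pmf.prob_compl[of "{x. P x}" M] by (simp add: Compl_eq Compl_eq_Diff_UNIV[symmetric])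
  show ?thesis
    using words_ge_field[OF k, of s "\<lambda>g. \<not> Ev g"] unfolding compl by linarith
qed

text \<open>Side lengths \<open>R * sqrt k\<close> turn the cubic error over
  \<open>real k ^ 2\<close> into one that vanishes for large \<open>k\<close> and fixed
  \<open>R\<close>; \<open>R \<le> sqrt k\<close> ensures \<open>r \<le> k\<close>.\<close>

lemma words_le_field_scaled:
  fixes R :: real
  assumes k: "0 < k" "R \<le> sqrt k" and rs: "r \<le> R * sqrt k" "s \<le> R * sqrt k"
  shows "measure_pmf.prob (words k r s) {x. Ev (match_graph (fst x) (snd x))} \<le>
    measure_pmf.prob (edge_field (1 / k) r s) {w. Ev (edges_in w 0 0 r s)} + 4 * R ^ 3 / sqrt k"
proof -
  define K where "K = sqrt (real k)"
  have K: "0 < K" "K\<^sup>2 = k"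
    using k by (auto simp: K_def)
  have R: "0 \<le> R"
    using rs(1) K by (metis K_def mult_less_0_iff not_less of_nat_0_le_iff order_trans)
  have "real r \<le> K * K"
    using rs(1) k mult_right_mono[of R K K] K by (simp add: K_def)
  then have "r \<le> k"
    using K by (simp add: power2_eq_square)
  have "real r * real s ^ 2 \<le> (R * K) * (R * K) ^ 2" "real r ^ 2 * real s \<le> (R * K) ^ 2 * (R * K)"
    using rs by (intro mult_mono power_mono; simp add: K_def)+
  then have "(real r * real s ^ 2 + 3 * (real r ^ 2 * real s)) \<le> 4 * R ^ 3 * K ^ 3"
    by (simp add: power2_eq_square power3_eq_cube mult_ac)
  then have "(real r * real s ^ 2 + 3 * (real r ^ 2 * real s)) / real k ^ 2 \<le> 4 * R ^ 3 * K ^ 3 / real k ^ 2"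
    by (rule divide_right_mono) simp
  also have "\<dots> = 4 * R ^ 3 / K"
    using K by (simp add: field_simps power2_eq_square power3_eq_cube flip: K(2))
  finally show ?thesis
    using words_le_field[OF k(1) \<open>r \<le> k\<close>, of s Ev] by (simp add: K_def)
qed

text \<open>Uniform in \<open>r\<close> and \<open>s\<close> although the comparison works at
  bounded scaled size only: for larger blocks the right-hand side exceeds 1. Hence \<open>k0\<close>
  depends on \<open>t\<close> and \<open>q\<close> alone; the factor 2 makes room for the comparison
  error.\<close>

lemma lcs_tail_block:
  fixes t :: real and q :: nat
  assumes t: "0 < t"
  defines "g \<equiv> (exp (2 * t) - 1) / 2"
  shows "\<exists>k0. \<forall>k>k0. \<forall>r s. lcs_tail k r s q \<le> 2 * exp (- t * q) * exp (g / sqrt k * (real r + real s))"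
proof -
  \<comment> \<open>Blocks with \<open>r + s\<close> at least \<open>R * sqrt k\<close> fall under
    the trivial bound.\<close>
  define R where "R = t * q / g"
  have g: "0 < g"
    using t by (simp add: g_def)
  have R: "0 \<le> R"
    using g t by (simp add: R_def)
  \<comment> \<open>Once \<open>b \<le> sqrt k\<close>, both \<open>R \<le> sqrt k\<close> and a
    comparison error of at most \<open>exp (- t * q)\<close> follow.\<close>
  define b where "b = R + 4 * R ^ 3 * exp (t * q)"
  have "\<forall>r s. lcs_tail k r s q \<le> 2 * exp (- t * q) * exp (g / sqrt k * (real r + real s))"
    if kb: "nat \<lceil>b\<^sup>2\<rceil> < k" for k
  proof (intro allI)
    fix r s
    have k: "0 < k"
      using kb by simp
    have b: "0 \<le> b" "R \<le> b" "4 * R ^ 3 * exp (t * q) \<le> b"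
      using R by (auto simp: b_def)
    have "b\<^sup>2 \<le> k"
      using kb by linarith
    then have bk: "b \<le> sqrt k"
      by (rule real_le_rsqrt)
    show "lcs_tail k r s q \<le> 2 * exp (- t * q) * exp (g / sqrt k * (real r + real s))"
    proof (cases "t * q \<le> g / sqrt k * (real r + real s)")
      case True
      have "lcs_tail k r s q \<le> 1"
        by simp
      also have "1 \<le> 2 * exp (- t * q + g / sqrt k * (real r + real s))"
        using True one_le_exp_iff[of "- t * q + g / sqrt k * (real r + real s)"] by linarith
      finally show ?thesis
        by (simp only: exp_add mult.assoc)
    next
      case False
      then have "g * (real r + real s) < t * q * sqrt k"
        using k by (simp add: field_simps)
      then have "real r + real s < R * sqrt k"
        using g by (simp add: R_def field_simps)
      then have rs: "r \<le> R * sqrt k" "s \<le> R * sqrt k"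
        by linarith+
      have "4 * R ^ 3 * exp (t * q) \<le> sqrt k"
        using b bk by linarith
      then have err: "4 * R ^ 3 / sqrt k \<le> exp (- t * q)"
        using k by (simp add: exp_minus field_simps)
      have "lcs_tail k r s q \<le>
          measure_pmf.prob (edge_field (1 / k) r s) {w. q \<le> max_planar_matching (edges_in w 0 0 r s)} + 4 * R ^ 3 / sqrt k"
        using k rs b bk by (intro words_le_field_scaled) auto
      moreover have "measure_pmf.prob (edge_field (1 / k) r s) {w. q \<le> max_planar_matching (edges_in w 0 0 r s)} \<le>
          exp (- t * q + sqrt (1 / k) * (r + s) * (exp (2 * t) - 1) / 2)"
        using edge_field_exp_tail[of "1 / k" t r s "real q"] k t by simp
      moreover have "exp (- t * q + sqrt (1 / k) * (r + s) * (exp (2 * t) - 1) / 2) =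
          exp (- t * q) * exp (g / sqrt k * (real r + real s))"
        by (simp add: g_def real_sqrt_divide mult_ac flip: exp_add)
      moreover have "exp (- t * q) * 1 \<le> exp (- t * q) * exp (g / sqrt k * (real r + real s))"
        using g by (intro mult_left_mono) auto
      ultimately show ?thesis
        using err by linarith
    qed
  qed
  then show ?thesis
    by blast
qed

subsection \<open>The random words graph as the match graph of two random words\<close>

lemma replicate_pmf_conv_Pi_pmf:
  "replicate_pmf n p = map_pmf (\<lambda>f. map f [1..<Suc n]) (Pi_pmf {1..n} d (\<lambda>_. p))"
proof (induction n)
  case (Suc n)
  have "map_pmf (\<lambda>f. map f [1..<Suc (Suc n)]) (Pi_pmf {1..Suc n} d (\<lambda>_. p)) =
    do {x \<leftarrow> p; f \<leftarrow> Pi_pmf {1..n} d (\<lambda>_. p); return_pmf (map (f(Suc n := x)) [1..<Suc (Suc n)])}"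
    by (simp add: atLeastAtMostSuc_conv Pi_pmf_insert pair_pmf_def map_bind_pmf del: upt_Suc)
  also have "\<dots> = do {x \<leftarrow> p; f \<leftarrow> Pi_pmf {1..n} d (\<lambda>_. p); return_pmf (map f [1..<Suc n] @ [x])}"
  proof -
    have "map (f(Suc n := x)) [1..<Suc (Suc n)] = map f [1..<Suc n] @ [x]" for f :: "nat \<Rightarrow> 'a" and x
      by (simp add: upt_Suc_append[of "Suc 0" "Suc n"] del: upt_Suc)
    then show ?thesis
      by (simp only:)
  qed
  also have "\<dots> = do {f \<leftarrow> Pi_pmf {1..n} d (\<lambda>_. p); x \<leftarrow> p; return_pmf (map f [1..<Suc n] @ [x])}"
    by (rule bind_commute_pmf)
  also have "\<dots> = do {xs \<leftarrow> replicate_pmf n p; x \<leftarrow> p; return_pmf (xs @ [x])}"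
    unfolding Suc.IH by (simp add: bind_map_pmf)
  also have "\<dots> = replicate_pmf (n + 1) p"
    unfolding replicate_pmf_distrib by (simp add: bind_assoc_pmf bind_return_pmf)
  finally show ?case
    by simp
qed simp

text \<open>The characters of the nodes \<open>Inl\<close> and \<open>Inr\<close> are independent
  families, and each family read in order is a random word.\<close>

lemma random_words_graph_eq_words:
  "random_words_graph n k = map_pmf (\<lambda>x. match_graph (fst x) (snd x)) (words k n n)"
proof -
  let ?I = "Inl ` {1..n} :: (nat + nat) set" and ?J = "Inr ` {1..n} :: (nat + nat) set"
  let ?P = "\<lambda>A. Pi_pmf A 0 (\<lambda>_. letter k)"
  have inl: "?P {1..n} = map_pmf (\<lambda>g. g \<circ> Inl) (?P ?I)"
    by (intro Pi_pmf_bij_betw) (auto simp: bij_betw_def)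
  have inr: "?P {1..n} = map_pmf (\<lambda>g. g \<circ> Inr) (?P ?J)"
    by (intro Pi_pmf_bij_betw) (auto simp: bij_betw_def)
  have "words k n n = pair_pmf (map_pmf (\<lambda>f. map (f \<circ> Inl) [1..<Suc n]) (?P ?I))
      (map_pmf (\<lambda>g. map (g \<circ> Inr) [1..<Suc n]) (?P ?J))"
  proof -
    have "replicate_pmf n (letter k) = map_pmf (\<lambda>f. map (f \<circ> Inl) [1..<Suc n]) (?P ?I)"
      unfolding replicate_pmf_conv_Pi_pmf[of n _ 0] inl by (simp only: map_pmf_comp)
    moreover have "replicate_pmf n (letter k) = map_pmf (\<lambda>g. map (g \<circ> Inr) [1..<Suc n]) (?P ?J)"
      unfolding replicate_pmf_conv_Pi_pmf[of n _ 0] inr by (simp only: map_pmf_comp)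
    ultimately show ?thesis
      unfolding words_def by metis
  qed
  also have "\<dots> = map_pmf (\<lambda>(f, g). (map (f \<circ> Inl) [1..<Suc n], map (g \<circ> Inr) [1..<Suc n])) (pair_pmf (?P ?I) (?P ?J))"
    by (simp add: pair_pmf_def map_bind_pmf bind_map_pmf del: upt_Suc)
  finally have words: "map_pmf (\<lambda>x. match_graph (fst x) (snd x)) (words k n n) =
    map_pmf (\<lambda>(f, g). match_graph (map (f \<circ> Inl) [1..<Suc n]) (map (g \<circ> Inr) [1..<Suc n])) (pair_pmf (?P ?I) (?P ?J))"
    by (simp add: map_pmf_comp case_prod_unfold del: upt_Suc)
  have "random_characters n k = map_pmf (\<lambda>(f, g) x. if x \<in> ?I then f x else g x) (pair_pmf (?P ?I) (?P ?J))"
    unfolding random_characters_def Plus_def by (intro Pi_pmf_union) auto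
  then have "random_words_graph n k = map_pmf (\<lambda>(f, g). {(a, b) \<in> complete_bipartite n.
      (if Inl a \<in> ?I then f (Inl a) else g (Inl a)) = (if Inr b \<in> ?I then f (Inr b) else g (Inr b))})
    (pair_pmf (?P ?I) (?P ?J))"
    unfolding random_words_graph_def by (simp only: map_pmf_comp case_prod_unfold fst_conv snd_conv)
  also have "\<dots> = map_pmf (\<lambda>(f, g). match_graph (map (f \<circ> Inl) [1..<Suc n]) (map (g \<circ> Inr) [1..<Suc n])) (pair_pmf (?P ?I) (?P ?J))"
  proof (intro arg_cong2[where f = map_pmf] refl ext)
    fix z :: "(nat + nat \<Rightarrow> nat) \<times> (nat + nat \<Rightarrow> nat)"
    obtain f g where z: "z = (f, g)"
      by (cases z)
    have "{(a, b) \<in> complete_bipartite n.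
      (if Inl a \<in> ?I then f (Inl a) else g (Inl a)) = (if Inr b \<in> ?I then f (Inr b) else g (Inr b))} =
      match_graph (map (f \<circ> Inl) [1..<Suc n]) (map (g \<circ> Inr) [1..<Suc n])"
      by (auto simp: complete_bipartite_def match_graph_def simp del: upt_Suc)
    then show "(case z of (f, g) \<Rightarrow> {(a, b) \<in> complete_bipartite n.
      (if Inl a \<in> ?I then f (Inl a) else g (Inl a)) = (if Inr b \<in> ?I then f (Inr b) else g (Inr b))}) =
      (case z of (f, g) \<Rightarrow> match_graph (map (f \<circ> Inl) [1..<Suc n]) (map (g \<circ> Inr) [1..<Suc n]))"
      by (simp only: z prod.case)
  qed
  finally show ?thesis
    unfolding words .
qed

subsection \<open>Upper bounds for random words\<close>

lemma inverse_one_minus_exp_le: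
  fixes x :: real
  assumes "0 < x"
  shows "1 / (1 - exp (- x)) \<le> 1 + 1 / x"
proof -
  have "exp (- x) * (1 + x) \<le> exp (- x) * exp x"
    using exp_ge_add_one_self[of x] by (intro mult_left_mono) auto
  then have "exp (- x) * (1 + x) \<le> 1"
    by (simp flip: exp_add)
  then have "x \<le> (1 - exp (- x)) * (1 + x)"
    by (simp add: algebra_simps)
  moreover have "1 - exp (- x) > 0"
    using assms by simp
  ultimately show ?thesis
    using assms by (simp add: field_simps)
qed

text \<open>The gain \<open>exp (- t * q)\<close> per block must beat the bounded entropy
  \<open>c\<close> of a cut. A \<open>t\<close> of order \<open>\<epsilon>\<close> keeps the rate
  \<open>g\<close> within a factor \<open>1 + \<epsilon> / 8\<close> of \<open>t\<close>, so the
  main terms of the exponent balance near \<open>m = 2 * n / sqrt k\<close>.\<close>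

lemma lcs_tail_exponential:
  fixes \<epsilon> :: real
  assumes \<epsilon>: "0 < \<epsilon>" "\<epsilon> \<le> 1"
  shows "\<exists>k0 t D. 0 < t \<and> (\<forall>k>k0. \<forall>n m. lcs_tail k n n m \<le>
    exp (D + 2 * t * (1 + \<epsilon> / 4) * (real n / sqrt (real k)) - t * (1 - \<epsilon> / 8) * m))"
proof -
  \<comment> \<open>Gives \<open>g \<le> t * (1 + 2 * t) = t * (1 + \<epsilon> / 8)\<close>, hence
    the gap \<open>\<kappa>\<close> between \<open>g\<close> and \<open>\<theta>\<close>.\<close>
  define t where "t = \<epsilon> / 16"
  define g where "g = (exp (2 * t) - 1) / 2"
  define \<theta> where "\<theta> = t * (1 + \<epsilon> / 4)"
  define \<kappa> where "\<kappa> = t * \<epsilon> / 8"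
  define c where "c = 2 * (1 + 1 / \<kappa>)\<^sup>2"
  \<comment> \<open>Makes \<open>ln c + t\<close> at most the share \<open>\<epsilon> / 8\<close> of
    \<open>t * q\<close>. Here \<open>ln c\<close> is the entropy of a cut and \<open>t\<close>
    stands for the cut edge, which is counted but brings no gain of its own.\<close>
  define q where "q = nat \<lceil>8 / (t * \<epsilon>) * (ln c + t)\<rceil>"
  have t: "0 < t" "2 * t \<le> 1"
    using \<epsilon> by (auto simp: t_def)
  have g: "0 < g" "g \<le> t * (1 + \<epsilon> / 8)"
  proof -
    have "exp (2 * t) \<le> 1 + 2 * t + (2 * t)\<^sup>2"
      using t by (intro exp_le_quadratic) auto
    then show "g \<le> t * (1 + \<epsilon> / 8)"
      by (simp add: g_def t_def field_simps power2_eq_square)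
  qed (use t in \<open>simp add: g_def\<close>)
  have \<kappa>: "0 < \<kappa>" "\<kappa> \<le> \<theta> - g"
    using g t \<epsilon> by (auto simp: \<kappa>_def \<theta>_def algebra_simps)
  have \<theta>: "0 \<le> \<theta>"
    using t \<epsilon> by (simp add: \<theta>_def)
  have c: "c > 0"
  proof -
    have "0 < 1 + 1 / \<kappa>"
      using \<kappa> by (simp add: add_pos_pos)
    then show ?thesis
      by (simp add: c_def)
  qed
  have q: "t * (1 - \<epsilon> / 8) * (q + 1) \<le> t * q - ln c"
  proof -
    have "8 / (t * \<epsilon>) * (ln c + t) \<le> q"
      unfolding q_def by linarith
    then have "ln c + t \<le> q * (t * \<epsilon> / 8)"
      using t \<epsilon> by (simp add: field_simps)
    moreover have "0 \<le> t * \<epsilon>"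
      using t \<epsilon> by simp
    ultimately show ?thesis
      by (simp add: algebra_simps)
  qed
  obtain k0 where k0: "\<And>k r s. k > k0 \<Longrightarrow>
      lcs_tail k r s q \<le> 2 * exp (- t * q) * exp (g / sqrt k * (real r + real s))"
    using lcs_tail_block[OF t(1), of q] unfolding g_def by blast
  have "lcs_tail k n n m \<le> exp (t * q + 2 * t * (1 + \<epsilon> / 4) * (real n / sqrt (real k)) - t * (1 - \<epsilon> / 8) * m)"
    if k: "k > k0" for k n m
  proof -
    define K where "K = sqrt (real k)"
    define F where "F = 2 * exp (- t * q)"
    define G where "G = 1 / (1 - exp (g / K - \<theta> / K))"
    define T where "T = m div (q + 1)"
    have K: "1 \<le> K" "K\<^sup>2 = k"
      using k by (auto simp: K_def)
    have less: "g / K < \<theta> / K"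
      using K \<kappa> by (simp add: divide_strict_right_mono)
    have "G \<le> 1 + 1 / (\<theta> / K - g / K)"
      using inverse_one_minus_exp_le[of "\<theta> / K - g / K"] less by (simp add: G_def)
    also have "\<dots> = 1 + K / (\<theta> - g)"
      by (simp flip: diff_divide_distrib)
    also have "\<dots> \<le> K + K / \<kappa>"
      using K \<kappa> by (intro add_mono divide_left_mono) auto
    finally have G: "G \<le> K * (1 + 1 / \<kappa>)"
      by (simp add: algebra_simps)
    have "0 \<le> G"
      using less by (simp add: G_def)
    \<comment> \<open>Two factors \<open>G\<close> of order \<open>K = sqrt k\<close> cancel the
      \<open>1 / k\<close> of the cut edge, so the cost per block is free of
      \<open>k\<close>.\<close>
    then have "F / k * G\<^sup>2 \<le> F / k * (K * (1 + 1 / \<kappa>))\<^sup>2"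
      using G by (intro mult_left_mono power_mono) (auto simp: F_def)
    also have "\<dots> = exp (- t * q) * c"
      using K k by (simp add: F_def c_def power_mult_distrib)
    also have "\<dots> = exp (- (t * q - ln c))"
      using c by (simp add: exp_diff exp_minus exp_add field_simps)
    also have "\<dots> \<le> exp (- (t * (1 - \<epsilon> / 8) * (q + 1)))"
      using q by simp
    finally have \<Phi>: "F / k * G\<^sup>2 \<le> exp (- (t * (1 - \<epsilon> / 8) * (q + 1)))" .
    \<comment> \<open>At most \<open>q\<close> edges are lost in the incomplete block. They cost the
      factor \<open>exp (t * q)\<close>, so \<open>D\<close> is \<open>t * q\<close>.\<close>
    have m: "T * (q + 1) \<le> m" "m \<le> T * (q + 1) + q"
      unfolding T_def using div_mult_mod_eq[of m "q + 1"] mod_less_divisor[of "q + 1" m] by linarith+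
    have "lcs_tail k n n m \<le> lcs_tail k n n (T * (q + 1))"
      using m by (intro measure_pmf.finite_measure_mono) auto
    also have "\<dots> \<le> exp (\<theta> / K * (real n + real n)) * (F / k * G\<^sup>2) ^ T"
      unfolding G_def
      by (rule lcs_tail_upper[OF _ _ less]) (use k0[OF k] k \<theta> K in \<open>auto simp: F_def K_def\<close>)
    also have "\<dots> \<le> exp (\<theta> / K * (real n + real n)) * exp (- (t * (1 - \<epsilon> / 8) * (q + 1))) ^ T"
      using \<Phi> by (intro mult_left_mono power_mono) (auto simp: F_def)
    also have "\<dots> = exp (2 * \<theta> * (n / K) - t * (1 - \<epsilon> / 8) * real (T * (q + 1)))"
      by (simp add: exp_of_nat_mult[symmetric] algebra_simps flip: exp_add)
    also have "\<dots> \<le> exp (t * q + 2 * \<theta> * (n / K) - t * (1 - \<epsilon> / 8) * m)"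
    proof -
      have "real m \<le> real (T * (q + 1)) + real q"
        using m(2) by linarith
      then have "t * (1 - \<epsilon> / 8) * m \<le> t * (1 - \<epsilon> / 8) * (real (T * (q + 1)) + real q)"
        using t \<epsilon> by (intro mult_left_mono) auto
      also have "\<dots> = t * (1 - \<epsilon> / 8) * real (T * (q + 1)) + t * (1 - \<epsilon> / 8) * q"
        by (rule distrib_left)
      also have "t * (1 - \<epsilon> / 8) * q \<le> t * 1 * q"
        using t \<epsilon> by (intro mult_right_mono mult_left_mono) auto
      finally show ?thesis
        by simp
    qed
    finally show ?thesis
      by (simp add: K_def \<theta>_def mult.assoc)
  qed
  then show ?thesis
    using t(1) by blast
qed

text \<open>Just above the level \<open>(1 + \<epsilon>) * (2 * N)\<close> the exponent is at most
  \<open>D - t * \<epsilon> * N\<close>. Beyond it the tail decays geometrically with ratio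
  \<open>exp (- s)\<close>, so the mean exceeds this level by at most the constant \<open>H\<close>,
  in which 1 pays for rounding.\<close>

lemma words_upper:
  fixes \<epsilon> :: real
  assumes \<epsilon>: "0 < \<epsilon>" "\<epsilon> \<le> 1"
  shows "\<exists>k0 c D. 0 < c \<and> (\<forall>k>k0. \<forall>n.
    measure_pmf.prob (words k n n) {x. (1 + \<epsilon>) * (2 * real n / sqrt (real k)) \<le> lcs (fst x) (snd x)} \<le> exp (D - c * (real n / sqrt (real k))) \<and>
    measure_pmf.expectation (words k n n) (\<lambda>x. lcs (fst x) (snd x)) \<le> (1 + \<epsilon>) * (2 * real n / sqrt (real k)) + D)"
proof -
  obtain k0 t D where t: "0 < t" and tail: "\<And>k n m. k > k0 \<Longrightarrow>
      lcs_tail k n n m \<le> exp (D + 2 * t * (1 + \<epsilon> / 4) * (real n / sqrt (real k)) - t * (1 - \<epsilon> / 8) * m)"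
    using lcs_tail_exponential[OF \<epsilon>] by blast
  define s where "s = t * (1 - \<epsilon> / 8)"
  define H where "H = 1 + exp D * (1 / (1 - exp (- s)))"
  have s: "0 < s"
    using t \<epsilon> by (simp add: s_def)
  have "measure_pmf.prob (words k n n) {x. (1 + \<epsilon>) * (2 * real n / sqrt (real k)) \<le> lcs (fst x) (snd x)} \<le> exp (D - t * \<epsilon> * (real n / sqrt (real k)))
    \<and> measure_pmf.expectation (words k n n) (\<lambda>x. lcs (fst x) (snd x)) \<le> (1 + \<epsilon>) * (2 * real n / sqrt (real k)) + H"
    if k: "k > k0" for k n
  proof
    define N where "N = n / sqrt k"
    define M where "M = nat \<lceil>(1 + \<epsilon>) * (2 * N)\<rceil>"
    have N: "0 \<le> N"
      by (simp add: N_def)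
    have M: "(1 + \<epsilon>) * (2 * N) \<le> M" "M \<le> (1 + \<epsilon>) * (2 * N) + 1"
      using N \<epsilon> unfolding M_def by (auto simp: of_nat_nat ceiling_correct; linarith)+
    have exponent: "D + 2 * t * (1 + \<epsilon> / 4) * N - s * M \<le> D - t * \<epsilon> * N"
    proof -
      have "s * ((1 + \<epsilon>) * (2 * N)) \<le> s * M"
        using M s by (intro mult_left_mono) auto
      \<comment> \<open>The gain per \<open>t * N\<close> is at least
        \<open>2 + 3 / 2 * \<epsilon>\<close>, the cost is \<open>2 * (1 + \<epsilon> / 4)\<close>;
        their difference \<open>\<epsilon>\<close> becomes the rate.\<close>
      moreover have "2 + 3 / 2 * \<epsilon> \<le> 2 * (1 - \<epsilon> / 8) * (1 + \<epsilon>)"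
      proof -
        have "\<epsilon> * (1 - \<epsilon>) \<ge> 0"
          using \<epsilon> by simp
        moreover have "2 * (1 - \<epsilon> / 8) * (1 + \<epsilon>) = 2 + 3 / 2 * \<epsilon> + \<epsilon> * (1 - \<epsilon>) / 4"
          by (simp add: field_simps)
        ultimately show ?thesis
          by linarith
      qed
      then have "t * N * (2 + 3 / 2 * \<epsilon>) \<le> t * N * (2 * (1 - \<epsilon> / 8) * (1 + \<epsilon>))"
        using t N by (intro mult_left_mono) auto
      moreover have "s * ((1 + \<epsilon>) * (2 * N)) = t * N * (2 * (1 - \<epsilon> / 8) * (1 + \<epsilon>))"
        by (simp add: s_def)
      moreover have "2 * t * (1 + \<epsilon> / 4) * N = t * N * (2 + 3 / 2 * \<epsilon>) - t * \<epsilon> * N"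
        by (simp add: field_simps)
      ultimately show ?thesis
        by linarith
    qed
    have "measure_pmf.prob (words k n n) {x. (1 + \<epsilon>) * (2 * real n / sqrt (real k)) \<le> lcs (fst x) (snd x)} = lcs_tail k n n M"
      using N \<epsilon> by (intro arg_cong[where f = "measure_pmf.prob _"])
        (auto simp: M_def N_def nat_le_iff ceiling_le_iff)
    also have "\<dots> \<le> exp (D + 2 * t * (1 + \<epsilon> / 4) * N - s * M)"
      using tail[OF k, of n M] by (simp add: N_def s_def)
    also have "\<dots> \<le> exp (D - t * \<epsilon> * N)"
      using exponent by simp
    finally show "measure_pmf.prob (words k n n) {x. (1 + \<epsilon>) * (2 * real n / sqrt (real k)) \<le> lcs (fst x) (snd x)}
      \<le> exp (D - t * \<epsilon> * (real n / sqrt (real k)))"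
      by (simp add: N_def)
    have fin: "finite (set_pmf (words k n n))"
      using k by simp
    \<comment> \<open>The excess over \<open>M\<close> is the number of levels
      \<open>M + j + 1\<close> reached; \<open>j < n\<close> covers all of them because the length
      is at most \<open>n\<close>.\<close>
    have "measure_pmf.expectation (words k n n) (\<lambda>x. lcs (fst x) (snd x)) \<le>
      measure_pmf.expectation (words k n n) (\<lambda>x. real M + (\<Sum>j<n. of_bool (M + j + 1 \<le> lcs (fst x) (snd x))))"
    proof (rule expectation_mono_finite[OF fin])
      fix x assume "x \<in> set_pmf (words k n n)"
      then have "lcs (fst x) (snd x) \<le> n"
        using set_words[of x k n n] max_planar_matching_le_rows[OF match_graph_subset, of "fst x" "snd x"] by simp
      then have "{..<lcs (fst x) (snd x) - M} \<subseteq> {..<n} \<inter> {j. M + j + 1 \<le> lcs (fst x) (snd x)}"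
        by auto
      then have "lcs (fst x) (snd x) - M \<le> card ({..<n} \<inter> {j. M + j + 1 \<le> lcs (fst x) (snd x)})"
        by (metis card_lessThan card_mono finite_Int finite_lessThan)
      then have "real (lcs (fst x) (snd x)) \<le> real M + real (card ({..<n} \<inter> {j. M + j + 1 \<le> lcs (fst x) (snd x)}))"
        by linarith
      then show "real (lcs (fst x) (snd x)) \<le> real M + (\<Sum>j<n. of_bool (M + j + 1 \<le> lcs (fst x) (snd x)))"
        by simp
    qed
    also have "\<dots> = real M + (\<Sum>j<n. lcs_tail k n n (M + j + 1))"
      unfolding prob_eq_expectation
      using fin by (simp add: Bochner_Integration.integral_add integrable_measure_pmf_finite del: sum_of_bool_eq)
    also have "(\<Sum>j<n. lcs_tail k n n (M + j + 1)) \<le> (\<Sum>j<n. exp D * exp (- s) ^ j)"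
    proof (rule sum_mono)
      fix j
      have "lcs_tail k n n (M + j + 1) \<le> exp (D + 2 * t * (1 + \<epsilon> / 4) * N - s * (M + j + 1))"
        using tail[OF k, of n "M + j + 1"] by (simp add: N_def s_def)
      also have "\<dots> \<le> exp (D - s * j)"
      proof -
        have "0 \<le> t * \<epsilon> * N"
          using t \<epsilon> N by simp
        then have "D + 2 * t * (1 + \<epsilon> / 4) * N - s * M \<le> D"
          by (intro order_trans[OF exponent]) simp
        then show ?thesis
          using s by (simp add: algebra_simps)
      qed
      also have "\<dots> = exp D * exp (- s) ^ j"
        by (simp add: exp_of_nat_mult[symmetric] mult.commute flip: exp_add)
      finally show "lcs_tail k n n (M + j + 1) \<le> exp D * exp (- s) ^ j" .
    qed
    also have "\<dots> = exp D * (\<Sum>j<n. exp (- s) ^ j)"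
      by (simp add: sum_distrib_left)
    also have "\<dots> \<le> exp D * (1 / (1 - exp (- s)))"
      using s by (intro mult_left_mono) (auto simp: sum_gp_strict divide_right_mono)
    finally show "measure_pmf.expectation (words k n n) (\<lambda>x. lcs (fst x) (snd x)) \<le> (1 + \<epsilon>) * (2 * real n / sqrt (real k)) + H"
      using M(2) by (simp add: H_def N_def)
  qed
  note * = this
  have "exp (D - t * \<epsilon> * x) \<le> exp (max D H - t * \<epsilon> * x)" for x
    by simp
  moreover have "x + H \<le> x + max D H" for x
    by simp
  ultimately show ?thesis
    using * t \<epsilon> by (intro exI[of _ k0] exI[of _ "t * \<epsilon>"] exI[of _ "max D H"]) (meson mult_pos_pos order_trans)
qed

subsection \<open>Lower bounds for random words\<close>

text \<open>Order of choices: \<open>e\<close> fixes \<open>\<xi>\<close> and \<open>K\<close>, then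
  \<open>N0\<close> makes the tail for independent edges at most \<open>e\<close>, then
  \<open>k\<close> makes the comparison error at most \<open>e\<close>. The first conclusion
  controls the rounding of the side of a block.\<close>

lemma lcs_block_lower:
  fixes e :: real
  assumes e: "0 < e" "e \<le> 1"
  shows "\<exists>k0 N0. 1 \<le> N0 \<and> (\<forall>k>k0. N0 * sqrt k * e \<ge> 1 \<and>
    measure_pmf.prob (words k (nat \<lceil>N0 * sqrt k\<rceil>) (nat \<lceil>N0 * sqrt k\<rceil>))
      {x. lcs (fst x) (snd x) < (1 - e) * 2 * N0} \<le> 2 * e)"
proof -
  define \<xi> where "\<xi> = e\<^sup>2 / 64"
  define K where "K = nat \<lceil>1 / \<xi>\<rceil>"
  define N0 where "N0 = max 1 (16 / \<xi>\<^sup>2 * ln ((6 * K + 8) / e))"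
  define R where "R = N0 + 1"
  \<comment> \<open>The summands serve, in turn, the rounding, the condition
    \<open>q \<le> \<xi> / 2\<close>, the condition \<open>R \<le> sqrt k\<close> and the comparison
    error.\<close>
  define b where "b = 1 / e + 2 / \<xi> + R + 4 * R ^ 3 / e"
  have \<xi>: "0 < \<xi>"
    using e by (simp add: \<xi>_def)
  have K: "0 < K" "1 / real K \<le> \<xi>"
  proof -
    have "0 < 1 / \<xi>"
      using \<xi> by simp
    then show "0 < K"
      unfolding K_def by linarith
    have "1 / \<xi> \<le> K"
      unfolding K_def by linarith
    then show "1 / real K \<le> \<xi>"
      using \<xi> \<open>0 < K\<close> by (simp add: field_simps)
  qed
  have N0: "1 \<le> N0" "(6 * K + 8) * exp (- (\<xi>\<^sup>2 / 16) * N0) \<le> e"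
  proof -
    have "16 / \<xi>\<^sup>2 * ln ((6 * K + 8) / e) \<le> N0"
      by (simp add: N0_def)
    then have "ln ((6 * K + 8) / e) \<le> \<xi>\<^sup>2 / 16 * N0"
      using \<xi> by (simp add: field_simps)
    then have "(6 * K + 8) / e \<le> exp (\<xi>\<^sup>2 / 16 * N0)"
    proof -
      have "0 < (6 * K + 8) / e"
        using e by (intro divide_pos_pos) auto
      then have "exp (ln ((6 * K + 8) / e)) = (6 * K + 8) / e"
        by (rule exp_ln)
      then show ?thesis
        using \<open>ln ((6 * K + 8) / e) \<le> \<xi>\<^sup>2 / 16 * N0\<close> exp_le_cancel_iff[of "ln ((6 * K + 8) / e)" "\<xi>\<^sup>2 / 16 * N0"]
        by simp
    qed
    then show "(6 * K + 8) * exp (- (\<xi>\<^sup>2 / 16) * N0) \<le> e"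
      using e by (simp add: exp_minus field_simps)
  qed (simp add: N0_def)
  have R: "2 \<le> R"
    using N0 by (simp add: R_def)
  have b: "0 \<le> b" "1 / e \<le> b" "2 / \<xi> \<le> b" "R \<le> b" "4 * R ^ 3 / e \<le> b"
    using e \<xi> R by (auto simp: b_def)
  have "N0 * sqrt k * e \<ge> 1 \<and> measure_pmf.prob (words k (nat \<lceil>N0 * sqrt k\<rceil>) (nat \<lceil>N0 * sqrt k\<rceil>))
      {x. lcs (fst x) (snd x) < (1 - e) * 2 * N0} \<le> 2 * e" if kb: "nat \<lceil>b\<^sup>2\<rceil> < k" for k
  proof
    define n where "n = nat \<lceil>N0 * sqrt k\<rceil>"
    define q where "q = sqrt (1 / real k)"
    have k: "0 < k"
      using kb by simp
    have "b\<^sup>2 \<le> k"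
      using kb by linarith
    then have bk: "b \<le> sqrt k"
      by (rule real_le_rsqrt)
    have sk: "1 / e \<le> sqrt k" "2 / \<xi> \<le> sqrt k" "R \<le> sqrt k" "4 * R ^ 3 / e \<le> sqrt k"
      using b bk by linarith+
    have "1 \<le> 1 * (sqrt k * e)"
      using sk(1) e by (simp add: field_simps)
    also have "1 * (sqrt k * e) \<le> N0 * (sqrt k * e)"
      using N0 e by (intro mult_right_mono) auto
    finally show "N0 * sqrt k * e \<ge> 1"
      by (simp add: mult.assoc)
    have q: "q = 1 / sqrt k" "q \<le> \<xi> / 2" "0 < 1 / real k"
      using sk(2) \<xi> k by (auto simp: q_def real_sqrt_divide field_simps)
    have n: "N0 * sqrt k \<le> n" "n \<le> R * sqrt k"
    proof -
      have "0 \<le> N0 * sqrt k"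
        using N0 by simp
      then have "N0 * sqrt k \<le> n" "n \<le> N0 * sqrt k + 1"
        unfolding n_def by linarith+
      moreover have "1 \<le> sqrt k"
        using sk(3) R by linarith
      moreover have "R * sqrt k = N0 * sqrt k + sqrt k"
        by (simp add: R_def distrib_right)
      ultimately show "N0 * sqrt k \<le> n" "n \<le> R * sqrt k"
        by linarith+
    qed
    have N: "N0 \<le> n * q"
      using n k by (simp add: q(1) field_simps)
    have err: "4 * R ^ 3 / sqrt k \<le> e"
      using sk(4) e k by (simp add: field_simps)
    have "measure_pmf.prob (words k n n) {x. lcs (fst x) (snd x) < (1 - e) * 2 * N0} \<le>
      measure_pmf.prob (edge_field (1 / k) n n) {w. max_planar_matching (edges_in w 0 0 n n) < (1 - e) * 2 * N0} + 4 * R ^ 3 / sqrt k"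
      using k sk(3) n by (intro words_le_field_scaled[where Ev = "\<lambda>g. max_planar_matching g < (1 - e) * 2 * N0"]) auto
    moreover have "measure_pmf.prob (edge_field (1 / k) n n) {w. max_planar_matching (edges_in w 0 0 n n) < (1 - e) * 2 * N0} \<le>
      measure_pmf.prob (edge_field (1 / k) n n) {w. real (max_planar_matching (edges_in w 0 0 n n)) < (1 - e) * 2 * (n * q)}"
    proof -
      have "(1 - e) * 2 * N0 \<le> (1 - e) * 2 * (n * q)"
        using N e by (intro mult_left_mono) auto
      then show ?thesis
        by (intro measure_pmf.finite_measure_mono) auto
    qed
    moreover have "measure_pmf.prob (edge_field (1 / k) n n) {w. real (max_planar_matching (edges_in w 0 0 n n)) < (1 - e) * 2 * (n * q)}
        \<le> (6 * K + 8) * exp (- (\<xi>\<^sup>2 / 16) * (n * q))"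
      by (rule edge_field_lower_tail[OF e \<xi>_def K q(3) q_def q(2) refl]) (use N N0 in linarith)
    moreover have "(6 * K + 8) * exp (- (\<xi>\<^sup>2 / 16) * (n * q)) \<le> (6 * K + 8) * exp (- (\<xi>\<^sup>2 / 16) * N0)"
      using N by (intro mult_left_mono) (auto intro!: mult_left_mono)
    ultimately have "measure_pmf.prob (words k n n) {x. lcs (fst x) (snd x) < (1 - e) * 2 * N0} \<le> 2 * e"
      using err N0(2) by linarith
    then show "measure_pmf.prob (words k (nat \<lceil>N0 * sqrt k\<rceil>) (nat \<lceil>N0 * sqrt k\<rceil>))
      {x. lcs (fst x) (snd x) < (1 - e) * 2 * N0} \<le> 2 * e"
      by (simp add: n_def)
  qed
  then show ?thesis
    using N0(1) by blast
qed

text \<open>Chernoff's bound for the concatenation of \<open>T\<close> blocks of side about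
  \<open>N0 * sqrt k\<close>. The failure probability of a block is only known to be at most
  \<open>2 * e\<close>, but its Laplace transform at one fixed \<open>t\<close> is at most
  \<open>exp (- (1 - 7 * e))\<close>, and these factors multiply.\<close>

lemma words_lower:
  fixes \<epsilon> :: real
  assumes \<epsilon>: "0 < \<epsilon>" "\<epsilon> \<le> 1"
  shows "\<exists>k0 c. 0 < c \<and> (\<forall>k>k0. \<forall>n.
    measure_pmf.prob (words k n n) {x. lcs (fst x) (snd x) \<le> (1 - \<epsilon>) * (2 * real n / sqrt k)} \<le>
      exp (1 - c * (real n / sqrt k)))"
proof -
  define e where "e = \<epsilon> / 16"
  have e: "0 < e" "e \<le> 1" "7 * e \<le> 1"
    using \<epsilon> by (auto simp: e_def)
  obtain k0 N0 where N0: "1 \<le> N0" and k0: "\<forall>k>k0. N0 * sqrt k * e \<ge> 1 \<and>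
      measure_pmf.prob (words k (nat \<lceil>N0 * sqrt k\<rceil>) (nat \<lceil>N0 * sqrt k\<rceil>))
      {x. lcs (fst x) (snd x) < (1 - e) * 2 * N0} \<le> 2 * e"
    using lcs_block_lower[OF e(1,2)] by (elim exE conjE) (rule that)
  note block = k0[rule_format, THEN conjunct1] k0[rule_format, THEN conjunct2]
  \<comment> \<open>Normalised so that a block of typical length \<open>2 * N0\<close> contributes
    \<open>exp (- 1)\<close>.\<close>
  define t where "t = 1 / (2 * N0)"
  have t: "0 < t"
    using N0 by (simp add: t_def)
  have "measure_pmf.prob (words k n n) {x. lcs (fst x) (snd x) \<le> (1 - \<epsilon>) * (2 * real n / sqrt k)} \<le>
      exp (1 - \<epsilon> / (2 * N0) * (real n / sqrt k))" if k: "k > k0" for k n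
  proof -
    define n0 where "n0 = nat \<lceil>N0 * sqrt k\<rceil>"
    define T r where "T = n div n0" and "r = n mod n0"
    define N where "N = real n / sqrt k"
    define \<beta> where "\<beta> = measure_pmf.expectation (words k n0 n0) (\<lambda>x. exp (- t * lcs (fst x) (snd x)))"
    have k': "0 < k" "0 < sqrt (real k)"
      using k by auto
    have fin: "finite (set_pmf (words k m m'))" for m m'
      using k' by simp
    have N: "0 \<le> N"
      by (simp add: N_def)
    have n0: "0 < n0" "real n0 \<le> N0 * sqrt k * (1 + e)"
    proof -
      have "0 < N0 * sqrt k"
        using N0 k' by simp
      then show "0 < n0"
        unfolding n0_def by linarith
      have "real n0 \<le> N0 * sqrt k + 1"
        using \<open>0 < N0 * sqrt k\<close> unfolding n0_def by linarith
      then show "real n0 \<le> N0 * sqrt k * (1 + e)"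
        using block(1)[OF k] by (simp add: algebra_simps)
    qed
    have n: "n = T * n0 + r"
      by (simp add: T_def r_def)
    have "\<beta> \<le> measure_pmf.expectation (words k n0 n0)
        (\<lambda>x. of_bool (lcs (fst x) (snd x) < (1 - e) * 2 * N0) + exp (- (1 - e)))"
      unfolding \<beta>_def
    proof (rule expectation_mono_finite[OF fin])
      fix x :: "nat list \<times> nat list"
      show "exp (- t * lcs (fst x) (snd x)) \<le> of_bool (lcs (fst x) (snd x) < (1 - e) * 2 * N0) + exp (- (1 - e))"
      proof (cases "lcs (fst x) (snd x) < (1 - e) * 2 * N0")
        case True
        have "exp (- t * lcs (fst x) (snd x)) \<le> 1"
          using t by simp
        also have "\<dots> = of_bool (lcs (fst x) (snd x) < (1 - e) * 2 * N0)"
          using True by simp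
        also have "\<dots> \<le> \<dots> + exp (- (1 - e))"
          by simp
        finally show ?thesis .
      next
        case False
        then have "t * ((1 - e) * 2 * N0) \<le> t * lcs (fst x) (snd x)"
          using t by (intro mult_left_mono) auto
        moreover have "t * ((1 - e) * 2 * N0) = 1 - e"
          using N0 by (simp add: t_def)
        ultimately show ?thesis
          using False by simp
      qed
    qed
    also have "\<dots> = measure_pmf.prob (words k n0 n0) {x. lcs (fst x) (snd x) < (1 - e) * 2 * N0} + exp (- (1 - e))"
      unfolding prob_eq_expectation
      by (subst Bochner_Integration.integral_add) (auto intro: integrable_measure_pmf_finite[OF fin])
    also have "\<dots> \<le> 2 * e + exp (- (1 - e))"
      using block(2)[OF k] by (simp add: n0_def)
    \<comment> \<open>As \<open>exp (1 - e) \<le> 3\<close>, the additive failure probability turns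
      into a relative error \<open>6 * e\<close>.\<close>
    also have "\<dots> \<le> exp (- (1 - e)) * (1 + 6 * e)"
    proof -
      have "1 \<le> exp (- (1 - e)) * 3"
      proof -
        have "exp (1 - e) \<le> exp (1 :: real)"
          using e by simp
        also have "\<dots> \<le> 3"
          by (rule exp_le)
        finally show ?thesis
          unfolding exp_minus by (simp add: field_simps)
      qed
      then have "2 * e * 1 \<le> 2 * e * (exp (- (1 - e)) * 3)"
        using e by (intro mult_left_mono) auto
      then show ?thesis
        by (simp add: algebra_simps)
    qed
    also have "\<dots> \<le> exp (- (1 - e)) * exp (6 * e)"
      using exp_ge_add_one_self[of "6 * e"] by (intro mult_left_mono) auto
    also have "\<dots> = exp (- (1 - 7 * e))"
      by (simp flip: exp_add)
    finally have \<beta>: "\<beta> \<le> exp (- (1 - 7 * e))" .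
    have \<beta>0: "0 \<le> \<beta>"
      unfolding \<beta>_def by (intro Bochner_Integration.integral_nonneg) auto
    have "measure_pmf.prob (words k n n) {x. lcs (fst x) (snd x) \<le> (1 - \<epsilon>) * (2 * real n / sqrt k)} =
      measure_pmf.prob (words k n n) {x. - t * ((1 - \<epsilon>) * (2 * N)) \<le> - t * lcs (fst x) (snd x)}"
    proof -
      have iff: "a \<le> b \<longleftrightarrow> - t * b \<le> - t * a" for a b
        using t by simp
      have "2 * real n / sqrt k = 2 * N"
        by (simp add: N_def)
      then show ?thesis
        by (simp only:) (intro arg_cong[where f = "measure_pmf.prob _"] Collect_cong iff)
    qed
    also have "\<dots> \<le> exp (- (- t * ((1 - \<epsilon>) * (2 * N)))) *
        measure_pmf.expectation (words k n n) (\<lambda>x. exp (- t * lcs (fst x) (snd x)))"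
      by (rule exp_Markov[OF fin])
    also have "measure_pmf.expectation (words k n n) (\<lambda>x. exp (- t * lcs (fst x) (snd x))) \<le> \<beta> ^ T"
      using lcs_mgf_lower[OF k'(1) less_imp_le[OF t], of T n0 r] unfolding n[symmetric] \<beta>_def .
    also have "\<beta> ^ T \<le> exp (- (1 - 7 * e)) ^ T"
      using \<beta> \<beta>0 by (rule power_mono)
    also have "exp (- (- t * ((1 - \<epsilon>) * (2 * N)))) * exp (- (1 - 7 * e)) ^ T =
        exp ((1 - \<epsilon>) * (N / N0) - (1 - 7 * e) * T)"
    proof -
      have 1: "- (- t * ((1 - \<epsilon>) * (2 * N))) = (1 - \<epsilon>) * (N / N0)"
        by (simp add: t_def)
      have 2: "exp (- (1 - 7 * e)) ^ T = exp (- ((1 - 7 * e) * T))"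
        by (simp only: exp_of_nat_mult[symmetric] mult_minus_right mult.commute)
      show ?thesis
        unfolding 1 2 exp_add[symmetric] by simp
    qed
    also have "\<dots> \<le> exp (1 - \<epsilon> / (2 * N0) * N)"
    proof -
      define y where "y = N / N0"
      have y: "0 \<le> y"
        using N N0 by (simp add: y_def)
      \<comment> \<open>The number of blocks is \<open>y\<close> up to the relative rounding error
        \<open>e\<close> and one incomplete block; the latter leads to the 1 in the final
        exponent.\<close>
      have "y * (1 - e) - 1 \<le> T"
      proof -
        have "n \<le> (T + 1) * n0"
          using dividend_less_div_times[OF n0(1), of n] by (simp add: T_def)
        then have "real n \<le> real ((T + 1) * n0)"
          by (rule of_nat_mono)
        also have "\<dots> = (T + 1) * real n0"
          by (simp add: algebra_simps)
        also have "\<dots> \<le> (T + 1) * (N0 * sqrt k * (1 + e))"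
          using n0 by (intro mult_left_mono) auto
        finally have "N \<le> (T + 1) * (N0 * (1 + e))"
          using k' by (simp add: N_def field_simps)
        then have "y \<le> (T + 1) * (1 + e)"
          using N0 by (simp add: y_def field_simps)
        then have "y * (1 - e) \<le> (T + 1) * (1 + e) * (1 - e)"
          using e by (intro mult_right_mono) auto
        also have "\<dots> = (T + 1) * (1 - e * e)"
          by (simp add: algebra_simps)
        also have "\<dots> \<le> real (T + 1) * 1"
          by (intro mult_left_mono) auto
        finally show ?thesis
          by simp
      qed
      then have "(1 - 7 * e) * (y * (1 - e) - 1) \<le> (1 - 7 * e) * T"
        using e by (intro mult_left_mono) auto
      moreover have "(1 - 7 * e) * (y * (1 - e) - 1) = y - 8 * e * y + 7 * (e * e) * y - 1 + 7 * e"
        by (simp add: algebra_simps)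
      moreover have "0 \<le> 7 * (e * e) * y"
        using y by simp
      \<comment> \<open>With \<open>e = \<epsilon> / 16\<close> the losses use up half of the
        available \<open>\<epsilon> * y\<close>; the other half is the rate.\<close>
      moreover have "8 * e * y = \<epsilon> / (2 * N0) * N" "(1 - \<epsilon>) * y = y - 2 * (\<epsilon> / (2 * N0) * N)"
        using N0 by (simp_all add: y_def e_def field_simps)
      ultimately have "(1 - \<epsilon>) * y - (1 - 7 * e) * T \<le> 1 - \<epsilon> / (2 * N0) * N"
        using e by linarith
      then show ?thesis
        by (simp add: y_def)
    qed
    finally show ?thesis
      by (simp add: N_def)
  qed
  moreover have "0 < \<epsilon> / (2 * N0)"
    using \<epsilon> N0 by simp
  ultimately show ?thesis
    by blast
qed

theorem theorem1:
  "\<forall>\<epsilon>::real. \<epsilon> > 0 \<longrightarrow>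
     (\<exists>(k\<^sub>0::nat) (C::real).
        (\<forall>(k::nat) (n::nat). k > k\<^sub>0 \<and> n > 0 \<and> real n / sqrt (real k) > C \<longrightarrow>
           (1 - \<epsilon>) * (2 * real n / sqrt (real k))
             \<le> measure_pmf.expectation (random_words_graph n k) (\<lambda>G. real (max_planar_matching G)) \<and>
           measure_pmf.expectation (random_words_graph n k) (\<lambda>G. real (max_planar_matching G))
             \<le> (1 + \<epsilon>) * (2 * real n / sqrt (real k))) \<and>
        (\<exists>c::real. c > 0 \<and>
           (\<forall>(k::nat) (n::nat). k > k\<^sub>0 \<and> n > 0 \<and> real n / sqrt (real k) > C \<longrightarrow>
              measure_pmf.prob (random_words_graph n k)
                {G. \<bar>real (max_planar_matching G) - 2 * real n / sqrt (real k)\<bar>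
                      \<ge> \<epsilon> * (2 * real n / sqrt (real k))}
                \<le> exp (- c * real n / sqrt (real k)))))"
proof (intro allI impI)
  fix \<epsilon> :: real assume \<epsilon>: "\<epsilon> > 0"
  \<comment> \<open>Half of \<open>\<epsilon>\<close>, so that additive constants fit into the other
    half; the minimum meets the restriction to parameters at most 1 in \<open>words_upper\<close>
    and \<open>words_lower\<close>.\<close>
  define \<delta> where "\<delta> = min \<epsilon> 1 / 2"
  have \<delta>: "0 < \<delta>" "\<delta> \<le> 1" "2 * \<delta> \<le> \<epsilon>" "2 * \<delta> \<le> 1"
    using \<epsilon> by (auto simp: \<delta>_def)
  obtain k1 c1 D where c1: "0 < c1" and upper: "\<And>k n. k > k1 \<Longrightarrow>
      measure_pmf.prob (words k n n) {x. (1 + \<delta>) * (2 * real n / sqrt (real k)) \<le> lcs (fst x) (snd x)} \<le>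
        exp (D - c1 * (real n / sqrt (real k)))"
    "\<And>k n. k > k1 \<Longrightarrow> measure_pmf.expectation (words k n n) (\<lambda>x. lcs (fst x) (snd x)) \<le>
        (1 + \<delta>) * (2 * real n / sqrt (real k)) + D"
    using words_upper[OF \<delta>(1,2)] by blast
  obtain k2 c2 where c2: "0 < c2" and lower: "\<And>k n. k > k2 \<Longrightarrow>
      measure_pmf.prob (words k n n) {x. lcs (fst x) (snd x) \<le> (1 - \<delta>) * (2 * real n / sqrt (real k))} \<le>
        exp (1 - c2 * (real n / sqrt (real k)))"
    using words_lower[OF \<delta>(1,2)] by blast
  define c where "c = min c1 c2 / 2"
  \<comment> \<open>The \<open>+ 1\<close> pays for the factor 2 of the union bound, by
    \<open>2 \<le> exp 1\<close>.\<close>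
  define B where "B = max D 1 + 1"
  \<comment> \<open>The summands absorb \<open>B\<close> in the exponent at the price of half the
    rate, make the lower tail at most \<open>\<delta>\<close>, and make \<open>D\<close> at most
    \<open>\<delta> * N\<close> in the mean.\<close>
  define C where "C = B / c + (1 - ln \<delta>) / c2 + B / \<delta>"
  have c: "0 < c" "2 * c \<le> c1" "2 * c \<le> c2"
    using c1 c2 by (auto simp: c_def)
  have B: "2 \<le> B" "D + 1 \<le> B"
    by (auto simp: B_def)
  have "0 \<le> 1 - ln \<delta>"
    using ln_le_zero_iff[of \<delta>] \<delta> by linarith
  then have "0 \<le> B / c" "0 \<le> (1 - ln \<delta>) / c2" "0 \<le> B / \<delta>"
    using B c c2 \<delta> by (auto intro!: divide_nonneg_pos simp del: diff_ge_0_iff_ge)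
  then have C: "0 \<le> C" "B / c \<le> C" "(1 - ln \<delta>) / c2 \<le> C" "B / \<delta> \<le> C"
    unfolding C_def by linarith+
  have expectation: "measure_pmf.expectation (random_words_graph n k) (\<lambda>G. real (max_planar_matching G)) =
      measure_pmf.expectation (words k n n) (\<lambda>x. lcs (fst x) (snd x))" for n k
    by (simp add: random_words_graph_eq_words)
  have main: "(1 - \<epsilon>) * (2 * N) \<le> measure_pmf.expectation (words k n n) (\<lambda>x. lcs (fst x) (snd x))"
    "measure_pmf.expectation (words k n n) (\<lambda>x. lcs (fst x) (snd x)) \<le> (1 + \<epsilon>) * (2 * N)"
    "measure_pmf.prob (words k n n) {x. \<bar>real (lcs (fst x) (snd x)) - 2 * N\<bar> \<ge> \<epsilon> * (2 * N)} \<le> exp (- c * N)"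
    if k: "k > max k1 k2" and N: "N = real n / sqrt (real k)" "N > C" for k n N
  proof -
    let ?M = "words k n n"
    have k': "k > k1" "k > k2" "0 < k"
      using k by auto
    have fin: "finite (set_pmf ?M)"
      using k' by simp
    have N0: "0 < N" "B / c < N" "(1 - ln \<delta>) / c2 < N" "B / \<delta> < N"
      using N C by linarith+
    have up: "measure_pmf.prob ?M {x. (1 + \<delta>) * (2 * N) \<le> lcs (fst x) (snd x)} \<le> exp (D - c1 * N)"
      "measure_pmf.expectation ?M (\<lambda>x. lcs (fst x) (snd x)) \<le> (1 + \<delta>) * (2 * N) + D"
      using upper[OF k'(1), of n] by (simp_all add: N(1))
    have low: "measure_pmf.prob ?M {x. lcs (fst x) (snd x) \<le> (1 - \<delta>) * (2 * N)} \<le> exp (1 - c2 * N)"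
      using lower[OF k'(2), of n] by (simp add: N(1))
    define a b where "a = \<delta> * N" and "b = \<epsilon> * N"
    have ab: "B < a" "2 * a \<le> b"
      using N0(4) \<delta> mult_right_mono[OF \<delta>(3), of N] N0(1) by (simp_all add: a_def b_def field_simps)
    note up(2)
    also have "(1 + \<delta>) * (2 * N) + D = 2 * N + 2 * a + D"
      by (simp add: a_def algebra_simps)
    also have "\<dots> \<le> 2 * N + 2 * b"
      using ab B by linarith
    also have "\<dots> = (1 + \<epsilon>) * (2 * N)"
      by (simp add: b_def algebra_simps)
    finally show "measure_pmf.expectation ?M (\<lambda>x. lcs (fst x) (snd x)) \<le> (1 + \<epsilon>) * (2 * N)" .
    have "1 - ln \<delta> < c2 * N"
      using N0(3) c2 by (simp add: field_simps)
    then have "exp (1 - c2 * N) \<le> exp (ln \<delta>)"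
      by simp
    then have small: "measure_pmf.prob ?M {x. lcs (fst x) (snd x) \<le> (1 - \<delta>) * (2 * N)} \<le> \<delta>"
      using low \<delta> by simp
    have "0 \<le> \<delta> * \<delta>"
      by simp
    \<comment> \<open>The lower bound for the mean loses one factor \<open>1 - \<delta>\<close> to
      the deviation and another to the exceptional event.\<close>
    then have "1 - \<epsilon> \<le> 1 - 2 * \<delta> + \<delta> * \<delta>"
      using \<delta>(3) by linarith
    then have "(1 - \<epsilon>) * (2 * N) \<le> (1 - 2 * \<delta> + \<delta> * \<delta>) * (2 * N)"
      using N0 by (intro mult_right_mono) auto
    also have "\<dots> = (1 - \<delta>) * (2 * N) * (1 - \<delta>)"
      by (simp add: algebra_simps)
    also have "\<dots> \<le> (1 - \<delta>) * (2 * N) * (1 - measure_pmf.prob ?M {x. lcs (fst x) (snd x) \<le> (1 - \<delta>) * (2 * N)})"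
      using small \<delta> N0 by (intro mult_left_mono) auto
    also have "\<dots> = measure_pmf.expectation ?M (\<lambda>x. (1 - \<delta>) * (2 * N) * (1 - of_bool (lcs (fst x) (snd x) \<le> (1 - \<delta>) * (2 * N))))"
      unfolding prob_eq_expectation
      by (simp add: Bochner_Integration.integral_diff integrable_measure_pmf_finite[OF fin] del: mult_minus_right)
    also have "\<dots> \<le> measure_pmf.expectation ?M (\<lambda>x. lcs (fst x) (snd x))"
      by (rule expectation_mono_finite[OF fin]) auto
    finally show "(1 - \<epsilon>) * (2 * N) \<le> measure_pmf.expectation ?M (\<lambda>x. lcs (fst x) (snd x))" .
    have "\<delta> * (2 * N) \<le> \<epsilon> * (2 * N)"
      using \<delta> N0 by (intro mult_right_mono) auto
    then have "measure_pmf.prob ?M {x. \<bar>real (lcs (fst x) (snd x)) - 2 * N\<bar> \<ge> \<epsilon> * (2 * N)} \<le>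
      measure_pmf.prob ?M ({x. (1 + \<delta>) * (2 * N) \<le> lcs (fst x) (snd x)} \<union> {x. lcs (fst x) (snd x) \<le> (1 - \<delta>) * (2 * N)})"
    proof (intro measure_pmf.finite_measure_mono subsetI)
      fix x assume "x \<in> {x. \<bar>real (lcs (fst x) (snd x)) - 2 * N\<bar> \<ge> \<epsilon> * (2 * N)}"
      then have "2 * N + \<delta> * (2 * N) \<le> lcs (fst x) (snd x) \<or> lcs (fst x) (snd x) \<le> 2 * N - \<delta> * (2 * N)"
        using \<open>\<delta> * (2 * N) \<le> \<epsilon> * (2 * N)\<close> by (simp only: mem_Collect_eq) linarith
      then show "x \<in> {x. (1 + \<delta>) * (2 * N) \<le> lcs (fst x) (snd x)} \<union> {x. lcs (fst x) (snd x) \<le> (1 - \<delta>) * (2 * N)}"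
        by (simp only: Un_iff mem_Collect_eq left_diff_distrib distrib_right mult_1)
    qed simp
    also have "\<dots> \<le> exp (D - c1 * N) + exp (1 - c2 * N)"
      by (intro order_trans[OF prob_Un_le] add_mono up low)
    also have "\<dots> \<le> exp (B - 1 - 2 * c * N) + exp (B - 1 - 2 * c * N)"
    proof -
      have "2 * c * N \<le> c1 * N" "2 * c * N \<le> c2 * N"
        using c N0 by (auto intro!: mult_right_mono)
      then show ?thesis
        using B by (intro add_mono) auto
    qed
    also have "\<dots> \<le> exp 1 * exp (B - 1 - 2 * c * N)"
      using exp_ge_add_one_self[of 1] mult_right_mono[of 2 "exp 1" "exp (B - 1 - 2 * c * N)"] by simp
    also have "\<dots> = exp (B - 2 * c * N)"
      by (simp flip: exp_add)
    also have "\<dots> \<le> exp (- c * N)"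
      using N0(2) c by (simp add: field_simps)
    finally show "measure_pmf.prob ?M {x. \<bar>real (lcs (fst x) (snd x)) - 2 * N\<bar> \<ge> \<epsilon> * (2 * N)} \<le> exp (- c * N)" .
  qed
  show "\<exists>(k\<^sub>0::nat) (C::real).
        (\<forall>(k::nat) (n::nat). k > k\<^sub>0 \<and> n > 0 \<and> real n / sqrt (real k) > C \<longrightarrow>
           (1 - \<epsilon>) * (2 * real n / sqrt (real k))
             \<le> measure_pmf.expectation (random_words_graph n k) (\<lambda>G. real (max_planar_matching G)) \<and>
           measure_pmf.expectation (random_words_graph n k) (\<lambda>G. real (max_planar_matching G))
             \<le> (1 + \<epsilon>) * (2 * real n / sqrt (real k))) \<and>
        (\<exists>c::real. c > 0 \<and>
           (\<forall>(k::nat) (n::nat). k > k\<^sub>0 \<and> n > 0 \<and> real n / sqrt (real k) > C \<longrightarrow>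
              measure_pmf.prob (random_words_graph n k)
                {G. \<bar>real (max_planar_matching G) - 2 * real n / sqrt (real k)\<bar>
                      \<ge> \<epsilon> * (2 * real n / sqrt (real k))}
                \<le> exp (- c * real n / sqrt (real k))))"
  proof (rule exI[of _ "max k1 k2"], rule exI[of _ C], intro conjI exI[of _ c] allI impI)
    show "0 < c"
      by (rule c)
  next
    fix k n :: nat assume kn: "k > max k1 k2 \<and> n > 0 \<and> real n / sqrt (real k) > C"
    note * = main[OF _ refl, of k n]
    show "(1 - \<epsilon>) * (2 * real n / sqrt (real k))
        \<le> measure_pmf.expectation (random_words_graph n k) (\<lambda>G. real (max_planar_matching G))"
      using *(1) kn unfolding expectation by simp
    show "measure_pmf.expectation (random_words_graph n k) (\<lambda>G. real (max_planar_matching G))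
        \<le> (1 + \<epsilon>) * (2 * real n / sqrt (real k))"
      using *(2) kn unfolding expectation by simp
  next
    fix k n :: nat assume kn: "k > max k1 k2 \<and> n > 0 \<and> real n / sqrt (real k) > C"
    note * = main[OF _ refl, of k n]
    show "measure_pmf.prob (random_words_graph n k)
        {G. \<bar>real (max_planar_matching G) - 2 * real n / sqrt (real k)\<bar> \<ge> \<epsilon> * (2 * real n / sqrt (real k))}
        \<le> exp (- c * real n / sqrt (real k))"
      using *(3) kn by (simp add: random_words_graph_eq_words vimage_def)
  qed
qed

end
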